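(* Let $\{(G_t,Y_t)\}_{t\ge 0}$ be a DED process with period $K$, parameter set $\Theta\subseteq\mathbb R^d$, event probabilities $p_t(\theta)=1-\exp(-\lambda_t(\theta))$ with $\lambda_t=\lambda_{t\bmod K}$, and limiting gating frequencies $\gamma(\theta)$. Let $\theta_0\in\operatorname{int}(\Theta)$, and assume: (1) there are constants $0<\lambda_{\min}\le\lambda_{\max}<\infty$ with $\lambda_{\min}\le\lambda_r(\theta)\le\lambda_{\max}$ for all $r=0,\dots,K-1$ and $\theta\in\Theta$; (2) for each $r=0,\dots,K-1$, $\lambda_r:\Theta\to\mathbb R$ extends to a $C^3$ map on an open set containing $\Theta$; (3) if $\theta\in\Theta$ satisfies $\lambda_r(\theta)=\lambda_r(\theta_0)$ for all $r$ with $\gamma_r(\theta_0)>0$, then $\theta=\theta_0$; (4) $\Theta$ is compact; (5) the matrix $\mathcal I_0=\mathcal I(\theta_0;\gamma(\theta_0))$ is positive definite. Define the normalized score $$\Delta_t(\theta_0)=\frac1{\sqrt t}\sum_{r=0}^{t-1}G_r\,\frac{Y_r-p_r(\theta_0)}{p_r(\theta_0)}\,\nabla\lambda_r(\theta_0).$$ Then, as $t\to\infty$: 1. For every bounded sequence $(h_t)$ in $\mathbb R^d$, the sequences $P_{\theta_0+h_t/\sqrt t,\,t}$ and $P_{\theta_0,t}$ are mutually contiguous. 2. For every bounded sequence $(h_t)$ in $\mathbb R^d$, $$\log\frac{dP_{\theta_0+h_t/\sqrt t,\,t}}{dP_{\theta_0,t}}=h_t^\top\Delta_t(\theta_0)-\tfrac12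 h_t^\top\mathcal I_0h_t+o_{P_{\theta_0,t}}(1).$$ 3. Under $P_{\theta_0,t}$, $\Delta_t(\theta_0)\Rightarrow\mathcal N(0,\mathcal I_0)$ (convergence in distribution). (For bounded $h_t$ one has $\theta_0+h_t/\sqrt t\in\Theta$ for all sufficiently large $t$, so the statements make sense.)
   Context: $\mathbb N=\{0,1,2,\dots\}$. Fix an integer $K\ge 1$ (period), an integer $D\in\mathbb N$ (dead time), and a parameter set $\Theta\subseteq\mathbb R^d$. For each $\theta\in\Theta$ let $p_t(\theta)\in[0,1]$, $t\in\mathbb N$, with $p_{t+K}(\theta)=p_t(\theta)$, written $p_t(\theta)=1-\exp(-\lambda_t(\theta))$. A DED (dead-time event detection) process is a stochastic process $\{(G_t,Y_t)\}_{t\ge0}$ with $G_t,Y_t\in\{0,1\}$, whose law under parameter $\theta$ is denoted $P_\theta$, such that: (i) (observation) under $P_\theta$ there are independent $Z_t\sim\mathrm{Ber}(p_t(\theta))$, $t\in\mathbb N$, with $Y_t=G_tZ_t$; (ii) (dead time) almost surely, $Y_t=1$ implies $G_s=0$ for all $s\in\{t+1,\dots,t+D\}$; (iii) (causality) for every $t$ there are $U_t\sim\mathrm{Unif}([0,1])$, jointly independent of the event sequence $\{Z_s\}_{s\ge0}$ and the past observations $\{(G_s,Y_s)\}_{s=0}^{t-1}$, and a measurable map $\Phi_t:\{0,1\}^{2t}\times[0,1]\to\{0,1\}$, not depending on $\theta$, such that $G_t=\Phi_t(G_0,Y_0,\dots,G_{t-1},Y_{t-1},U_t)$ a.s.; (iv)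 (gating-frequency convergence) for every $\theta\in\Theta$ there is $\gamma(\theta)\in[0,1]^K$ such that for each $r=0,\dots,K-1$, $\frac1L\sum_{\ell=0}^{L-1}G_{r+\ell K}\to\gamma_r(\theta)$ in $P_\theta$-probability as $L\to\infty$. $P_{\theta,T}$ denotes the law of $X_{0:T-1}=((G_0,Y_0),\dots,(G_{T-1},Y_{T-1}))$ under $\theta$. Fisher information: for $r=0,\dots,K-1$, $\mathcal I_r(\theta)=\frac{1-p_r(\theta)}{p_r(\theta)}\nabla\lambda_r(\theta)\nabla\lambda_r(\theta)^\top$; for $\alpha\in[0,1]^K$, $\mathcal I(\theta;\alpha)=\frac1K\sum_{r=0}^{K-1}\alpha_r\mathcal I_r(\theta)$. *)

theory Defs
  imports "HOL-Probability.Probability"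
begin

section \<open>Calculus and linear algebra\<close>

text \<open>Iterated Frechet differentiability; for open \<open>S\<close> this says that \<open>f\<close> is of class \<open>C\<^sup>k\<close>
  on \<open>S\<close>.\<close>

primrec Ck_on :: "nat \<Rightarrow> 'a::real_normed_vector set \<Rightarrow> ('a \<Rightarrow> 'b::real_normed_vector) \<Rightarrow> bool" where
  "Ck_on 0 S f \<longleftrightarrow> continuous_on S f"
| "Ck_on (Suc k) S f \<longleftrightarrow>
     (\<forall>x\<in>S. f differentiable (at x)) \<and>
     (\<forall>v. Ck_on k S (\<lambda>x. frechet_derivative f (at x) v))"

definition grad :: "('a::real_inner \<Rightarrow> real) \<Rightarrow> 'a \<Rightarrow> 'a" where
  "grad f x = (THE D. GDERIV f x :> D)"

definition outer_prod :: "real ^ 'd \<Rightarrow> real ^ 'd \<Rightarrow> real ^ 'd ^ 'd" where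
  "outer_prod u v = (\<chi> i j. u $ i * v $ j)"

definition pos_def_matrix :: "real ^ 'd ^ 'd \<Rightarrow> bool" where
  "pos_def_matrix A \<longleftrightarrow> transpose A = A \<and> (\<forall>x. x \<noteq> 0 \<longrightarrow> x \<bullet> (A *v x) > 0)"


section \<open>Asymptotic notions for sequences of probability measures\<close>

text \<open>The underlying measure may vary with \<open>n\<close>, so this is \<open>X\<^sub>n = o\<^sub>P(1)\<close> under \<open>P\<^sub>n\<close>.\<close>

definition tendsto0_in_prob :: "(nat \<Rightarrow> 'a measure) \<Rightarrow> (nat \<Rightarrow> 'a \<Rightarrow> real) \<Rightarrow> bool" where
  "tendsto0_in_prob P X \<longleftrightarrow>
     (\<forall>\<epsilon>>0. (\<lambda>n. measure (P n) {x \<in> space (P n). \<bar>X n x\<bar> > \<epsilon>}) \<longlonglongrightarrow> 0)"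

definition contiguous_to :: "(nat \<Rightarrow> 'a measure) \<Rightarrow> (nat \<Rightarrow> 'a measure) \<Rightarrow> bool" where
  "contiguous_to Q P \<longleftrightarrow>
     (\<forall>A. (\<forall>n. A n \<in> sets (P n)) \<longrightarrow>
          (\<lambda>n. measure (P n) (A n)) \<longlonglongrightarrow> 0 \<longrightarrow> (\<lambda>n. measure (Q n) (A n)) \<longlonglongrightarrow> 0)"

definition mutually_contiguous :: "(nat \<Rightarrow> 'a measure) \<Rightarrow> (nat \<Rightarrow> 'a measure) \<Rightarrow> bool" where
  "mutually_contiguous P Q \<longleftrightarrow> contiguous_to P Q \<and> contiguous_to Q P"

definition weakly_converges :: "(nat \<Rightarrow> 'a::topological_space measure) \<Rightarrow> 'a measure \<Rightarrow> bool" where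
  "weakly_converges \<mu> \<nu> \<longleftrightarrow>
     (\<forall>f :: 'a \<Rightarrow> real. continuous_on UNIV f \<longrightarrow> bounded (range f) \<longrightarrow>
        (\<lambda>n. integral\<^sup>L (\<mu> n) f) \<longlonglongrightarrow> integral\<^sup>L \<nu> f)"

text \<open>The law \<open>N(m, \<Sigma>)\<close> for a positive definite covariance matrix \<open>\<Sigma>\<close>.\<close>

definition multivariate_normal :: "real ^ 'd \<Rightarrow> real ^ 'd ^ 'd \<Rightarrow> (real ^ 'd) measure" where
  "multivariate_normal m \<Sigma> = density lborel (\<lambda>x. ennreal
     (exp (- ((x - m) \<bullet> (matrix_inv \<Sigma> *v (x - m))) / 2) / sqrt ((2 * pi) ^ CARD('d) * det \<Sigma>)))"


section \<open>Dead-time event detection processes\<close>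

text \<open>The values 1 and 0 are encoded as \<open>True\<close> and \<open>False\<close>; a history
  \<open>((G\<^sub>0,Y\<^sub>0), \<dots>, (G\<^sub>t\<^sub>-\<^sub>1,Y\<^sub>t\<^sub>-\<^sub>1))\<close> is a list of length \<open>t\<close>.\<close>

definition histories :: "nat \<Rightarrow> (bool \<times> bool) list set" where
  "histories t = {xs. length xs = t}"

definition history :: "(nat \<Rightarrow> 'w \<Rightarrow> bool) \<Rightarrow> (nat \<Rightarrow> 'w \<Rightarrow> bool) \<Rightarrow> nat \<Rightarrow> 'w \<Rightarrow> (bool \<times> bool) list" where
  "history G Y t \<omega> = map (\<lambda>s. (G s \<omega>, Y s \<omega>)) [0..<t]"

definition history_law ::
    "('p \<Rightarrow> 'w measure) \<Rightarrow> (nat \<Rightarrow> 'w \<Rightarrow> bool) \<Rightarrow> (nat \<Rightarrow> 'w \<Rightarrow> bool) \<Rightarrow> 'p \<Rightarrow> nat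
     \<Rightarrow> (bool \<times> bool) list measure" where
  "history_law M G Y \<theta> T = distr (M \<theta>) (count_space (histories T)) (history G Y T)"

text \<open>\<open>M \<theta>\<close> is the probability measure on the sample space under parameter \<open>\<theta>\<close>. The variables
  \<open>Z\<close> and \<open>U\<close> may depend on \<open>\<theta>\<close>, the gating maps \<open>\<Phi>\<close> may not. For each \<open>t\<close> separately, \<open>U\<close> is
  independent of the pair consisting of the whole event sequence \<open>Z\<close> and the history up to time \<open>t\<close>
  (these two components need not be independent of each other). This is written with
  \<open>indep_set\<close>, since \<open>indep_var\<close> requires both variables to have the same range type.\<close>

definition ded_process ::
    "nat \<Rightarrow> nat \<Rightarrow> 'p set \<Rightarrow> (nat \<Rightarrow> 'p \<Rightarrow> real) \<Rightarrow> ('p \<Rightarrow> nat \<Rightarrow> real)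
     \<Rightarrow> ('p \<Rightarrow> 'w measure) \<Rightarrow> (nat \<Rightarrow> 'w \<Rightarrow> bool) \<Rightarrow> (nat \<Rightarrow> 'w \<Rightarrow> bool) \<Rightarrow> bool" where
  "ded_process K D \<Theta> p \<gamma> M G Y \<longleftrightarrow>
     K \<ge> 1 \<and>
     (\<forall>\<theta>\<in>\<Theta>. \<forall>t. 0 \<le> p t \<theta> \<and> p t \<theta> \<le> 1 \<and> p (t + K) \<theta> = p t \<theta>) \<and>
     (\<forall>\<theta>\<in>\<Theta>. prob_space (M \<theta>) \<and>
        (\<forall>t. G t \<in> measurable (M \<theta>) (count_space UNIV) \<and>
             Y t \<in> measurable (M \<theta>) (count_space UNIV))) \<and>
     \<comment> \<open>observation and causality\<close>
     (\<exists>\<Phi> :: nat \<Rightarrow> (bool \<times> bool) list \<Rightarrow> real \<Rightarrow> bool.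
        (\<forall>t. (\<lambda>(xs, u). \<Phi> t xs u) \<in>
             measurable (count_space (histories t) \<Otimes>\<^sub>M restrict_space borel {0..1})
                        (count_space UNIV)) \<and>
        (\<forall>\<theta>\<in>\<Theta>. \<exists>Z :: nat \<Rightarrow> 'w \<Rightarrow> bool.
           prob_space.indep_vars (M \<theta>) (\<lambda>_. count_space UNIV) Z UNIV \<and>
           (\<forall>t. distr (M \<theta>) (count_space UNIV) (Z t) = measure_pmf (bernoulli_pmf (p t \<theta>))) \<and>
           (AE \<omega> in M \<theta>. \<forall>t. Y t \<omega> = (G t \<omega> \<and> Z t \<omega>)) \<and>
           (\<forall>t. \<exists>U :: 'w \<Rightarrow> real.
              U \<in> borel_measurable (M \<theta>) \<and>
              distr (M \<theta>) lborel U = uniform_measure lborel {0..1} \<and>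
              prob_space.indep_set (M \<theta>)
                (sets (vimage_algebra (space (M \<theta>)) U borel))
                (sets (vimage_algebra (space (M \<theta>))
                   (\<lambda>\<omega>. ((\<lambda>s. Z s \<omega>), history G Y t \<omega>))
                   ((\<Pi>\<^sub>M s\<in>UNIV. count_space UNIV) \<Otimes>\<^sub>M count_space (histories t)))) \<and>
              (AE \<omega> in M \<theta>. G t \<omega> = \<Phi> t (history G Y t \<omega>) (U \<omega>))))) \<and>
     \<comment> \<open>dead time\<close>
     (\<forall>\<theta>\<in>\<Theta>. AE \<omega> in M \<theta>. \<forall>t. Y t \<omega> \<longrightarrow> (\<forall>s\<in>{t+1..t+D}. \<not> G s \<omega>)) \<and>
     \<comment> \<open>convergence of the gating frequencies\<close>
     (\<forall>\<theta>\<in>\<Theta>. \<forall>r<K. 0 \<le> \<gamma> \<theta> r \<and> \<gamma> \<theta> r \<le> 1 \<and>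
        tendsto0_in_prob (\<lambda>_. M \<theta>)
          (\<lambda>L \<omega>. (\<Sum>l<L. of_bool (G (r + l * K) \<omega>)) / real L - \<gamma> \<theta> r))"

definition fisher_component ::
    "(nat \<Rightarrow> real ^ 'd \<Rightarrow> real) \<Rightarrow> (nat \<Rightarrow> real ^ 'd \<Rightarrow> real) \<Rightarrow> nat \<Rightarrow> real ^ 'd \<Rightarrow> real ^ 'd ^ 'd" where
  "fisher_component p lam r \<theta> =
     ((1 - p r \<theta>) / p r \<theta>) *\<^sub>R outer_prod (grad (lam r) \<theta>) (grad (lam r) \<theta>)"

definition fisher_information ::
    "nat \<Rightarrow> (nat \<Rightarrow> real ^ 'd \<Rightarrow> real) \<Rightarrow> (nat \<Rightarrow> real ^ 'd \<Rightarrow> real) \<Rightarrow> real ^ 'd \<Rightarrow> (nat \<Rightarrow> real)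
     \<Rightarrow> real ^ 'd ^ 'd" where
  "fisher_information K p lam \<theta> \<alpha> = (1 / real K) *\<^sub>R (\<Sum>r<K. \<alpha> r *\<^sub>R fisher_component p lam r \<theta>)"

definition normalized_score ::
    "(nat \<Rightarrow> real ^ 'd \<Rightarrow> real) \<Rightarrow> (nat \<Rightarrow> real ^ 'd \<Rightarrow> real) \<Rightarrow> real ^ 'd \<Rightarrow> nat
     \<Rightarrow> (bool \<times> bool) list \<Rightarrow> real ^ 'd" where
  "normalized_score p lam \<theta> t xs =
     (1 / sqrt (real t)) *\<^sub>R
       (\<Sum>r<t. (of_bool (fst (xs ! r)) * ((of_bool (snd (xs ! r)) - p r \<theta>) / p r \<theta>)) *\<^sub>R
               grad (lam r) \<theta>)"

text \<open>Meaningful when \<open>Q\<close> is absolutely continuous with respect to \<open>P\<close>. For history laws this is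
  the case whenever the event probabilities lie strictly between 0 and 1, since the gating maps do
  not depend on the parameter.\<close>

definition log_lr :: "'a measure \<Rightarrow> 'a measure \<Rightarrow> 'a \<Rightarrow> real" where
  "log_lr Q P x = ln (enn2real (RN_deriv P Q x))"

end

theory Submission
  imports Defs "HOL-Real_Asymp.Real_Asymp"
begin

text \<open>Given the past, the gating variable has a parameter-free conditional law, so the law of the
  history is a product of gating factors and Bernoulli factors, and only the latter enter the
  likelihood ratio. Hence any product of functions of the single observations whose
  conditional mean is 1 in each step has mean 1.

  Contiguity then needs no limit theorem: the second moment of the likelihood ratio is at most
  \<open>(1 + C / t) ^ t\<close>, in both directions, and Cauchy-Schwarz bounds one law by the square root of
  the other. For the expansion, the log-likelihood ratio is a linear function of the number of open
  gates and the residual sum in each residue class modulo \<open>K\<close>; the former satisfies a law of large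
  numbers and the latter is a martingale of order \<open>sqrt t\<close>. For the
  central limit theorem, compensating \<open>exp (i u \<bullet> \<Delta>)\<close> by its conditional characteristic functions,
  which depend on the history only through the numbers of open gates, gives a variable of mean 1.\<close>

section \<open>Linear images of Lebesgue measure and the multivariate normal law\<close>

text \<open>The obstacle is the gating: each gate may depend on the whole past, so the residuals are
  not independent and the conditional variance accumulated by time t is random. For fixed t a
  history takes finitely many values, so expectations are finite sums peeled off one observation at
  a time, and in them the gate probabilities only have to be nonnegative and sum to 1. The gating
  frequencies are bounded, so their convergence in probability is convergence in mean, and it is
  used only through mean absolute errors. In the expansion the linear terms cancel in the
  conditional mean of a log-likelihood increment; what is left is of order 1/t and is summed against
  the gate counts. The constant in \<open>(1 + C / t) ^ t\<close> is a chi-square distance of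
  Bernoulli laws, finite because all event probabilities keep a fixed distance from 0 and 1.
  Compensation yields only characteristic functions, while the limit law is given by a density and
  weak convergence by test functions. Hence the need for a linear change of variables, which gives
  the Gaussian transform, and for a continuity theorem in several dimensions, with tightness
  supplied by first moments.\<close>

lemma pos_def_orthonormal_family:
  fixes S :: "real ^ 'd ^ 'd"
  assumes "pos_def_matrix S" and "n \<le> CARD('d)"
  shows "\<exists>e :: nat \<Rightarrow> real ^ 'd. \<forall>i<n. \<forall>j<n. e i \<bullet> (S *v e j) = of_bool (i = j)"
  using assms(2)
proof (induction n)
  case 0
  show ?case by simp
next
  case (Suc n)
  then obtain e :: "nat \<Rightarrow> real ^ 'd"
    where e: "\<And>i j. i < n \<Longrightarrow> j < n \<Longrightarrow> e i \<bullet> (S *v e j) = of_bool (i = j)"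
    by auto
  have sym: "x \<bullet> (S *v y) = y \<bullet> (S *v x)" for x y
    using assms(1) unfolding pos_def_matrix_def
    by (metis dot_lmul_matrix inner_commute transpose_matrix_vector)
  have "dim (e ` {..<n}) \<le> card (e ` {..<n})"
    by (rule dim_le_card') simp
  also have "\<dots> \<le> n"
    using card_image_le[of "{..<n}" e] by simp
  also have "\<dots> < CARD('d)"
    using Suc.prems by simp
  finally have "span (e ` {..<n}) \<noteq> UNIV"
    by (metis dim_span dim_UNIV DIM_cart DIM_real less_irrefl mult.right_neutral)
  then obtain v where v: "v \<notin> span (e ` {..<n})"
    by auto
  \<comment> \<open>Gram-Schmidt for the inner product given by \<open>S\<close>: \<open>w\<close>
    is nonzero because \<open>v\<close> lies outside the span, so positive definiteness permits
    normalising it.\<close>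
  define w where "w = v - (\<Sum>i<n. (v \<bullet> (S *v e i)) *\<^sub>R e i)"
  have "(\<Sum>i<n. (v \<bullet> (S *v e i)) *\<^sub>R e i) \<in> span (e ` {..<n})"
    by (intro span_sum span_scale span_base) auto
  with v have "w \<noteq> 0"
    by (auto simp: w_def)
  then have w_pos: "w \<bullet> (S *v w) > 0"
    using assms(1) unfolding pos_def_matrix_def by auto
  have w_orth: "w \<bullet> (S *v e j) = 0" if "j < n" for j
  proof -
    have "w \<bullet> (S *v e j) = v \<bullet> (S *v e j) - (\<Sum>i<n. (v \<bullet> (S *v e i)) * (e i \<bullet> (S *v e j)))"
      by (simp add: w_def inner_diff_left inner_sum_left)
    also have "(\<Sum>i<n. (v \<bullet> (S *v e i)) * (e i \<bullet> (S *v e j))) = (\<Sum>i<n. if i = j then v \<bullet> (S *v e j) else 0)"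
      by (intro sum.cong) (use that e in auto)
    finally show ?thesis using that by simp
  qed
  define z where "z = (1 / sqrt (w \<bullet> (S *v w))) *\<^sub>R w"
  have z1: "z \<bullet> (S *v z) = 1"
    using w_pos by (simp add: z_def matrix_vector_mult_scaleR field_simps)
  have z0: "z \<bullet> (S *v e j) = 0" if "j < n" for j
    using w_orth[OF that] by (simp add: z_def)
  have "(e(n := z)) i \<bullet> (S *v (e(n := z)) j) = of_bool (i = j)" if "i < Suc n" "j < Suc n" for i j
    using that z1 z0 e sym[of "e i" z] by (cases "i = n"; cases "j = n") (auto simp: less_Suc_eq)
  then show ?case by blast
qed

text \<open>If the columns of \<open>A\<close> are orthonormal for the form of \<open>S\<close>,
  then \<open>transpose A ** S ** A\<close> is the identity, and \<open>S\<close> is recovered from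
  the inverse of \<open>A\<close>; hence \<open>B\<close> is the transposed inverse.\<close>

lemma pos_def_factorization:
  fixes S :: "real ^ 'd ^ 'd"
  assumes "pos_def_matrix S"
  obtains B :: "real ^ 'd ^ 'd" where "invertible B" and "S = B ** transpose B"
proof -
  obtain e :: "nat \<Rightarrow> real ^ 'd"
    where e: "\<And>i j. i < CARD('d) \<Longrightarrow> j < CARD('d) \<Longrightarrow> e i \<bullet> (S *v e j) = of_bool (i = j)"
    using pos_def_orthonormal_family[OF assms order_refl] by auto
  \<comment> \<open>\<open>b\<close> transfers the family from numbers to the index type
    \<open>'d\<close>, where its vectors become the columns of \<open>A\<close>.\<close>
  obtain b :: "'d \<Rightarrow> nat" where b: "bij_betw b UNIV {0..<CARD('d)}"
    using ex_bij_betw_finite_nat[OF finite_class.finite_UNIV] by blast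
  have b_less: "b i < CARD('d)" for i
    using b unfolding bij_betw_def by (metis atLeastLessThan_iff rangeI)
  have b_eq: "b i = b j \<longleftrightarrow> i = j" for i j
    using b unfolding bij_betw_def inj_on_def by auto
  define A :: "real ^ 'd ^ 'd" where "A = (\<chi> i j. e (b j) $ i)"
  have "(transpose A ** S ** A) $ i $ j = e (b i) \<bullet> (S *v e (b j))" for i j
    unfolding matrix_mul_assoc[symmetric]
    by (simp add: A_def matrix_matrix_mult_def transpose_def inner_vec_def matrix_vector_mult_def)
  then have one: "transpose A ** S ** A = mat 1"
    by (simp add: vec_eq_iff e b_less b_eq mat_def)
  then have invA: "invertible A"
    unfolding invertible_left_inverse by blast
  define B where "B = transpose (matrix_inv A)"
  have AA: "matrix_inv A ** A = mat 1" "A ** matrix_inv A = mat 1"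
    using invA unfolding invertible_def matrix_inv_def by (metis (mono_tags, lifting) someI_ex)+
  have AT: "transpose (matrix_inv A) ** transpose A = mat 1"
    by (metis AA(2) matrix_transpose_mul transpose_mat)
  have "S = (transpose (matrix_inv A) ** transpose A) ** S ** (A ** matrix_inv A)"
    by (simp add: AA AT)
  also have "\<dots> = transpose (matrix_inv A) ** (transpose A ** S ** A) ** matrix_inv A"
    by (simp only: matrix_mul_assoc)
  also have "\<dots> = B ** transpose B"
    by (simp add: one B_def)
  finally have "S = B ** transpose B" .
  moreover have "invertible B"
    unfolding B_def invertible_right_inverse using AT by blast
  ultimately show ?thesis using that by blast
qed

section \<open>Linear change of variables for Lebesgue measure\<close>

lemma nn_integral_lborel_diagonal:
  fixes f :: "real ^ 'd \<Rightarrow> ennreal" and A :: "real ^ 'd ^ 'd"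
  assumes [measurable]: "f \<in> borel_measurable borel"
    and diag: "\<And>i j. i \<noteq> j \<Longrightarrow> A $ i $ j = 0" and inv: "invertible A"
  shows "ennreal \<bar>det A\<bar> * (\<integral>\<^sup>+ x. f (A *v x) \<partial>lborel) = (\<integral>\<^sup>+ x. f x \<partial>lborel)"
proof -
  have det: "det A = (\<Prod>i\<in>UNIV. A $ i $ i)"
    using diag by (rule det_diagonal)
  have nz: "A $ i $ i \<noteq> 0" for i
    using inv det by (auto simp: invertible_det_nz)
  \<comment> \<open>The affine image formula scales along basis vectors, so the factors are indexed
    by them: \<open>c (axis i 1)\<close> is the diagonal entry \<open>A $ i $ i\<close>.\<close>
  define c where "c = (\<lambda>b :: real ^ 'd. b \<bullet> (A *v b))"
  have c_axis: "c (axis i 1) = A $ i $ i" for i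
    by (simp add: c_def inner_axis' matrix_vector_mult_basis column_def)
  have T: "(\<Sum>j\<in>Basis. (c j * (x \<bullet> j)) *\<^sub>R j) = A *v x" for x
  proof -
    have "(\<Sum>j\<in>Basis. (c j * (x \<bullet> j)) *\<^sub>R j) = (\<Sum>i\<in>UNIV. (A $ i $ i * x $ i) *\<^sub>R axis i 1)"
      by (simp add: Basis_vec_def Union_eq[symmetric] UNION_singleton_eq_range sum.reindex inj_on_def axis_eq_axis c_axis inner_axis)
    also have "\<dots> = A *v x"
    proof (simp add: vec_eq_iff, intro allI)
      fix k
      have "(\<Sum>i\<in>UNIV. A $ i $ i * x $ i * axis i 1 $ k) = (\<Sum>i\<in>UNIV. if i = k then A $ k $ k * x $ k else 0)"
        by (intro sum.cong) (auto simp: axis_def)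
      also have "\<dots> = A $ k $ k * x $ k" by simp
      also have "\<dots> = (A *v x) $ k"
        using diag by (simp add: matrix_vector_mult_def sum.remove[of UNIV k])
      finally show "(\<Sum>i\<in>UNIV. A $ i $ i * x $ i * axis i 1 $ k) = (A *v x) $ k" .
    qed
    finally show ?thesis .
  qed
  have prod: "(\<Prod>j\<in>Basis. \<bar>c j\<bar>) = \<bar>det A\<bar>"
    by (simp add: Basis_vec_def UNION_singleton_eq_range prod.reindex inj_on_def axis_eq_axis c_axis det abs_prod)
  have cnz: "c j \<noteq> 0" if "j \<in> Basis" for j
    using that nz c_axis by (auto simp: Basis_vec_def)
  have [measurable]: "(\<lambda>x. A *v x) \<in> borel \<rightarrow>\<^sub>M borel"
    by (intro borel_measurable_continuous_onI continuous_intros)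
  have eq: "lborel = density (distr lborel borel (\<lambda>x. A *v x)) (\<lambda>_. ennreal \<bar>det A\<bar>)"
    using lborel_affine_euclidean[of c 0, OF cnz] unfolding T prod by simp
  show ?thesis
    by (subst (2) eq) (simp add: nn_integral_density nn_integral_distr nn_integral_cmult)
qed

text \<open>Swapping two coordinates is an involution, so its determinant has absolute value 1, and
  the preimage of a box is a box with permuted sides and the same volume. Boxes determine Lebesgue
  measure.\<close>

lemma nn_integral_lborel_swap:
  fixes f :: "real ^ 'd \<Rightarrow> ennreal" and m n :: 'd
  assumes [measurable]: "f \<in> borel_measurable borel"
  defines "A \<equiv> (\<chi> i j. mat 1 $ i $ Transposition.transpose m n j) :: real ^ 'd ^ 'd"
  shows "ennreal \<bar>det A\<bar> * (\<integral>\<^sup>+ x. f (A *v x) \<partial>lborel) = (\<integral>\<^sup>+ x. f x \<partial>lborel)"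
proof -
  have Av: "(A *v x) $ i = x $ Transposition.transpose m n i" for x i
  proof -
    have "(A *v x) $ i = (\<Sum>j\<in>UNIV. if j = Transposition.transpose m n i then x $ j else 0)"
    proof -
      have "i = Transposition.transpose m n j \<longleftrightarrow> j = Transposition.transpose m n i" for j
        by (metis Transposition.transpose_involutory)
      then show ?thesis
        by (simp add: A_def matrix_vector_mult_def mat_def if_distrib[of "\<lambda>c. c * _"] cong: if_cong)
    qed
    then show ?thesis by simp
  qed
  have "A *v (A *v x) = x" for x
    by (simp add: vec_eq_iff Av)
  then have "A ** A = mat 1"
    by (simp add: matrix_eq matrix_vector_mul_assoc)
  then have "det A * det A = 1"
    by (metis det_I det_mul)
  then have det: "\<bar>det A\<bar> = 1"
    by (metis abs_1 abs_mult_self_eq square_eq_1_iff abs_minus_cancel)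
  have [measurable]: "(\<lambda>x. A *v x) \<in> borel \<rightarrow>\<^sub>M borel"
    by (intro borel_measurable_continuous_onI continuous_intros)
  have "lborel = distr lborel borel (\<lambda>x. A *v x)"
  proof (rule lborel_eqI)
    fix l u :: "real ^ 'd"
    assume le: "\<And>b. b \<in> Basis \<Longrightarrow> l \<bullet> b \<le> u \<bullet> b"
    have le': "l $ i \<le> u $ i" for i
      using le[of "axis i 1"] by (auto simp: inner_axis axis_in_Basis_iff)
    have "(\<lambda>x. A *v x) -` box l u = box (A *v l) (A *v u)"
      by (auto simp: mem_box_cart Av) (metis Transposition.transpose_involutory)+
    then have "emeasure (distr lborel borel (\<lambda>x. A *v x)) (box l u) = emeasure lborel (box (A *v l) (A *v u))"
      by (simp add: emeasure_distr)
    also have "\<dots> = (\<Prod>b\<in>Basis. (A *v u - A *v l) \<bullet> b)"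
      by (rule emeasure_lborel_box) (auto simp: Basis_vec_def inner_axis Av le')
    also have "(\<Prod>b\<in>Basis. (A *v u - A *v l) \<bullet> b) = (\<Prod>i\<in>UNIV. (u - l) $ Transposition.transpose m n i)"
      by (simp add: Basis_vec_def UNION_singleton_eq_range prod.reindex inj_on_def axis_eq_axis inner_axis Av)
    also have "\<dots> = (\<Prod>i\<in>UNIV. (u - l) $ i)"
      by (rule prod.reindex_bij_betw[where h = "Transposition.transpose m n"]) simp
    also have "\<dots> = (\<Prod>b\<in>Basis. (u - l) \<bullet> b)"
      by (simp add: Basis_vec_def UNION_singleton_eq_range prod.reindex inj_on_def axis_eq_axis inner_axis)
    finally show "emeasure (distr lborel borel (\<lambda>x. A *v x)) (box l u) = (\<Prod>b\<in>Basis. (u - l) \<bullet> b)" .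
  qed simp
  then have "(\<integral>\<^sup>+ x. f x \<partial>lborel) = (\<integral>\<^sup>+ x. f x \<partial>distr lborel borel (\<lambda>x. A *v x))"
    by simp
  also have "\<dots> = (\<integral>\<^sup>+ x. f (A *v x) \<partial>lborel)"
    by (simp add: nn_integral_distr)
  finally show ?thesis
    using det by simp
qed

text \<open>Makes Fubini available one coordinate at a time, for the shears and for the Gaussian
  integrals below.\<close>

lemma lborel_eq_PiM:
  "lborel = distr (\<Pi>\<^sub>M b\<in>Basis. lborel) borel (\<lambda>x. \<Sum>b\<in>Basis. x b *\<^sub>R (b :: 'a :: euclidean_space))"
  unfolding lborel_def[where 'a = 'a] lborel_eq_real ..

text \<open>Integrate first along the axis \<open>m\<close>: the shear moves each such line into
  itself by the \<open>n\<close>-th coordinate, which is constant on the line because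
  \<open>m \<noteq> n\<close>, and one-dimensional integrals are invariant under
  translation.\<close>

lemma nn_integral_lborel_shear:
  fixes f :: "real ^ 'd \<Rightarrow> ennreal" and m n :: 'd
  assumes f[measurable]: "f \<in> borel_measurable borel" and mn: "m \<noteq> n"
  defines "A \<equiv> (\<chi> i j. of_bool (i = m \<and> j = n \<or> i = j)) :: real ^ 'd ^ 'd"
  shows "ennreal \<bar>det A\<bar> * (\<integral>\<^sup>+ x. f (A *v x) \<partial>lborel) = (\<integral>\<^sup>+ x. f x \<partial>lborel)"
proof -
  interpret product_sigma_finite "\<lambda>_ :: real ^ 'd. lborel :: real measure" by standard
  have "A = (\<chi> k. if k = m then row m (mat 1) + 1 *s row n (mat 1) else row k (mat 1))"
    using mn by (auto simp: A_def vec_eq_iff row_def mat_def)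
  then have det: "det A = 1"
    using det_row_operation[OF mn, where c = 1 and A = "mat 1 :: real ^ 'd ^ 'd"] by simp
  have Av: "A *v x = x + (x $ n) *\<^sub>R axis m 1" for x
  proof (simp add: vec_eq_iff, intro allI)
    fix i
    have "(A *v x) $ i = (\<Sum>j\<in>UNIV. (if j = i then x $ j else 0) + (if j = n then if i = m then x $ j else 0 else 0))"
      unfolding A_def matrix_vector_mult_def using mn by (auto intro!: sum.cong)
    also have "\<dots> = x $ i + x $ n * axis m 1 $ i"
      by (simp add: sum.distrib axis_def)
    finally show "(A *v x) $ i = x $ i + x $ n * axis m 1 $ i" .
  qed
  define a where "a = (axis m 1 :: real ^ 'd)"
  define I where "I = Basis - {a}"
  have I: "Basis = insert a I" "a \<notin> I" "finite I"
    unfolding I_def a_def by auto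
  define \<phi> where "\<phi> = (\<lambda>x :: real ^ 'd \<Rightarrow> real. \<Sum>b\<in>insert a I. x b *\<^sub>R b)"
  have [measurable]: "(\<lambda>x. A *v x) \<in> borel \<rightarrow>\<^sub>M borel"
    by (intro borel_measurable_continuous_onI continuous_intros)
  have \<phi>_meas: "\<phi> \<in> (\<Pi>\<^sub>M b\<in>insert a I. lborel) \<rightarrow>\<^sub>M borel"
    unfolding \<phi>_def by measurable
  have \<phi>_upd: "\<phi> (x(a := y)) = y *\<^sub>R a + (\<Sum>b\<in>I. x b *\<^sub>R b)" for x y
  proof -
    have "(\<Sum>b\<in>I. (x(a := y)) b *\<^sub>R b) = (\<Sum>b\<in>I. x b *\<^sub>R b)"
      by (intro sum.cong) (use I in auto)
    then show ?thesis
      unfolding \<phi>_def using I(2,3) by simp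
  qed
  have \<phi>_n: "\<phi> (x(a := y)) $ n = (\<Sum>b\<in>I. x b *\<^sub>R b) $ n" for x y
    unfolding \<phi>_upd using mn by (simp add: a_def axis_def)
  have int: "(\<integral>\<^sup>+ x. g x \<partial>lborel) = (\<integral>\<^sup>+ x. \<integral>\<^sup>+ y. g (\<phi> (x(a := y))) \<partial>lborel \<partial>(\<Pi>\<^sub>M b\<in>I. lborel))"
    if [measurable]: "g \<in> borel_measurable borel" for g
  proof -
    have "(\<integral>\<^sup>+ x. g x \<partial>lborel) = (\<integral>\<^sup>+ x. g (\<phi> x) \<partial>(\<Pi>\<^sub>M b\<in>insert a I. lborel))"
      unfolding lborel_eq_PiM[where 'a = "real ^ 'd"] I(1) \<phi>_def[symmetric]
      by (rule nn_integral_distr[OF \<phi>_meas]) simp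
    also have "\<dots> = (\<integral>\<^sup>+ x. \<integral>\<^sup>+ y. g (\<phi> (x(a := y))) \<partial>lborel \<partial>(\<Pi>\<^sub>M b\<in>I. lborel))"
      by (intro product_nn_integral_insert I measurable_compose[OF \<phi>_meas]) simp
    finally show ?thesis .
  qed
  have inner: "(\<integral>\<^sup>+ y. f (A *v \<phi> (x(a := y))) \<partial>lborel) = (\<integral>\<^sup>+ y. f (\<phi> (x(a := y))) \<partial>lborel)" for x
  proof -
    define t where "t = (\<Sum>b\<in>I. x b *\<^sub>R b) $ n"
    have "A *v \<phi> (x(a := y)) = \<phi> (x(a := t + 1 * y))" for y
      unfolding Av \<phi>_n t_def[symmetric] unfolding \<phi>_upd by (simp add: a_def algebra_simps)
    moreover have "(\<lambda>y. f (\<phi> (x(a := y)))) \<in> borel_measurable borel"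
      unfolding \<phi>_upd by measurable
    ultimately show ?thesis
      using nn_integral_real_affine[of "\<lambda>y. f (\<phi> (x(a := y)))" 1 t] by simp
  qed
  have "(\<integral>\<^sup>+ x. f (A *v x) \<partial>lborel) = (\<integral>\<^sup>+ x. f x \<partial>lborel)"
    by (subst (1 2) int) (simp_all add: inner)
  then show ?thesis
    by (simp add: det)
qed

text \<open>The change of variables theorems of HOL-Analysis require the index type to be a wellorder.\<close>

lemma nn_integral_lborel_linear:
  fixes f :: "real ^ 'd \<Rightarrow> ennreal" and A :: "real ^ 'd ^ 'd"
  assumes "f \<in> borel_measurable borel" and "invertible A"
  shows "ennreal \<bar>det A\<bar> * (\<integral>\<^sup>+ x. f (A *v x) \<partial>lborel) = (\<integral>\<^sup>+ x. f x \<partial>lborel)"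
  using assms
\<comment> \<open>Elementary matrices generate all matrices. The cases are products, matrices with a
  zero row (never invertible), diagonal matrices, swaps and shears; \<open>f\<close> varies because
  the product case composes it with a factor.\<close>
proof (induction A arbitrary: f rule: induct_matrix_elementary_alt)
  case (1 A B)
  have inv: "invertible A" "invertible B"
    using 1(4) by (simp_all add: invertible_det_nz det_mul)
  have "(\<lambda>x. A *v x) \<in> borel \<rightarrow>\<^sub>M borel"
    by (intro borel_measurable_continuous_onI continuous_intros)
  then have fA: "(\<lambda>x. f (A *v x)) \<in> borel_measurable borel"
    using 1(3) by measurable
  have "ennreal \<bar>det (A ** B)\<bar> * (\<integral>\<^sup>+ x. f (A ** B *v x) \<partial>lborel)
      = ennreal \<bar>det A\<bar> * (ennreal \<bar>det B\<bar> * (\<integral>\<^sup>+ x. f (A *v (B *v x)) \<partial>lborel))"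
    by (simp add: det_mul abs_mult ennreal_mult mult.assoc matrix_vector_mul_assoc)
  also have "\<dots> = (\<integral>\<^sup>+ x. f x \<partial>lborel)"
    using 1(2)[OF fA inv(2)] 1(1)[OF 1(3) inv(1)] by simp
  finally show ?case .
next
  case (2 A i)
  then have "det A = 0"
    by (intro det_zero_row) auto
  with 2 show ?case by (simp add: invertible_det_nz)
next
  case (3 A)
  then show ?case by (intro nn_integral_lborel_diagonal)
next
  case (4 m n)
  then show ?case by (intro nn_integral_lborel_swap)
next
  case (5 m n)
  then show ?case by (intro nn_integral_lborel_shear)
qed

section \<open>Characteristic functions of Gaussian laws\<close>

definition std_multi_normal :: "(real ^ 'd) measure" where
  "std_multi_normal = density lborel (\<lambda>x. ennreal (exp (- (x \<bullet> x) / 2) / sqrt ((2 * pi) ^ CARD('d))))"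

text \<open>Substituting \<open>x = B y\<close> turns the quadratic form of the inverse of
  \<open>S\<close> into \<open>y \<bullet> y\<close>, and the Jacobian
  \<open>\<bar>det B\<bar>\<close> cancels the square root of \<open>det S\<close>, which is
  \<open>(det B)\<^sup>2\<close>.\<close>

lemma multivariate_normal_eq_distr:
  fixes S B :: "real ^ 'd ^ 'd"
  assumes inv: "invertible B" and S: "S = B ** transpose B"
  shows "multivariate_normal 0 S = distr std_multi_normal borel (\<lambda>x. B *v x)"
proof (rule measure_eqI)
  show "sets (multivariate_normal 0 S) = sets (distr std_multi_normal borel ((*v) B))"
    by (simp add: multivariate_normal_def)
next
  fix X
  assume "X \<in> sets (multivariate_normal 0 S)"
  then have [measurable]: "X \<in> sets borel"
    by (simp add: multivariate_normal_def)
  have [measurable]: "(\<lambda>x. B *v x) \<in> borel \<rightarrow>\<^sub>M borel"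
    by (intro borel_measurable_continuous_onI continuous_intros)
  have [measurable]: "(\<lambda>x. matrix_inv S *v x) \<in> borel \<rightarrow>\<^sub>M borel"
    by (intro borel_measurable_continuous_onI continuous_intros)
  have [measurable]: "(\<lambda>x. B *v x) -` X \<in> sets borel"
    using measurable_sets_borel[of "\<lambda>x. B *v x" borel X] by simp
  define \<phi> where "\<phi> = (\<lambda>x :: real ^ 'd. exp (- (x \<bullet> (matrix_inv S *v x)) / 2) / sqrt ((2 * pi) ^ CARD('d) * det S))"
  have detS: "det S = (det B)\<^sup>2"
    by (simp add: S det_mul det_transpose power2_eq_square)
  have detB: "det B \<noteq> 0"
    using inv by (simp add: invertible_det_nz)
  have "invertible S"
    by (simp add: invertible_det_nz detS detB)
  then have SS: "matrix_inv S ** S = mat 1"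
    unfolding invertible_def matrix_inv_def by (metis (mono_tags, lifting) someI_ex)
  obtain C where C: "C ** transpose B = mat 1" "transpose B ** C = mat 1"
    using detB by (metis det_transpose invertible_def invertible_det_nz)
  have "matrix_inv S ** B = matrix_inv S ** B ** (transpose B ** C)"
    by (simp add: C)
  also have "\<dots> = matrix_inv S ** S ** C"
    by (simp add: S matrix_mul_assoc)
  finally have SB: "matrix_inv S ** B = C"
    by (simp add: SS)
  have "(B *v x) \<bullet> (matrix_inv S *v (B *v x)) = x \<bullet> x" for x
  proof -
    have "(B *v x) \<bullet> (matrix_inv S *v (B *v x)) = (B *v x) \<bullet> (C *v x)"
      by (simp add: matrix_vector_mul_assoc SB)
    also have "\<dots> = x \<bullet> (transpose B *v (C *v x))"
      by (metis dot_lmul_matrix inner_commute transpose_matrix_vector transpose_transpose)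
    finally show ?thesis
      by (simp add: matrix_vector_mul_assoc C)
  qed
  then have \<phi>B: "\<bar>det B\<bar> * \<phi> (B *v x) = exp (- (x \<bullet> x) / 2) / sqrt ((2 * pi) ^ CARD('d))" for x
    using detB by (simp add: \<phi>_def detS real_sqrt_mult)
  have "emeasure (multivariate_normal 0 S) X = (\<integral>\<^sup>+ x. ennreal (\<phi> x) * indicator X x \<partial>lborel)"
    unfolding multivariate_normal_def \<phi>_def by (subst emeasure_density) simp_all
  also have "\<dots> = ennreal \<bar>det B\<bar> * (\<integral>\<^sup>+ x. ennreal (\<phi> (B *v x)) * indicator X (B *v x) \<partial>lborel)"
    by (rule nn_integral_lborel_linear[symmetric, OF _ inv]) (simp add: \<phi>_def)
  also have "\<dots> = (\<integral>\<^sup>+ x. ennreal \<bar>det B\<bar> * (ennreal (\<phi> (B *v x)) * indicator X (B *v x)) \<partial>lborel)"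
    by (rule nn_integral_cmult[symmetric]) (simp add: \<phi>_def)
  also have "\<dots> = (\<integral>\<^sup>+ x. ennreal (exp (- (x \<bullet> x) / 2) / sqrt ((2 * pi) ^ CARD('d)))
                       * indicator ((\<lambda>x. B *v x) -` X) x \<partial>lborel)"
    by (intro nn_integral_cong) (simp only: mult.assoc[symmetric] ennreal_mult'[OF abs_ge_zero, symmetric] \<phi>B, simp add: indicator_def)
  also have "\<dots> = emeasure std_multi_normal ((\<lambda>x. B *v x) -` X)"
    unfolding std_multi_normal_def by (subst emeasure_density) simp_all
  also have "\<dots> = emeasure (distr std_multi_normal borel (\<lambda>x. B *v x)) X"
    by (subst emeasure_distr) (simp_all add: std_multi_normal_def)
  finally show "emeasure (multivariate_normal 0 S) X = emeasure (distr std_multi_normal borel (\<lambda>x. B *v x)) X" .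
qed

lemma std_normal_complex_char:
  fixes u :: real
  shows "integrable lborel (\<lambda>x. complex_of_real (std_normal_density x) * exp (\<i> * of_real (u * x)))"
    and "(\<integral>x. complex_of_real (std_normal_density x) * exp (\<i> * of_real (u * x)) \<partial>lborel) = exp (- of_real (u\<^sup>2) / 2)"
proof -
  interpret N: real_distribution std_normal_distribution
    by (rule real_dist_normal_dist)
  have "integrable std_normal_distribution (\<lambda>x. exp (\<i> * of_real (u * x)))"
    by (intro N.integrable_const_bound[where B = 1]) simp_all
  then show "integrable lborel (\<lambda>x. complex_of_real (std_normal_density x) * exp (\<i> * of_real (u * x)))"
    by (subst (asm) integrable_density) (simp_all add: scaleR_conv_of_real)
  have "char std_normal_distribution u = exp (- (u\<^sup>2) / 2)"
    by (simp add: char_std_normal_distribution)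
  then show "(\<integral>x. complex_of_real (std_normal_density x) * exp (\<i> * of_real (u * x)) \<partial>lborel) = exp (- of_real (u\<^sup>2) / 2)"
    unfolding char_def
    by (subst (asm) integral_density) (simp_all add: scaleR_conv_of_real exp_of_real[symmetric])
qed

lemma std_multi_normal_density_eq_prod:
  fixes x :: "real ^ 'd"
  shows "exp (- (x \<bullet> x) / 2) / sqrt ((2 * pi) ^ CARD('d)) = (\<Prod>b\<in>Basis. std_normal_density (x \<bullet> b))"
proof -
  have "(\<Prod>b\<in>Basis. std_normal_density (x \<bullet> b)) = (1 / sqrt (2 * pi)) ^ CARD('d) * exp (\<Sum>b\<in>Basis. - (x \<bullet> b)\<^sup>2 / 2)"
    by (simp add: std_normal_density_def prod_dividef power_one_over exp_sum)
  also have "(\<Sum>b\<in>Basis. - (x \<bullet> b)\<^sup>2 / 2) = - (x \<bullet> x) / 2"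
    by (subst (2) euclidean_inner) (simp add: sum_negf sum_divide_distrib power2_eq_square)
  finally have "(\<Prod>b\<in>Basis. std_normal_density (x \<bullet> b)) = 1 / sqrt ((2 * pi) ^ CARD('d)) * exp (- (x \<bullet> x) / 2)"
    by (simp only: real_sqrt_power power_one_over)
  then show ?thesis
    by (simp only: mult_1 times_divide_eq_left)
qed

text \<open>Both the density and the exponential factor over the coordinates, so the integral is a
  product of one-dimensional ones.\<close>

lemma char_std_multi_normal:
  fixes u :: "real ^ 'd"
  shows "(\<integral>x. exp (\<i> * of_real (u \<bullet> x)) \<partial>std_multi_normal) = exp (- of_real (u \<bullet> u) / 2)"
    and "prob_space (std_multi_normal :: (real ^ 'd) measure)"
proof -
  interpret product_sigma_finite "\<lambda>_ :: real ^ 'd. lborel :: real measure" by standard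
  have char: "(\<integral>x. exp (\<i> * of_real (u \<bullet> x)) \<partial>std_multi_normal) = exp (- of_real (u \<bullet> u) / 2)" for u :: "real ^ 'd"
  proof -
    define f where "f = (\<lambda>b y. complex_of_real (std_normal_density y) * exp (\<i> * of_real ((u \<bullet> b) * y)))"
    have "(\<integral>x. exp (\<i> * of_real (u \<bullet> x)) \<partial>std_multi_normal)
        = (\<integral>x. (\<Prod>b\<in>Basis. std_normal_density (x \<bullet> b)) *\<^sub>R exp (\<i> * of_real (u \<bullet> x)) \<partial>lborel)"
      unfolding std_multi_normal_def std_multi_normal_density_eq_prod
      by (subst integral_density) (auto intro!: AE_I2 prod_nonneg)
    also have "\<dots> = (\<integral>x. (\<Prod>b\<in>Basis. f b (x \<bullet> b)) \<partial>lborel)"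
    proof (intro Bochner_Integration.integral_cong refl)
      fix x :: "real ^ 'd"
      have "exp (\<i> * of_real (u \<bullet> x)) = (\<Prod>b\<in>Basis. exp (\<i> * complex_of_real ((u \<bullet> b) * (x \<bullet> b))))"
        by (subst euclidean_inner) (simp add: exp_sum[symmetric] sum_distrib_left)
      then show "(\<Prod>b\<in>Basis. std_normal_density (x \<bullet> b)) *\<^sub>R exp (\<i> * of_real (u \<bullet> x)) = (\<Prod>b\<in>Basis. f b (x \<bullet> b))"
        by (simp add: f_def prod.distrib scaleR_conv_of_real)
    qed
    also have "\<dots> = (\<integral>x. (\<Prod>b\<in>Basis. f b ((\<Sum>b\<in>Basis. x b *\<^sub>R b) \<bullet> b)) \<partial>(\<Pi>\<^sub>M b\<in>(Basis :: (real ^ 'd) set). lborel))"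
      unfolding lborel_eq_PiM[where 'a = "real ^ 'd"]
      by (rule integral_distr) (simp_all add: f_def)
    also have "\<dots> = (\<integral>x. (\<Prod>b\<in>Basis. f b (x b)) \<partial>(\<Pi>\<^sub>M b\<in>(Basis :: (real ^ 'd) set). lborel))"
      by (intro Bochner_Integration.integral_cong refl prod.cong) simp
    also have "\<dots> = (\<Prod>b\<in>Basis. \<integral>y. f b y \<partial>lborel)"
      by (rule product_integral_prod) (simp_all add: f_def std_normal_complex_char(1)[simplified])
    also have "\<dots> = (\<Prod>b\<in>Basis. exp (- of_real ((u \<bullet> b)\<^sup>2) / 2))"
      unfolding f_def by (simp only: std_normal_complex_char(2))
    also have "\<dots> = exp (- of_real (u \<bullet> u) / 2)"
      by (subst (2) euclidean_inner)
         (simp add: exp_sum[symmetric] sum_negf sum_divide_distrib power2_eq_square)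
    finally show ?thesis .
  qed
  show "(\<integral>x. exp (\<i> * of_real (u \<bullet> x)) \<partial>std_multi_normal) = exp (- of_real (u \<bullet> u) / 2)"
    by (rule char)
  have "(\<integral>x. 1 \<partial>(std_multi_normal :: (real ^ 'd) measure)) = (1 :: complex)"
    using char[of 0] by simp
  then have "measure (std_multi_normal :: (real ^ 'd) measure) (space std_multi_normal) = 1"
    by (simp add: scaleR_conv_of_real)
  \<comment> \<open>The total mass is the transform at 0. An infinite mass would make
    \<open>measure\<close> equal to 0, so the value 1 also gives finiteness.\<close>
  then show "prob_space (std_multi_normal :: (real ^ 'd) measure)"
    by (intro prob_spaceI) (metis emeasure_eq_ennreal_measure ennreal_1 measure_zero_top zero_neq_one)
qed

text \<open>By the factorization the law is a linear image of the standard one, whose transform is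
  evaluated at \<open>transpose B *v u\<close>; the squared norm of this vector is the quadratic
  form of \<open>S\<close>.\<close>

lemma multivariate_normal_char:
  fixes S :: "real ^ 'd ^ 'd"
  assumes "pos_def_matrix S"
  shows "prob_space (multivariate_normal 0 S)"
    and "(\<integral>x. exp (\<i> * of_real (u \<bullet> x)) \<partial>multivariate_normal 0 S) = exp (- of_real (u \<bullet> (S *v u)) / 2)"
proof -
  obtain B :: "real ^ 'd ^ 'd" where B: "invertible B" "S = B ** transpose B"
    by (rule pos_def_factorization[OF assms])
  interpret N: prob_space "std_multi_normal :: (real ^ 'd) measure"
    by (rule char_std_multi_normal)
  have "(\<lambda>x. B *v x) \<in> borel \<rightarrow>\<^sub>M borel"
    by (intro borel_measurable_continuous_onI continuous_intros)
  then have [measurable]: "(\<lambda>x. B *v x) \<in> std_multi_normal \<rightarrow>\<^sub>M borel"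
    by (simp add: std_multi_normal_def)
  have adj: "u \<bullet> (B *v x) = (transpose B *v u) \<bullet> x" for x
    by (metis dot_lmul_matrix inner_commute transpose_matrix_vector)
  have "(transpose B *v u) \<bullet> (transpose B *v u) = u \<bullet> (S *v u)"
    by (simp only: adj[symmetric] matrix_vector_mul_assoc B(2))
  then show "(\<integral>x. exp (\<i> * of_real (u \<bullet> x)) \<partial>multivariate_normal 0 S) = exp (- of_real (u \<bullet> (S *v u)) / 2)"
    unfolding multivariate_normal_eq_distr[OF B]
    by (subst integral_distr) (simp_all add: adj char_std_multi_normal)
  show "prob_space (multivariate_normal 0 S)"
    unfolding multivariate_normal_eq_distr[OF B] by (rule N.prob_space_distr) simp
qed

section \<open>Weak convergence from characteristic functions\<close>

text \<open>The generators are the real and imaginary parts of the functions that characteristic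
  functions integrate. Products are not a rule, so that convergence of integrals follows by
  linearity alone; closure under products is proved separately.\<close>

inductive trig_poly :: "('a::real_inner \<Rightarrow> real) \<Rightarrow> bool" where
  cos: "trig_poly (\<lambda>x. cos (u \<bullet> x))"
| sin: "trig_poly (\<lambda>x. sin (u \<bullet> x))"
| scale: "trig_poly f \<Longrightarrow> trig_poly (\<lambda>x. c * f x)"
| add: "trig_poly f \<Longrightarrow> trig_poly g \<Longrightarrow> trig_poly (\<lambda>x. f x + g x)"

lemma trig_poly_const: "trig_poly (\<lambda>_. c)"
  using trig_poly.scale[OF trig_poly.cos[of 0], of c] by simp

lemma trig_poly_sum: "(\<And>i. i \<in> I \<Longrightarrow> trig_poly (f i)) \<Longrightarrow> trig_poly (\<lambda>x. \<Sum>i\<in>I. f i x)"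
  by (induction I rule: infinite_finite_induct) (auto intro: trig_poly_const trig_poly.add)

text \<open>The product-to-sum formulas keep products inside the linear span.\<close>

lemma trig_poly_mult_cos_sin:
  assumes "trig_poly f"
  shows "trig_poly (\<lambda>x. f x * cos (u \<bullet> x)) \<and> trig_poly (\<lambda>x. f x * sin (u \<bullet> x))"
  using assms
proof induction
  case (cos v)
  have 1: "(\<lambda>x. cos (v \<bullet> x) * cos (u \<bullet> x)) = (\<lambda>x. (1/2) * cos ((v - u) \<bullet> x) + (1/2) * cos ((v + u) \<bullet> x))"
    by (auto simp: inner_add_left inner_diff_left cos_add cos_diff field_simps)
  have 2: "(\<lambda>x. cos (v \<bullet> x) * sin (u \<bullet> x)) = (\<lambda>x. (1/2) * sin ((v + u) \<bullet> x) + (-1/2) * sin ((v - u) \<bullet> x))"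
    by (auto simp: inner_add_left inner_diff_left sin_add sin_diff field_simps)
  show ?case unfolding 1 2 by (intro conjI trig_poly.add trig_poly.scale trig_poly.cos trig_poly.sin)
next
  case (sin v)
  have 1: "(\<lambda>x. sin (v \<bullet> x) * cos (u \<bullet> x)) = (\<lambda>x. (1/2) * sin ((v + u) \<bullet> x) + (1/2) * sin ((v - u) \<bullet> x))"
    by (auto simp: inner_add_left inner_diff_left sin_add sin_diff field_simps)
  have 2: "(\<lambda>x. sin (v \<bullet> x) * sin (u \<bullet> x)) = (\<lambda>x. (1/2) * cos ((v - u) \<bullet> x) + (-1/2) * cos ((v + u) \<bullet> x))"
    by (auto simp: inner_add_left inner_diff_left cos_add cos_diff field_simps)
  show ?case unfolding 1 2 by (intro conjI trig_poly.add trig_poly.scale trig_poly.cos trig_poly.sin)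
next
  case (scale f c)
  then show ?case by (auto simp: mult.assoc intro: trig_poly.scale)
next
  case (add f g)
  then show ?case by (auto simp: distrib_right intro: trig_poly.add)
qed

lemma trig_poly_mult:
  assumes "trig_poly f" "trig_poly g"
  shows "trig_poly (\<lambda>x. f x * g x)"
  using assms(2)
proof induction
  case (scale g c)
  have "(\<lambda>x. f x * (c * g x)) = (\<lambda>x. c * (f x * g x))" by (simp add: algebra_simps)
  with scale show ?case by (simp add: trig_poly.scale)
next
  case (add g h)
  then show ?case by (auto simp: distrib_left intro: trig_poly.add)
qed (use trig_poly_mult_cos_sin[OF assms(1)] in auto)

lemma trig_poly_continuous: "trig_poly f \<Longrightarrow> continuous_on UNIV f"
  by (induction rule: trig_poly.induct) (intro continuous_intros; assumption)+

lemma trig_poly_bounded: "trig_poly f \<Longrightarrow> bounded (range f)"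
proof (induction rule: trig_poly.induct)
  case (cos u)
  show ?case by (auto simp: bounded_iff intro!: exI[of _ 1])
next
  case (sin u)
  show ?case by (auto simp: bounded_iff intro!: exI[of _ 1])
next
  case (scale f c)
  then obtain B where "\<And>x. \<bar>f x\<bar> \<le> B"
    by (auto simp: bounded_iff)
  then have "\<bar>c * f x\<bar> \<le> \<bar>c\<bar> * B" for x
    by (simp add: abs_mult mult_left_mono)
  then show ?case
    by (auto simp: bounded_iff)
next
  case (add f g)
  then show ?case by (intro bounded_plus_comp)
qed

text \<open>A linear form of the vector of sines is a combination of generators, and the remaining
  constructors of polynomials preserve \<open>trig_poly\<close>.\<close>

lemma real_polynomial_function_sin_trig_poly:
  fixes P :: "real ^ 'd \<Rightarrow> real"
  assumes "real_polynomial_function P"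
  shows "trig_poly (\<lambda>x. P (\<chi> i. sin (c * x $ i)))"
  using assms
proof induction
  case (linear f)
  interpret bounded_linear f by fact
  have eq: "f (\<chi> i. sin (c * x $ i)) = (\<Sum>i\<in>UNIV. f (axis i 1) * sin ((c *\<^sub>R axis i 1) \<bullet> x))" for x :: "real ^ 'd"
  proof -
    have "f (\<chi> i. sin (c * x $ i)) = f (\<Sum>i\<in>UNIV. sin (c * x $ i) *s axis i 1)"
      by (subst basis_expansion[symmetric]) simp
    then show ?thesis
      by (simp add: sum scaleR scalar_mult_eq_scaleR inner_axis' mult.commute)
  qed
  show ?case
    unfolding eq by (intro trig_poly_sum trig_poly.scale trig_poly.sin)
next
  case (const c)
  show ?case by (rule trig_poly_const)
next
  case (add f g)
  then show ?case by (intro trig_poly.add)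
next
  case (mult f g)
  then show ?case by (intro trig_poly_mult)
qed

text \<open>The substitution \<open>y = sin (c x)\<close> is injective on the ball of radius \<open>R\<close> and maps the whole space into
  \<open>[-1, 1]^d\<close>, so the approximant keeps the bound of \<open>f\<close> outside the ball as well.\<close>

lemma trig_poly_approx:
  fixes f :: "real ^ 'd \<Rightarrow> real"
  assumes cont: "continuous_on UNIV f" and bd: "\<And>x. \<bar>f x\<bar> \<le> b" and "R > 0" "\<epsilon> > 0"
  obtains g where "trig_poly g" and "\<And>x. \<bar>g x\<bar> \<le> b + \<epsilon>" and "\<And>x. norm x \<le> R \<Longrightarrow> \<bar>f x - g x\<bar> \<le> \<epsilon>"
proof -
  \<comment> \<open>With this scale, \<open>\<bar>x $ i\<bar> \<le> R\<close> puts
    \<open>c * x $ i\<close> into the interval from -pi/2 to pi/2, on which \<open>arcsin\<close>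
    inverts \<open>sin\<close>.\<close>
  define c where "c = pi / (2 * R)"
  have c: "c > 0" "c * R = pi / 2"
    using \<open>R > 0\<close> by (auto simp: c_def)
  define F where "F = (\<lambda>y :: real ^ 'd. f (\<chi> i. arcsin (y $ i) / c))"
  let ?C = "cbox (-1) 1 :: (real ^ 'd) set"
  have "continuous_on ?C F"
    unfolding F_def
    by (rule continuous_on_compose2[OF cont])
       (auto intro!: continuous_intros simp: mem_box_cart, use c in auto)
  then obtain P where P: "real_polynomial_function P" and PF: "\<And>y. y \<in> ?C \<Longrightarrow> \<bar>F y - P y\<bar> < \<epsilon>"
    using Stone_Weierstrass_real_polynomial_function[OF compact_cbox _ \<open>\<epsilon> > 0\<close>] by blast
  define s where "s = (\<lambda>x :: real ^ 'd. \<chi> i. sin (c * x $ i))"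
  have s: "s x \<in> ?C" for x
    by (simp add: s_def mem_box_cart)
  have Fs: "F (s x) = f x" if "norm x \<le> R" for x
  proof -
    have "arcsin (sin (c * x $ i)) = c * x $ i" for i
    proof (rule arcsin_sin)
      have "\<bar>x $ i\<bar> \<le> R"
        using component_le_norm_cart[of x i] that by linarith
      then have "c * \<bar>x $ i\<bar> \<le> c * R"
        using c(1) by (intro mult_left_mono) auto
      then have "\<bar>c * x $ i\<bar> \<le> pi / 2"
        using c by (simp add: abs_mult)
      then show "- (pi / 2) \<le> c * x $ i" "c * x $ i \<le> pi / 2" by linarith+
    qed
    then show ?thesis
      using c by (simp add: F_def s_def)
  qed
  show thesis
  proof (rule that)
    show "trig_poly (\<lambda>x. P (s x))"
      unfolding s_def by (rule real_polynomial_function_sin_trig_poly[OF P])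
    show "\<bar>P (s x)\<bar> \<le> b + \<epsilon>" for x
      using PF[OF s, of x] bd[of "\<chi> i. arcsin (s x $ i) / c"] unfolding F_def by linarith
    show "\<bar>f x - P (s x)\<bar> \<le> \<epsilon>" if "norm x \<le> R" for x
      using PF[OF s, of x] Fs[OF that] by linarith
  qed
qed

section \<open>The continuity theorem\<close>

lemma integral_approx_off_ball:
  fixes f g :: "'a::euclidean_space \<Rightarrow> real"
  assumes "prob_space N" and sets: "sets N = sets borel"
    and f: "continuous_on UNIV f" "\<And>x. \<bar>f x\<bar> \<le> b" and g: "continuous_on UNIV g" "\<And>x. \<bar>g x\<bar> \<le> b + \<epsilon>"
    and close: "\<And>x. norm x \<le> R \<Longrightarrow> \<bar>f x - g x\<bar> \<le> \<epsilon>" and "\<epsilon> > 0"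
  shows "\<bar>integral\<^sup>L N f - integral\<^sup>L N g\<bar> \<le> \<epsilon> + (2 * b + \<epsilon>) * measure N {x. norm x > R}"
proof -
  interpret prob_space N by fact
  have [measurable]: "f \<in> borel_measurable N" "g \<in> borel_measurable N"
    using f(1) g(1) by (simp_all add: borel_measurable_continuous_onI measurable_cong_sets[OF sets refl])
  have S[measurable]: "{x. norm x > R} \<in> sets N"
    unfolding sets by measurable
  have int: "integrable N f" "integrable N g"
    using f g by (auto intro: integrable_const_bound[where B = b] integrable_const_bound[where B = "b + \<epsilon>"])
  have b: "b \<ge> 0"
    using f(2)[of 0] by linarith
  have "\<bar>integral\<^sup>L N f - integral\<^sup>L N g\<bar> = \<bar>\<integral>x. f x - g x \<partial>N\<bar>"
    using int by simp
  also have "\<dots> \<le> (\<integral>x. \<bar>f x - g x\<bar> \<partial>N)"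
    by (rule integral_abs_bound)
  also have "\<dots> \<le> (\<integral>x. \<epsilon> + (2 * b + \<epsilon>) * indicator {x. norm x > R} x \<partial>N)"
  proof (rule integral_mono)
    show "integrable N (\<lambda>x. \<epsilon> + (2 * b + \<epsilon>) * indicator {x. norm x > R} x :: real)"
      using S by (intro Bochner_Integration.integrable_add integrable_const integrable_mult_right integrable_real_indicator)
        (auto simp: emeasure_eq_measure)
    fix x
    \<comment> \<open>Outside the ball only the sum of the two uniform bounds,
      \<open>2 * b + \<epsilon>\<close>, is available; it is weighted with the tail mass.\<close>
    show "\<bar>f x - g x\<bar> \<le> \<epsilon> + (2 * b + \<epsilon>) * indicator {x. norm x > R} x"
      using close[of x] f(2)[of x] g(2)[of x] \<open>\<epsilon> > 0\<close> b by (cases "norm x \<le> R") (auto simp: indicator_def)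
  qed (use int in auto)
  also have "\<dots> = \<epsilon> + (2 * b + \<epsilon>) * measure N {x. norm x > R}"
    using S by (subst Bochner_Integration.integral_add) (auto simp: prob_space emeasure_eq_measure)
  finally show ?thesis .
qed

lemma tendsto_le_approx:
  fixes a :: "nat \<Rightarrow> real"
  assumes "\<And>\<epsilon>. \<epsilon> > 0 \<Longrightarrow> \<forall>\<^sub>F n in sequentially. \<bar>a n - l\<bar> \<le> \<epsilon>"
  shows "a \<longlonglongrightarrow> l"
proof (rule tendstoI)
  fix e :: real
  assume "e > 0"
  then have "\<forall>\<^sub>F n in sequentially. \<bar>a n - l\<bar> \<le> e / 2"
    by (intro assms) simp
  then show "\<forall>\<^sub>F n in sequentially. dist (a n) l < e"
    using \<open>e > 0\<close> by (auto simp: dist_real_def elim!: eventually_mono)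
qed

text \<open>Levy's continuity theorem with tightness as a hypothesis. Integrals of trigonometric
  polynomials converge by linearity, and tightness makes the approximation of \<open>f\<close> by
  one of them uniform over all large \<open>n\<close>.\<close>

theorem weakly_converges_char:
  fixes \<mu> :: "nat \<Rightarrow> (real ^ 'd) measure"
  assumes P: "\<And>n. prob_space (\<mu> n)" "\<And>n. sets (\<mu> n) = sets borel"
    and N: "prob_space \<nu>" "sets \<nu> = sets borel"
    and char: "\<And>u. (\<lambda>n. \<integral>x. exp (\<i> * of_real (u \<bullet> x)) \<partial>\<mu> n) \<longlonglongrightarrow> (\<integral>x. exp (\<i> * of_real (u \<bullet> x)) \<partial>\<nu>)"
    and tight: "\<And>\<epsilon>. \<epsilon> > 0 \<Longrightarrow> \<exists>R. \<forall>\<^sub>F n in sequentially. measure (\<mu> n) {x. norm x > R} \<le> \<epsilon>"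
  shows "weakly_converges \<mu> \<nu>"
  unfolding weakly_converges_def
proof (intro allI impI)
  have integrable: "integrable N f" if "prob_space N" "sets N = sets borel" "continuous_on UNIV f" "bounded (range f)"
    for N and f :: "real ^ 'd \<Rightarrow> 'b :: {banach, second_countable_topology}"
  proof -
    interpret prob_space N by fact
    obtain B where "\<And>x. norm (f x) \<le> B"
      using \<open>bounded (range f)\<close> by (auto simp: bounded_iff)
    then show ?thesis
      using that by (intro integrable_const_bound[where B = B])
        (simp_all add: borel_measurable_continuous_onI measurable_cong_sets[OF that(2) refl])
  qed
  have exp_int: "integrable N (\<lambda>x. exp (\<i> * of_real (u \<bullet> x)))"
    if "prob_space N" "sets N = sets borel" for N and u :: "real ^ 'd"
    using that by (intro integrable) (auto intro!: continuous_intros simp: bounded_iff)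
  have trig: "(\<lambda>n. integral\<^sup>L (\<mu> n) g) \<longlonglongrightarrow> integral\<^sup>L \<nu> g" if "trig_poly g" for g
    using that
  proof induction
    case (cos u)
    have "integral\<^sup>L N (\<lambda>x. cos (u \<bullet> x)) = Re (\<integral>x. exp (\<i> * of_real (u \<bullet> x)) \<partial>N)"
      if "prob_space N" "sets N = sets borel" for N
      by (subst integral_Re[OF exp_int[OF that], symmetric]) (simp add: Re_exp)
    with tendsto_Re[OF char[of u]] P N show ?case by simp
  next
    case (sin u)
    have "integral\<^sup>L N (\<lambda>x. sin (u \<bullet> x)) = Im (\<integral>x. exp (\<i> * of_real (u \<bullet> x)) \<partial>N)"
      if "prob_space N" "sets N = sets borel" for N
      by (subst integral_Im[OF exp_int[OF that], symmetric]) (simp add: Im_exp)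
    with tendsto_Im[OF char[of u]] P N show ?case by simp
  next
    case (scale g c)
    then show ?case by (auto intro: tendsto_mult_left)
  next
    case (add g h)
    have "integral\<^sup>L M (\<lambda>x. g x + h x) = integral\<^sup>L M g + integral\<^sup>L M h"
      if "prob_space M" "sets M = sets borel" for M
      using that add.hyps
      by (intro Bochner_Integration.integral_add integrable) (auto intro: trig_poly_continuous trig_poly_bounded)
    with add P N show ?case by (auto intro: tendsto_add)
  qed
  fix f :: "real ^ 'd \<Rightarrow> real"
  assume f: "continuous_on UNIV f" and "bounded (range f)"
  then obtain b where b: "\<And>x. \<bar>f x\<bar> \<le> b"
    by (auto simp: bounded_iff)
  have b0: "b \<ge> 0"
    using b[of 0] by linarith
  interpret N: prob_space \<nu> by fact
  \<comment> \<open>A single probability measure is tight, because the complements of growing balls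
    decrease to the empty set.\<close>
  have tight_\<nu>: "\<exists>R. measure \<nu> {x. norm x > R} \<le> \<epsilon>" if "\<epsilon> > 0" for \<epsilon>
  proof -
    have "(\<lambda>n. measure \<nu> {x. norm x > real n}) \<longlonglongrightarrow> measure \<nu> (\<Inter>n. {x. norm x > real n})"
      by (rule N.finite_Lim_measure_decseq) (auto simp: N(2) decseq_def)
    moreover have "(\<Inter>n. {x :: real ^ 'd. norm x > real n}) = {}"
      using reals_Archimedean2 not_less_iff_gr_or_eq by fastforce
    ultimately have "\<forall>\<^sub>F n in sequentially. measure \<nu> {x. norm x > real n} < \<epsilon>"
      using that by (auto intro: order_tendstoD(2))
    then show ?thesis
      by (auto simp: eventually_sequentially intro: less_imp_le)
  qed
  show "(\<lambda>n. integral\<^sup>L (\<mu> n) f) \<longlonglongrightarrow> integral\<^sup>L \<nu> f"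
  proof (rule tendsto_le_approx)
    fix \<epsilon> :: real
    assume "\<epsilon> > 0"
    \<comment> \<open>The final error is \<open>\<delta>\<close> plus twice
      \<open>\<delta> + (2 * b + 1) * \<delta>\<close>, which explains the denominator; the minimum
      with 1 bounds \<open>2 * b + \<delta>\<close> by \<open>2 * b + 1\<close>.\<close>
    define \<delta> where "\<delta> = min 1 (\<epsilon> / (3 + 2 * (2 * b + 1)))"
    have pos: "3 + 2 * (2 * b + 1) > 0"
      using b0 by simp
    then have \<delta>: "\<delta> > 0" "\<delta> \<le> 1"
      using \<open>\<epsilon> > 0\<close> by (simp_all add: \<delta>_def)
    have \<delta>_\<epsilon>: "\<delta> * (3 + 2 * (2 * b + 1)) \<le> \<epsilon>"
      using pos by (simp only: pos_le_divide_eq[symmetric]) (simp add: \<delta>_def)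
    obtain R1 where R1: "\<forall>\<^sub>F n in sequentially. measure (\<mu> n) {x. norm x > R1} \<le> \<delta>"
      using tight[OF \<delta>(1)] by blast
    obtain R2 where R2: "measure \<nu> {x. norm x > R2} \<le> \<delta>"
      using tight_\<nu>[OF \<delta>(1)] by blast
    \<comment> \<open>The maximum with 1 makes the radius positive, as the approximation
      requires.\<close>
    define R where "R = max 1 (max R1 R2)"
    have mono: "measure N {x. norm x > R} \<le> measure N {x. norm x > r}"
      if "prob_space N" "sets N = sets borel" "r \<le> R" for N and r and x :: "real ^ 'd"
    proof -
      interpret prob_space N by fact
      show ?thesis
        by (rule finite_measure_mono) (use that in auto)
    qed
    obtain g where g: "trig_poly g" "\<And>x. \<bar>g x\<bar> \<le> b + \<delta>" "\<And>x. norm x \<le> R \<Longrightarrow> \<bar>f x - g x\<bar> \<le> \<delta>"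
      using trig_poly_approx[OF f b, of R \<delta>] \<delta>(1) R_def by (auto simp: max_def split: if_splits)
    have approx: "\<bar>integral\<^sup>L M f - integral\<^sup>L M g\<bar> \<le> \<delta> + (2 * b + 1) * \<delta>"
      if M: "prob_space M" "sets M = sets borel" and m: "measure M {x. norm x > r} \<le> \<delta>" "r \<le> R" for M r
    proof -
      have "\<bar>integral\<^sup>L M f - integral\<^sup>L M g\<bar> \<le> \<delta> + (2 * b + \<delta>) * measure M {x. norm x > R}"
        by (rule integral_approx_off_ball[OF M f b trig_poly_continuous[OF g(1)] g(2,3) \<delta>(1)])
      also have "\<dots> \<le> \<delta> + (2 * b + 1) * \<delta>"
        using \<delta> b0 mono[OF M m(2)] m(1) by (intro add_left_mono mult_mono) auto
      finally show ?thesis .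
    qed
    have "\<forall>\<^sub>F n in sequentially. \<bar>integral\<^sup>L (\<mu> n) g - integral\<^sup>L \<nu> g\<bar> < \<delta>"
      using trig[OF g(1)] \<delta>(1) by (auto simp: tendsto_iff dist_real_def)
    with R1 show "\<forall>\<^sub>F n in sequentially. \<bar>integral\<^sup>L (\<mu> n) f - integral\<^sup>L \<nu> f\<bar> \<le> \<epsilon>"
    proof eventually_elim
      case (elim n)
      have "\<bar>integral\<^sup>L (\<mu> n) f - integral\<^sup>L (\<mu> n) g\<bar> \<le> \<delta> + (2 * b + 1) * \<delta>"
        by (rule approx[OF P elim(1)]) (simp add: R_def)
      moreover have "\<bar>integral\<^sup>L \<nu> f - integral\<^sup>L \<nu> g\<bar> \<le> \<delta> + (2 * b + 1) * \<delta>"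
        by (rule approx[OF N R2]) (simp add: R_def)
      moreover have "\<delta> + (\<delta> + (2 * b + 1) * \<delta>) + (\<delta> + (2 * b + 1) * \<delta>) \<le> \<epsilon>"
        using \<delta>_\<epsilon> by (simp add: algebra_simps)
      ultimately show ?case
        using elim(2) unfolding abs_le_iff abs_less_iff by linarith
    qed
  qed
qed

section \<open>Finite sums over histories\<close>

text \<open>The conditional probability of the observation \<open>y\<close> given the gate
  \<open>g\<close>, when an event has probability \<open>p\<close>.\<close>

definition obs_weight :: "real \<Rightarrow> bool \<Rightarrow> bool \<Rightarrow> real" where
  "obs_weight p g y = (if g then if y then p else 1 - p else of_bool (\<not> y))"

lemma obs_weight_nonneg: "0 \<le> p \<Longrightarrow> p \<le> 1 \<Longrightarrow> 0 \<le> obs_weight p g y"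
  by (simp add: obs_weight_def)

lemma obs_weight_sum: "obs_weight p g True + obs_weight p g False = 1"
  by (simp add: obs_weight_def)

lemma finite_histories [simp, intro]: "finite (histories t)"
  using finite_lists_length_eq[of "UNIV :: (bool \<times> bool) set" t] by (simp add: histories_def)

lemma histories_0 [simp]: "histories 0 = {[]}"
  by (auto simp: histories_def)

lemma histories_Suc:
  "histories (Suc t) = (\<lambda>(xs, x). xs @ [x]) ` (histories t \<times> UNIV)"
proof (intro set_eqI iffI)
  fix zs :: "(bool \<times> bool) list"
  assume "zs \<in> histories (Suc t)"
  then have "zs = butlast zs @ [last zs]" "butlast zs \<in> histories t"
    by (auto simp: histories_def intro!: append_butlast_last_id[symmetric])
  then show "zs \<in> (\<lambda>(xs, x). xs @ [x]) ` (histories t \<times> UNIV)"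
    by (force intro: image_eqI[of _ _ "(butlast zs, last zs)"])
qed (auto simp: histories_def)

lemma sum_histories_Suc:
  fixes f :: "(bool \<times> bool) list \<Rightarrow> 'a::comm_monoid_add"
  shows "(\<Sum>xs\<in>histories (Suc t). f xs) = (\<Sum>xs\<in>histories t. \<Sum>g\<in>UNIV. \<Sum>y\<in>UNIV. f (xs @ [(g, y)]))"
proof -
  have "(\<Sum>xs\<in>histories (Suc t). f xs) = (\<Sum>(xs, x)\<in>histories t \<times> UNIV. f (xs @ [x]))"
    unfolding histories_Suc by (subst sum.reindex) (auto simp: inj_on_def o_def case_prod_unfold)
  also have "\<dots> = (\<Sum>xs\<in>histories t. \<Sum>x\<in>UNIV. f (xs @ [x]))"
    by (simp add: sum.cartesian_product)
  also have "\<dots> = (\<Sum>xs\<in>histories t. \<Sum>g\<in>UNIV. \<Sum>y\<in>UNIV. f (xs @ [(g, y)]))"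
    by (simp only: UNIV_Times_UNIV[symmetric] sum.cartesian_product[symmetric] case_prod_unfold)
       (simp add: sum.cartesian_product case_prod_unfold)
  finally show ?thesis .
qed

text \<open>\<open>q xs g\<close> stands for the conditional probability of the gate value
  \<open>g\<close> after the history \<open>xs\<close>. Nothing else is fixed, so laws with
  different event probabilities can be compared under one and the same gating rule.\<close>

locale gating_kernel =
  fixes q :: "(bool \<times> bool) list \<Rightarrow> bool \<Rightarrow> real"
  assumes q_nonneg: "0 \<le> q xs g" and q_sum: "q xs True + q xs False = 1"
begin

definition path_prob :: "(nat \<Rightarrow> real) \<Rightarrow> (bool \<times> bool) list \<Rightarrow> real" where
  "path_prob p xs = (\<Prod>s<length xs. q (take s xs) (fst (xs ! s)) * obs_weight (p s) (fst (xs ! s)) (snd (xs ! s)))"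

text \<open>A finite sum instead of an integral, so that linearity carries no integrability
  conditions; the vector-valued type serves real and complex test functions alike.\<close>

definition expect :: "(nat \<Rightarrow> real) \<Rightarrow> nat \<Rightarrow> ((bool \<times> bool) list \<Rightarrow> 'a::real_vector) \<Rightarrow> 'a" where
  "expect p t f = (\<Sum>xs\<in>histories t. path_prob p xs *\<^sub>R f xs)"

lemma path_prob_Nil [simp]: "path_prob p [] = 1"
  by (simp add: path_prob_def)

lemma path_prob_snoc:
  "path_prob p (xs @ [(g, y)]) = path_prob p xs * (q xs g * obs_weight (p (length xs)) g y)"
proof -
  have "(\<Prod>s<length xs. q (take s (xs @ [(g, y)])) (fst ((xs @ [(g, y)]) ! s)) *
            obs_weight (p s) (fst ((xs @ [(g, y)]) ! s)) (snd ((xs @ [(g, y)]) ! s)))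
      = path_prob p xs"
    unfolding path_prob_def by (intro prod.cong) (auto simp: nth_append)
  then show ?thesis
    by (simp add: path_prob_def)
qed

lemma path_prob_nonneg:
  assumes "\<And>s. s < length xs \<Longrightarrow> 0 \<le> p s \<and> p s \<le> 1"
  shows "0 \<le> path_prob p xs"
  unfolding path_prob_def using assms by (auto intro!: prod_nonneg mult_nonneg_nonneg q_nonneg obs_weight_nonneg)

text \<open>The tower property: condition on the first \<open>t\<close> observations, average over
  the next gate, and given the gate over its observation.\<close>

lemma expect_Suc:
  "expect p (Suc t) f
     = expect p t (\<lambda>xs. \<Sum>g\<in>UNIV. q xs g *\<^sub>R (\<Sum>y\<in>UNIV. obs_weight (p t) g y *\<^sub>R f (xs @ [(g, y)])))"
  unfolding expect_def sum_histories_Suc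
  by (intro sum.cong refl) (simp add: path_prob_snoc histories_def scaleR_sum_right scaleR_add_right)

lemma expect_cong: "(\<And>xs. xs \<in> histories t \<Longrightarrow> f xs = g xs) \<Longrightarrow> expect p t f = expect p t g"
  by (simp add: expect_def)

lemma expect_add: "expect p t (\<lambda>xs. f xs + g xs) = expect p t f + expect p t g"
  by (simp add: expect_def scaleR_add_right sum.distrib)

lemma expect_diff: "expect p t (\<lambda>xs. f xs - g xs) = expect p t f - expect p t g"
  by (simp add: expect_def scaleR_diff_right sum_subtractf)

lemma expect_mult_left:
  fixes f :: "_ \<Rightarrow> 'b::real_algebra"
  shows "expect p t (\<lambda>xs. c * f xs) = c * expect p t f"
  by (simp add: expect_def sum_distrib_left)

lemma expect_sum: "expect p t (\<lambda>xs. \<Sum>i\<in>I. f i xs) = (\<Sum>i\<in>I. expect p t (f i))"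
  unfolding expect_def scaleR_sum_right by (rule sum.swap)

lemma expect_const: "expect p t (\<lambda>_. c) = c"
proof (induction t)
  case 0
  show ?case by (simp add: expect_def)
next
  case (Suc t)
  have "(\<Sum>g\<in>UNIV. q xs g *\<^sub>R (\<Sum>y\<in>UNIV. obs_weight (p t) g y *\<^sub>R c)) = c" for xs
    by (simp add: UNIV_bool scaleR_add_left[symmetric] obs_weight_sum q_sum add.commute[of "obs_weight _ _ False"] add.commute[of "q _ False"])
  then show ?case
    using Suc by (simp add: expect_Suc)
qed

lemma expect_mono:
  fixes f g :: "_ \<Rightarrow> real"
  assumes "\<And>s. 0 \<le> p s \<and> p s \<le> 1" and "\<And>xs. xs \<in> histories t \<Longrightarrow> f xs \<le> g xs"
  shows "expect p t f \<le> expect p t g"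
  unfolding expect_def using assms by (intro sum_mono) (simp add: mult_left_mono path_prob_nonneg)

lemma expect_nonneg:
  fixes f :: "_ \<Rightarrow> real"
  assumes "\<And>s. 0 \<le> p s \<and> p s \<le> 1" and "\<And>xs. 0 \<le> f xs"
  shows "0 \<le> expect p t f"
  unfolding expect_def using assms by (intro sum_nonneg) (simp add: path_prob_nonneg)

lemma norm_expect_le:
  fixes f :: "_ \<Rightarrow> 'b::real_normed_vector"
  assumes "\<And>s. 0 \<le> p s \<and> p s \<le> 1"
  shows "norm (expect p t f) \<le> expect p t (\<lambda>xs. norm (f xs))"
  unfolding expect_def using assms by (intro order.trans[OF norm_sum]) (simp add: path_prob_nonneg)

text \<open>Peel off the last observation: its factor averages to 1 for either gate value, hence
  also under any mixture of the two, so the kernel does not matter.\<close>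

lemma expect_prod_eq_1:
  fixes f :: "nat \<Rightarrow> bool \<Rightarrow> bool \<Rightarrow> 'b::{real_normed_field}"
  assumes "\<And>s g. s < t \<Longrightarrow> (\<Sum>y\<in>UNIV. obs_weight (p s) g y *\<^sub>R f s g y) = 1"
  shows "expect p t (\<lambda>xs. \<Prod>s<t. f s (fst (xs ! s)) (snd (xs ! s))) = 1"
  using assms
proof (induction t)
  case 0
  show ?case by (simp add: expect_def)
next
  case (Suc t)
  let ?F = "\<lambda>xs. \<Prod>s<t. f s (fst (xs ! s)) (snd (xs ! s))"
  have "expect p (Suc t) (\<lambda>xs. \<Prod>s<Suc t. f s (fst (xs ! s)) (snd (xs ! s))) = expect p t ?F"
    unfolding expect_Suc
  proof (rule expect_cong)
    fix xs
    assume xs: "xs \<in> histories t"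
    have F: "?F (xs @ [(g, y)]) = ?F xs" for g y
      using xs by (intro prod.cong) (auto simp: histories_def nth_append)
    have nth: "(xs @ [x]) ! t = x" for x
      using xs by (auto simp: histories_def)
    have "(\<Sum>y\<in>UNIV. obs_weight (p t) g y *\<^sub>R (\<Prod>s<Suc t. f s (fst ((xs @ [(g, y)]) ! s)) (snd ((xs @ [(g, y)]) ! s))))
        = ?F xs * (\<Sum>y\<in>UNIV. obs_weight (p t) g y *\<^sub>R f t g y)" for g
      unfolding prod.lessThan_Suc F nth by (simp add: sum_distrib_left)
    then have "(\<Sum>y\<in>UNIV. obs_weight (p t) g y *\<^sub>R (\<Prod>s<Suc t. f s (fst ((xs @ [(g, y)]) ! s)) (snd ((xs @ [(g, y)]) ! s))))
        = ?F xs" for g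
      using Suc.prems by simp
    then show "(\<Sum>g\<in>UNIV. q xs g *\<^sub>R (\<Sum>y\<in>UNIV. obs_weight (p t) g y *\<^sub>R
           (\<Prod>s<Suc t. f s (fst ((xs @ [(g, y)]) ! s)) (snd ((xs @ [(g, y)]) ! s))))) = ?F xs"
      using q_sum[of xs] by (simp add: UNIV_bool scaleR_add_left[symmetric] add.commute)
  qed
  with Suc show ?case by simp
qed

text \<open>Dividing each factor by its conditional mean produces a product of mean 1, and each of
  the \<open>t\<close> divisors is at most \<open>c\<close>.\<close>

lemma expect_prod_le:
  fixes f :: "nat \<Rightarrow> bool \<Rightarrow> bool \<Rightarrow> real"
  assumes p: "\<And>s. 0 \<le> p s \<and> p s \<le> 1" and f: "\<And>s g y. f s g y \<ge> 0"
    and pos: "\<And>s g. s < t \<Longrightarrow> (\<Sum>y\<in>UNIV. obs_weight (p s) g y * f s g y) > 0"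
    and le: "\<And>s g. s < t \<Longrightarrow> (\<Sum>y\<in>UNIV. obs_weight (p s) g y * f s g y) \<le> c"
  shows "expect p t (\<lambda>xs. \<Prod>s<t. f s (fst (xs ! s)) (snd (xs ! s))) \<le> c ^ t"
proof -
  define C where "C = (\<lambda>s g. \<Sum>y\<in>UNIV. obs_weight (p s) g y * f s g y)"
  have "expect p t (\<lambda>xs. \<Prod>s<t. f s (fst (xs ! s)) (snd (xs ! s)))
      \<le> expect p t (\<lambda>xs. c ^ t * (\<Prod>s<t. f s (fst (xs ! s)) (snd (xs ! s)) / C s (fst (xs ! s))))"
  proof (rule expect_mono[OF p])
    fix xs :: "(bool \<times> bool) list"
    have "(\<Prod>s<t. f s (fst (xs ! s)) (snd (xs ! s)))
        \<le> (\<Prod>s<t. c * (f s (fst (xs ! s)) (snd (xs ! s)) / C s (fst (xs ! s))))"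
    proof (intro prod_mono conjI f)
      fix s
      assume "s \<in> {..<t}"
      then have C: "C s (fst (xs ! s)) > 0" "C s (fst (xs ! s)) \<le> c"
        using pos le unfolding C_def by auto
      have "C s (fst (xs ! s)) * (f s (fst (xs ! s)) (snd (xs ! s)) / C s (fst (xs ! s)))
          \<le> c * (f s (fst (xs ! s)) (snd (xs ! s)) / C s (fst (xs ! s)))"
        using C f by (intro mult_right_mono) auto
      then show "f s (fst (xs ! s)) (snd (xs ! s)) \<le> c * (f s (fst (xs ! s)) (snd (xs ! s)) / C s (fst (xs ! s)))"
        using C by simp
    qed
    then show "(\<Prod>s<t. f s (fst (xs ! s)) (snd (xs ! s)))
        \<le> c ^ t * (\<Prod>s<t. f s (fst (xs ! s)) (snd (xs ! s)) / C s (fst (xs ! s)))"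
      by (simp only: prod.distrib prod_constant card_lessThan)
  qed
  also have "\<dots> = c ^ t * expect p t (\<lambda>xs. \<Prod>s<t. f s (fst (xs ! s)) (snd (xs ! s)) / C s (fst (xs ! s)))"
    by (rule expect_mult_left)
  also have "expect p t (\<lambda>xs. \<Prod>s<t. f s (fst (xs ! s)) (snd (xs ! s)) / C s (fst (xs ! s))) = 1"
  proof (rule expect_prod_eq_1)
    fix s g
    assume "s < t"
    then have "C s g \<noteq> 0"
      using pos unfolding C_def by (metis less_irrefl)
    then show "(\<Sum>y\<in>UNIV. obs_weight (p s) g y *\<^sub>R (f s g y / C s g)) = 1"
      by (simp add: sum_divide_distrib[symmetric] C_def)
  qed
  finally show ?thesis by simp
qed

text \<open>Orthogonality of martingale increments: the cross term vanishes because the conditional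
  mean is 0, and the square of the new increment adds at most 1.\<close>

lemma expect_square_martingale_le:
  fixes f :: "nat \<Rightarrow> bool \<Rightarrow> bool \<Rightarrow> real"
  assumes p: "\<And>s. 0 \<le> p s \<and> p s \<le> 1"
    and mean: "\<And>s g. (\<Sum>y\<in>UNIV. obs_weight (p s) g y * f s g y) = 0"
    and bd: "\<And>s g y. \<bar>f s g y\<bar> \<le> 1"
  shows "expect p t (\<lambda>xs. (\<Sum>s<t. f s (fst (xs ! s)) (snd (xs ! s)))\<^sup>2) \<le> real t"
proof (induction t)
  case 0
  show ?case by (simp add: expect_def)
next
  case (Suc t)
  let ?F = "\<lambda>xs. \<Sum>s<t. f s (fst (xs ! s)) (snd (xs ! s))"
  have "expect p (Suc t) (\<lambda>xs. (\<Sum>s<Suc t. f s (fst (xs ! s)) (snd (xs ! s)))\<^sup>2) \<le> expect p t (\<lambda>xs. (?F xs)\<^sup>2 + 1)"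
    unfolding expect_Suc
  proof (rule expect_mono[OF p])
    fix xs
    assume xs: "xs \<in> histories t"
    have F: "?F (xs @ [(g, y)]) = ?F xs" for g y
      using xs by (intro sum.cong) (auto simp: histories_def nth_append)
    have expand: "(\<Sum>y\<in>UNIV. w y * (a + h y)\<^sup>2)
        = a\<^sup>2 * (\<Sum>y\<in>UNIV. w y) + 2 * a * (\<Sum>y\<in>UNIV. w y * h y) + (\<Sum>y\<in>UNIV. w y * (h y)\<^sup>2)"
      for a :: real and w h :: "bool \<Rightarrow> real"
      by (simp add: UNIV_bool power2_sum algebra_simps)
    have nth: "(xs @ [x]) ! t = x" for x
      using xs by (auto simp: histories_def)
    have "(\<Sum>y\<in>UNIV. obs_weight (p t) g y *\<^sub>R (\<Sum>s<Suc t. f s (fst ((xs @ [(g, y)]) ! s)) (snd ((xs @ [(g, y)]) ! s)))\<^sup>2)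
        = (\<Sum>y\<in>UNIV. obs_weight (p t) g y * (?F xs + f t g y)\<^sup>2)" for g
      unfolding sum.lessThan_Suc F nth by simp
    also have "\<dots> g = (?F xs)\<^sup>2 * (\<Sum>y\<in>UNIV. obs_weight (p t) g y)
        + 2 * ?F xs * (\<Sum>y\<in>UNIV. obs_weight (p t) g y * f t g y)
        + (\<Sum>y\<in>UNIV. obs_weight (p t) g y * (f t g y)\<^sup>2)" for g
      by (rule expand)
    also have "\<dots> g \<le> (?F xs)\<^sup>2 + 1" for g
    proof -
      have "obs_weight (p t) g y * (f t g y)\<^sup>2 \<le> obs_weight (p t) g y" for y
        using bd[of t g y] p[of t] by (intro mult_left_le) (auto simp: abs_square_le_1 obs_weight_nonneg)
      then have "(\<Sum>y\<in>UNIV. obs_weight (p t) g y * (f t g y)\<^sup>2) \<le> (\<Sum>y\<in>UNIV. obs_weight (p t) g y)"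
        by (intro sum_mono)
      moreover have "(\<Sum>y\<in>UNIV. obs_weight (p t) g y) = 1"
        using obs_weight_sum[of "p t" g] by (simp add: UNIV_bool add.commute)
      ultimately show ?thesis
        using mean by simp
    qed
    finally have step: "(\<Sum>y\<in>UNIV. obs_weight (p t) g y *\<^sub>R (\<Sum>s<Suc t. f s (fst ((xs @ [(g, y)]) ! s)) (snd ((xs @ [(g, y)]) ! s)))\<^sup>2)
        \<le> (?F xs)\<^sup>2 + 1" for g .
    have "(\<Sum>g\<in>UNIV. q xs g *\<^sub>R (\<Sum>y\<in>UNIV. obs_weight (p t) g y *\<^sub>R
           (\<Sum>s<Suc t. f s (fst ((xs @ [(g, y)]) ! s)) (snd ((xs @ [(g, y)]) ! s)))\<^sup>2))
        \<le> (\<Sum>g\<in>UNIV. q xs g * ((?F xs)\<^sup>2 + 1))"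
      by (intro sum_mono) (simp only: real_scaleR_def, intro mult_left_mono q_nonneg step[unfolded real_scaleR_def])
    also have "\<dots> = (?F xs)\<^sup>2 + 1"
      using q_sum[of xs] by (simp add: UNIV_bool distrib_right[symmetric] add.commute)
    finally show "(\<Sum>g\<in>UNIV. q xs g *\<^sub>R (\<Sum>y\<in>UNIV. obs_weight (p t) g y *\<^sub>R
           (\<Sum>s<Suc t. f s (fst ((xs @ [(g, y)]) ! s)) (snd ((xs @ [(g, y)]) ! s)))\<^sup>2)) \<le> (?F xs)\<^sup>2 + 1" .
  qed
  also have "\<dots> \<le> real (Suc t)"
    using Suc by (simp add: expect_add expect_const)
  finally show ?case .
qed

end

section \<open>The law of the history\<close>

text \<open>The probability of gating value \<open>g\<close> given the history \<open>xs\<close>; it does not involve the parameter.\<close>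

definition gating_prob :: "(nat \<Rightarrow> (bool \<times> bool) list \<Rightarrow> real \<Rightarrow> bool) \<Rightarrow> (bool \<times> bool) list \<Rightarrow> bool \<Rightarrow> real" where
  "gating_prob \<Phi> xs g = measure (uniform_measure lborel {0..1}) {u \<in> {0..1}. \<Phi> (length xs) xs u = g}"

lemma gating_set_measurable:
  assumes "(\<lambda>(xs, u). \<Psi> xs u) \<in>
             measurable (count_space (histories t) \<Otimes>\<^sub>M restrict_space borel {0..1}) (count_space UNIV)"
    and "length xs = t"
  shows "{u \<in> {0..1 :: real}. \<Psi> xs u = g} \<in> sets borel"
proof -
  have "(\<lambda>u. (xs, u)) \<in> restrict_space borel {0..1} \<rightarrow>\<^sub>M count_space (histories t) \<Otimes>\<^sub>M restrict_space borel {0..1 :: real}"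
    using assms(2) by (intro measurable_Pair1') (simp add: histories_def)
  from measurable_compose[OF this assms(1)]
  have "(\<lambda>u. \<Psi> xs u) \<in> restrict_space borel {0..1} \<rightarrow>\<^sub>M count_space UNIV"
    by simp
  then have "(\<lambda>u. \<Psi> xs u) -` {g} \<inter> space (restrict_space borel {0..1}) \<in> sets (restrict_space borel {0..1 :: real})"
    by (rule measurable_sets) simp
  also have "(\<lambda>u. \<Psi> xs u) -` {g} \<inter> space (restrict_space borel {0..1 :: real}) = {u \<in> {0..1}. \<Psi> xs u = g}"
    by (auto simp: space_restrict_space)
  finally show ?thesis
    by (subst (asm) sets_restrict_space_iff) auto
qed

lemma gating_kernel_gating_prob:
  assumes "\<And>t. (\<lambda>(xs, u). \<Phi> t xs u) \<in>
             measurable (count_space (histories t) \<Otimes>\<^sub>M restrict_space borel {0..1}) (count_space UNIV)"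
  shows "gating_kernel (gating_prob \<Phi>)"
proof
  interpret U: prob_space "uniform_measure lborel {0..1 :: real}"
    by (rule prob_space_uniform_measure) auto
  fix xs :: "(bool \<times> bool) list"
  show "0 \<le> gating_prob \<Phi> xs g" for g
    by (simp add: gating_prob_def)
  have meas: "{u \<in> {0..1 :: real}. \<Phi> (length xs) xs u = g} \<in> sets borel" for g
    by (rule gating_set_measurable[where \<Psi> = "\<Phi> (length xs)", OF assms refl])
  have "gating_prob \<Phi> xs True + gating_prob \<Phi> xs False
      = measure (uniform_measure lborel {0..1}) ({u \<in> {0..1}. \<Phi> (length xs) xs u = True} \<union> {u \<in> {0..1}. \<Phi> (length xs) xs u = False})"
    unfolding gating_prob_def using meas[of True] meas[of False] by (intro U.finite_measure_Union[symmetric]) auto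
  also have "{u \<in> {0..1}. \<Phi> (length xs) xs u = True} \<union> {u \<in> {0..1 :: real}. \<Phi> (length xs) xs u = False} = {0..1}"
    by auto
  also have "measure (uniform_measure lborel {0..1 :: real}) {0..1} = 1"
    by (simp add: measure_uniform_measure)
  finally show "gating_prob \<Phi> xs True + gating_prob \<Phi> xs False = 1" .
qed

text \<open>Translates the independence of generated sigma-algebras, the form in which the process
  definition states it, into a product formula for events.\<close>

lemma (in prob_space) prob_indep_vimage:
  assumes indep: "indep_set (sets (vimage_algebra (space M) U borel)) (sets (vimage_algebra (space M) V N))"
    and V: "V \<in> M \<rightarrow>\<^sub>M N" and A: "A \<in> sets borel" and B: "B \<in> sets N"
  shows "prob {\<omega> \<in> space M. U \<omega> \<in> A \<and> V \<omega> \<in> B} = prob {\<omega> \<in> space M. U \<omega> \<in> A} * prob {\<omega> \<in> space M. V \<omega> \<in> B}"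
proof -
  have "{\<omega> \<in> space M. U \<omega> \<in> A} \<in> sets (vimage_algebra (space M) U borel)"
    using in_vimage_algebra[OF A, of U "space M"] by (simp add: vimage_def Int_def conj_commute)
  moreover have "{\<omega> \<in> space M. V \<omega> \<in> B} \<in> sets (vimage_algebra (space M) V N)"
    using in_vimage_algebra[OF B, of V "space M"] by (simp add: vimage_def Int_def conj_commute)
  ultimately have "prob ({\<omega> \<in> space M. U \<omega> \<in> A} \<inter> {\<omega> \<in> space M. V \<omega> \<in> B})
      = prob {\<omega> \<in> space M. U \<omega> \<in> A} * prob {\<omega> \<in> space M. V \<omega> \<in> B}"
    by (rule indep_setD[OF indep])
  moreover have "{\<omega> \<in> space M. U \<omega> \<in> A} \<inter> {\<omega> \<in> space M. V \<omega> \<in> B} = {\<omega> \<in> space M. U \<omega> \<in> A \<and> V \<omega> \<in> B}"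
    by auto
  ultimately show ?thesis by simp
qed

lemma history_Suc: "history G Y (Suc t) \<omega> = history G Y t \<omega> @ [(G t \<omega>, Y t \<omega>)]"
  by (simp add: history_def)

text \<open>The target is finite and discrete, so it is enough that each single history is an
  event.\<close>

lemma history_measurable:
  assumes "\<And>t. G t \<in> measurable M (count_space UNIV)" "\<And>t. Y t \<in> measurable M (count_space UNIV)"
  shows "history G Y t \<in> measurable M (count_space (histories t))"
proof (induction t)
  case 0
  then show ?case by (simp add: history_def histories_def)
next
  case (Suc t)
  have "(\<lambda>\<omega>. (history G Y t \<omega>, (G t \<omega>, Y t \<omega>))) \<in> M \<rightarrow>\<^sub>M count_space (histories t \<times> UNIV)"
  proof (subst measurable_count_space_eq2)
    show "finite (histories t \<times> (UNIV :: (bool \<times> bool) set))" by simp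
    have "{\<omega> \<in> space M. history G Y t \<omega> = xs \<and> G t \<omega> = g \<and> Y t \<omega> = y} \<in> sets M" if "xs \<in> histories t" for xs g y
    proof -
      have [measurable]: "G t \<in> measurable M (count_space UNIV)" "Y t \<in> measurable M (count_space UNIV)"
        by fact+
      have [measurable]: "Measurable.pred M (\<lambda>\<omega>. history G Y t \<omega> = xs)"
        using Suc that by measurable
      show ?thesis by measurable
    qed
    then show "(\<lambda>\<omega>. (history G Y t \<omega>, (G t \<omega>, Y t \<omega>))) \<in> space M \<rightarrow> histories t \<times> UNIV \<and>
        (\<forall>z\<in>histories t \<times> UNIV. (\<lambda>\<omega>. (history G Y t \<omega>, (G t \<omega>, Y t \<omega>))) -` {z} \<inter> space M \<in> sets M)"
      by (auto simp: vimage_def Int_def conj_commute histories_def history_def)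
  qed
  moreover have "(\<lambda>(xs, x). xs @ [x]) \<in> count_space (histories t \<times> UNIV) \<rightarrow>\<^sub>M count_space (histories (Suc t))"
    by (auto simp: histories_Suc)
  ultimately have "(\<lambda>\<omega>. case (history G Y t \<omega>, (G t \<omega>, Y t \<omega>)) of (xs, x) \<Rightarrow> xs @ [x]) \<in> M \<rightarrow>\<^sub>M count_space (histories (Suc t))"
    by (rule measurable_compose)
  then show ?case
    by (simp add: history_Suc[abs_def])
qed

context prob_space
begin

text \<open>The history up to time \<open>t\<close> is independent of the events from \<open>t\<close> on; the assumptions give
  independence of \<open>U\<close> only one time step at a time, so this is carried along in the induction.\<close>

lemma prob_history_and_future_events:
  fixes p :: "nat \<Rightarrow> real" and \<Phi> :: "nat \<Rightarrow> (bool \<times> bool) list \<Rightarrow> real \<Rightarrow> bool"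
  assumes \<Phi>: "\<And>t. (\<lambda>(xs, u). \<Phi> t xs u) \<in>
             measurable (count_space (histories t) \<Otimes>\<^sub>M restrict_space borel {0..1}) (count_space UNIV)"
    and GY: "\<And>t. G t \<in> measurable M (count_space UNIV)" "\<And>t. Y t \<in> measurable M (count_space UNIV)"
    and p: "\<And>t. 0 \<le> p t \<and> p t \<le> 1"
    and Z: "indep_vars (\<lambda>_. count_space UNIV) Z UNIV"
    and Z_distr: "\<And>t. distr M (count_space UNIV) (Z t) = measure_pmf (bernoulli_pmf (p t))"
    and obs: "AE \<omega> in M. \<forall>t. Y t \<omega> = (G t \<omega> \<and> Z t \<omega>)"
    and U: "\<And>t. \<exists>U :: 'a \<Rightarrow> real. U \<in> borel_measurable M \<and>
              distr M lborel U = uniform_measure lborel {0..1} \<and>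
              indep_set (sets (vimage_algebra (space M) U borel))
                (sets (vimage_algebra (space M) (\<lambda>\<omega>. ((\<lambda>s. Z s \<omega>), history G Y t \<omega>))
                   ((\<Pi>\<^sub>M s\<in>UNIV. count_space UNIV) \<Otimes>\<^sub>M count_space (histories t)))) \<and>
              (AE \<omega> in M. G t \<omega> = \<Phi> t (history G Y t \<omega>) (U \<omega>))"
    and "length xs = t" and "finite J" and "\<And>s. s \<in> J \<Longrightarrow> t \<le> s"
  shows "prob {\<omega> \<in> space M. history G Y t \<omega> = xs \<and> (\<forall>s\<in>J. Z s \<omega> = z s)}
       = gating_kernel.path_prob (gating_prob \<Phi>) p xs * (\<Prod>s\<in>J. if z s then p s else 1 - p s)"
  using assms(9-)
proof (induction t arbitrary: xs J z)
  case 0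
  interpret gating_kernel "gating_prob \<Phi>"
    by (rule gating_kernel_gating_prob[OF \<Phi>])
  have Z_meas: "Z s \<in> M \<rightarrow>\<^sub>M count_space UNIV" for s
    using Z by (simp add: indep_vars_def)
  have single: "prob (Z s -` {b} \<inter> space M) = (if b then p s else 1 - p s)" for s b
  proof -
    have "prob (Z s -` {b} \<inter> space M) = measure (distr M (count_space UNIV) (Z s)) {b}"
      by (subst measure_distr[OF Z_meas]) simp_all
    also have "\<dots> = pmf (bernoulli_pmf (p s)) b"
      by (simp add: Z_distr pmf.rep_eq)
    finally show ?thesis
      using p[of s] by (cases b) simp_all
  qed
  have "prob {\<omega> \<in> space M. \<forall>s\<in>J. Z s \<omega> = z s} = (\<Prod>s\<in>J. if z s then p s else 1 - p s)"
  proof (cases "J = {}")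
    case True
    then show ?thesis by (simp add: prob_space)
  next
    case False
    have "{\<omega> \<in> space M. \<forall>s\<in>J. Z s \<omega> = z s} = (\<Inter>s\<in>J. Z s -` {z s} \<inter> space M)"
      using False by auto
    then show ?thesis
      using indep_varsD[OF Z False \<open>finite J\<close>, of "\<lambda>s. {z s}"] by (simp add: single)
  qed
  then show ?case
    using 0 by (simp add: history_def)
next
  case (Suc t)
  interpret gating_kernel "gating_prob \<Phi>"
    by (rule gating_kernel_gating_prob[OF \<Phi>])
  obtain zs g y where xs: "xs = zs @ [(g, y)]" and zs: "length zs = t"
    using Suc.prems(1) by (metis length_Suc_conv_rev surj_pair)
  obtain U where U_meas[measurable]: "U \<in> borel_measurable M"
    and U_distr: "distr M lborel U = uniform_measure lborel {0..1}"
    and U_indep: "indep_set (sets (vimage_algebra (space M) U borel))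
                (sets (vimage_algebra (space M) (\<lambda>\<omega>. ((\<lambda>s. Z s \<omega>), history G Y t \<omega>))
                   ((\<Pi>\<^sub>M s\<in>UNIV. count_space UNIV) \<Otimes>\<^sub>M count_space (histories t))))"
    and U_gate: "AE \<omega> in M. G t \<omega> = \<Phi> t (history G Y t \<omega>) (U \<omega>)"
    using U[of t] by blast
  have Z_meas[measurable]: "Z s \<in> M \<rightarrow>\<^sub>M count_space UNIV" for s
    using Z by (simp add: indep_vars_def)
  have hist_meas[measurable]: "history G Y s \<in> M \<rightarrow>\<^sub>M count_space (histories s)" for s
    by (rule history_measurable[OF GY])
  define A where "A = {u \<in> {0..1 :: real}. \<Phi> t zs u = g}"
  have A[measurable]: "A \<in> sets borel"
    unfolding A_def by (rule gating_set_measurable[where \<Psi> = "\<Phi> t", OF \<Phi> zs])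
  have U_A: "prob {\<omega> \<in> space M. U \<omega> \<in> A} = gating_prob \<Phi> zs g"
  proof -
    have "prob {\<omega> \<in> space M. U \<omega> \<in> A} = measure (distr M lborel U) A"
      by (subst measure_distr) (auto simp: vimage_def Int_def conj_commute)
    then show ?thesis
      by (simp add: U_distr gating_prob_def A_def zs)
  qed
  \<comment> \<open>\<open>A\<close> records only arguments in the unit interval, so the almost sure
    equivalence below needs \<open>U\<close> to lie there.\<close>
  have U_unit: "AE \<omega> in M. U \<omega> \<in> {0..1}"
  proof -
    have "AE u in distr M lborel U. u \<in> {0..1}"
      unfolding U_distr by (rule AE_uniform_measureI) auto
    then show ?thesis
      by (subst (asm) AE_distr_iff) auto
  qed
  \<comment> \<open>If the gate at time \<open>t\<close> is open, observing \<open>y\<close>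
    prescribes the event variable at time \<open>t\<close>, which joins the prescribed future
    events. A closed gate prescribes nothing.\<close>
  define J' where "J' = (if g then insert t J else J)"
  define z' where "z' = z(t := y)"
  have tJ: "t \<notin> J"
    using Suc.prems(3) by force
  have J'_fin: "finite J'" and J'_ge: "\<And>s. s \<in> J' \<Longrightarrow> t \<le> s"
    using Suc.prems(2,3) by (auto simp: J'_def Suc_le_eq split: if_splits dest: less_imp_le)
  \<comment> \<open>The past history and the prescribed events form a single event of the pair that
    \<open>U\<close> is independent of, so the gate factor splits off from both at once.\<close>
  define C where "C = {(\<zeta>, hs). (\<forall>s\<in>J'. \<zeta> s = z' s) \<and> hs = zs} \<inter>
      space ((\<Pi>\<^sub>M s\<in>(UNIV :: nat set). count_space (UNIV :: bool set)) \<Otimes>\<^sub>M count_space (histories t))"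
  have C: "C \<in> sets ((\<Pi>\<^sub>M s\<in>UNIV. count_space UNIV) \<Otimes>\<^sub>M count_space (histories t))"
  proof -
    have "C = {\<zeta> \<in> space (\<Pi>\<^sub>M s\<in>(UNIV :: nat set). count_space (UNIV :: bool set)). \<forall>s\<in>J'. \<zeta> s = z' s} \<times> {zs}"
      using zs by (auto simp: C_def space_pair_measure histories_def)
    moreover have "{\<zeta> \<in> space (\<Pi>\<^sub>M s\<in>(UNIV :: nat set). count_space (UNIV :: bool set)). \<forall>s\<in>J'. \<zeta> s = z' s}
        \<in> sets (\<Pi>\<^sub>M s\<in>(UNIV :: nat set). count_space (UNIV :: bool set))"
      using J'_fin by measurable
    ultimately show ?thesis
      using zs by (auto simp: histories_def)
  qed
  have V_meas: "(\<lambda>\<omega>. ((\<lambda>s. Z s \<omega>), history G Y t \<omega>)) \<in> M \<rightarrow>\<^sub>M (\<Pi>\<^sub>M s\<in>UNIV. count_space UNIV) \<Otimes>\<^sub>M count_space (histories t)"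
    by (intro measurable_Pair measurable_PiM_single' hist_meas) (auto simp: Z_meas)
  have V_C: "((\<lambda>s. Z s \<omega>), history G Y t \<omega>) \<in> C \<longleftrightarrow> history G Y t \<omega> = zs \<and> (\<forall>s\<in>J'. Z s \<omega> = z' s)"
    if "\<omega> \<in> space M" for \<omega>
    using measurable_space[OF V_meas that] by (auto simp: C_def)
  have prod_z': "(\<Prod>s\<in>J. if z' s then p s else 1 - p s) = (\<Prod>s\<in>J. if z s then p s else 1 - p s)"
    using tJ by (intro prod.cong) (auto simp: z'_def)
  have [measurable]: "Measurable.pred M (\<lambda>\<omega>. history G Y s \<omega> = hs)" for s hs
  proof (cases "hs \<in> histories s")
    case True
    then show ?thesis using hist_meas[of s] by measurable
  next
    case False
    then have "history G Y s \<omega> = hs \<longleftrightarrow> False" for \<omega>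
      by (auto simp: histories_def history_def)
    then show ?thesis by simp
  qed
  have J_fin: "finite J" by fact
  show ?case
  proof (cases "\<not> g \<and> y")
    \<comment> \<open>An observed event behind a closed gate: both sides are 0.\<close>
    case True
    have "AE \<omega> in M. \<not> (history G Y (Suc t) \<omega> = xs \<and> (\<forall>s\<in>J. Z s \<omega> = z s))"
      using obs
    proof eventually_elim
      case (elim \<omega>)
      have "Y t \<omega> \<longrightarrow> G t \<omega>" using elim by blast
      then show ?case using True by (auto simp: history_Suc xs)
    qed
    moreover have "{\<omega> \<in> space M. history G Y (Suc t) \<omega> = xs \<and> (\<forall>s\<in>J. Z s \<omega> = z s)} \<in> events"
      using J_fin by measurable
    ultimately have "prob {\<omega> \<in> space M. history G Y (Suc t) \<omega> = xs \<and> (\<forall>s\<in>J. Z s \<omega> = z s)} = 0"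
      by (subst prob_Collect_eq_0) auto
    then show ?thesis
      using True by (simp add: xs path_prob_snoc obs_weight_def)
  next
    case False
    have "prob {\<omega> \<in> space M. history G Y (Suc t) \<omega> = xs \<and> (\<forall>s\<in>J. Z s \<omega> = z s)}
        = prob {\<omega> \<in> space M. U \<omega> \<in> A \<and> ((\<lambda>s. Z s \<omega>), history G Y t \<omega>) \<in> C}"
    proof (rule prob_eq_AE)
      show "{\<omega> \<in> space M. history G Y (Suc t) \<omega> = xs \<and> (\<forall>s\<in>J. Z s \<omega> = z s)} \<in> events"
        using J_fin by measurable
      show "{\<omega> \<in> space M. U \<omega> \<in> A \<and> ((\<lambda>s. Z s \<omega>), history G Y t \<omega>) \<in> C} \<in> events"
        using V_meas C by measurable
      show "AE \<omega> in M. history G Y (Suc t) \<omega> = xs \<and> (\<forall>s\<in>J. Z s \<omega> = z s) \<longleftrightarrow>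
          U \<omega> \<in> A \<and> ((\<lambda>s. Z s \<omega>), history G Y t \<omega>) \<in> C"
        using obs U_gate U_unit AE_space
      proof eventually_elim
        case (elim \<omega>)
        have Yt: "Y t \<omega> = (G t \<omega> \<and> Z t \<omega>)" using elim(1) by blast
        have z'_J: "(\<forall>s\<in>J. Z s \<omega> = z' s) \<longleftrightarrow> (\<forall>s\<in>J. Z s \<omega> = z s)"
          using tJ by (auto simp: z'_def)
        show ?case
          unfolding V_C[OF elim(4)] history_Suc xs
          using elim(2,3) Yt False z'_J by (auto simp: A_def J'_def z'_def)
      qed
    qed
    also have "\<dots> = gating_prob \<Phi> zs g * prob {\<omega> \<in> space M. ((\<lambda>s. Z s \<omega>), history G Y t \<omega>) \<in> C}"
      using prob_indep_vimage[OF U_indep V_meas A C] by (simp add: U_A)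
    also have "{\<omega> \<in> space M. ((\<lambda>s. Z s \<omega>), history G Y t \<omega>) \<in> C}
        = {\<omega> \<in> space M. history G Y t \<omega> = zs \<and> (\<forall>s\<in>J'. Z s \<omega> = z' s)}"
      using V_C by auto
    \<comment> \<open>The induction hypothesis allows prescribed events from time \<open>t\<close>
      on, so it covers the time \<open>t\<close> that was just added to \<open>J'\<close>.\<close>
    also have "prob \<dots> = path_prob p zs * (\<Prod>s\<in>J'. if z' s then p s else 1 - p s)"
      by (rule Suc.IH[OF zs J'_fin J'_ge])
    also have "(\<Prod>s\<in>J'. if z' s then p s else 1 - p s) = obs_weight (p t) g y * (\<Prod>s\<in>J. if z s then p s else 1 - p s)"
      using False tJ J_fin prod_z' by (auto simp: J'_def obs_weight_def z'_def)
    finally show ?thesis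
      by (simp add: xs path_prob_snoc zs)
  qed
qed

end

text \<open>One kernel serves every parameter because the gating maps are chosen before the
  parameter. The point masses are the previous formula with no prescribed future events.\<close>

lemma history_law_eq_point_measure:
  assumes "ded_process K D \<Theta> p \<gamma> M G Y"
  obtains q where "gating_kernel q"
    and "\<And>\<theta> t. \<theta> \<in> \<Theta> \<Longrightarrow> history_law M G Y \<theta> t
            = point_measure (histories t) (\<lambda>xs. ennreal (gating_kernel.path_prob q (\<lambda>s. p s \<theta>) xs))"
proof -
  obtain \<Phi> :: "nat \<Rightarrow> (bool \<times> bool) list \<Rightarrow> real \<Rightarrow> bool" where
    \<Phi>: "\<And>t. (\<lambda>(xs, u). \<Phi> t xs u) \<in>
             measurable (count_space (histories t) \<Otimes>\<^sub>M restrict_space borel {0..1}) (count_space UNIV)"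
    and ex: "\<forall>\<theta>\<in>\<Theta>. \<exists>Z :: nat \<Rightarrow> 'b \<Rightarrow> bool.
           prob_space.indep_vars (M \<theta>) (\<lambda>_. count_space UNIV) Z UNIV \<and>
           (\<forall>t. distr (M \<theta>) (count_space UNIV) (Z t) = measure_pmf (bernoulli_pmf (p t \<theta>))) \<and>
           (AE \<omega> in M \<theta>. \<forall>t. Y t \<omega> = (G t \<omega> \<and> Z t \<omega>)) \<and>
           (\<forall>t. \<exists>U :: 'b \<Rightarrow> real.
              U \<in> borel_measurable (M \<theta>) \<and>
              distr (M \<theta>) lborel U = uniform_measure lborel {0..1} \<and>
              prob_space.indep_set (M \<theta>)
                (sets (vimage_algebra (space (M \<theta>)) U borel))
                (sets (vimage_algebra (space (M \<theta>))
                   (\<lambda>\<omega>. ((\<lambda>s. Z s \<omega>), history G Y t \<omega>))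
                   ((\<Pi>\<^sub>M s\<in>UNIV. count_space UNIV) \<Otimes>\<^sub>M count_space (histories t)))) \<and>
              (AE \<omega> in M \<theta>. G t \<omega> = \<Phi> t (history G Y t \<omega>) (U \<omega>)))"
    using assms unfolding ded_process_def by blast
  interpret gating_kernel "gating_prob \<Phi>"
    by (rule gating_kernel_gating_prob[OF \<Phi>])
  show thesis
  proof (rule that)
    show "gating_kernel (gating_prob \<Phi>)" by (rule gating_kernel_axioms)
    fix \<theta> t
    assume \<theta>: "\<theta> \<in> \<Theta>"
    have ps: "prob_space (M \<theta>)" and GY: "\<And>t. G t \<in> measurable (M \<theta>) (count_space UNIV)"
        "\<And>t. Y t \<in> measurable (M \<theta>) (count_space UNIV)"
      and p: "\<And>t. 0 \<le> p t \<theta> \<and> p t \<theta> \<le> 1"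
      using assms \<theta> unfolding ded_process_def by blast+
    interpret prob_space "M \<theta>" by (rule ps)
    have hist_meas: "history G Y t \<in> M \<theta> \<rightarrow>\<^sub>M count_space (histories t)"
      by (rule history_measurable[OF GY])
    obtain Z where Z: "indep_vars (\<lambda>_. count_space UNIV) Z UNIV"
        "\<And>t. distr (M \<theta>) (count_space UNIV) (Z t) = measure_pmf (bernoulli_pmf (p t \<theta>))"
        "AE \<omega> in M \<theta>. \<forall>t. Y t \<omega> = (G t \<omega> \<and> Z t \<omega>)"
        "\<And>t. \<exists>U :: 'b \<Rightarrow> real.
              U \<in> borel_measurable (M \<theta>) \<and>
              distr (M \<theta>) lborel U = uniform_measure lborel {0..1} \<and>
              indep_set
                (sets (vimage_algebra (space (M \<theta>)) U borel))
                (sets (vimage_algebra (space (M \<theta>))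
                   (\<lambda>\<omega>. ((\<lambda>s. Z s \<omega>), history G Y t \<omega>))
                   ((\<Pi>\<^sub>M s\<in>UNIV. count_space UNIV) \<Otimes>\<^sub>M count_space (histories t)))) \<and>
              (AE \<omega> in M \<theta>. G t \<omega> = \<Phi> t (history G Y t \<omega>) (U \<omega>))"
      using bspec[OF ex \<theta>] by blast
    show "history_law M G Y \<theta> t = point_measure (histories t) (\<lambda>xs. ennreal (path_prob (\<lambda>s. p s \<theta>) xs))"
      unfolding history_law_def
    proof (rule measure_eqI_finite[where A = "histories t"])
      fix xs
      assume xs: "xs \<in> histories t"
      then have "prob {\<omega> \<in> space (M \<theta>). history G Y t \<omega> = xs} = path_prob (\<lambda>s. p s \<theta>) xs"
        using prob_history_and_future_events[OF \<Phi> GY p Z, of xs t "{}" "\<lambda>_. True"]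
        by (simp add: histories_def)
      moreover have "{\<omega> \<in> space (M \<theta>). history G Y t \<omega> = xs} = history G Y t -` {xs} \<inter> space (M \<theta>)"
        by auto
      ultimately have "emeasure (distr (M \<theta>) (count_space (histories t)) (history G Y t)) {xs}
          = ennreal (path_prob (\<lambda>s. p s \<theta>) xs)"
        using xs by (subst emeasure_distr[OF hist_meas]) (simp_all add: emeasure_eq_measure)
      also have "\<dots> = emeasure (point_measure (histories t) (\<lambda>xs. ennreal (path_prob (\<lambda>s. p s \<theta>) xs))) {xs}"
        using xs by (simp add: emeasure_point_measure_finite)
      finally show "emeasure (distr (M \<theta>) (count_space (histories t)) (history G Y t)) {xs}
          = emeasure (point_measure (histories t) (\<lambda>xs. ennreal (path_prob (\<lambda>s. p s \<theta>) xs))) {xs}" .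
    qed (simp_all add: sets_point_measure)
  qed
qed

section \<open>Likelihood ratios and contiguity\<close>

context gating_kernel
begin

definition path_law :: "(nat \<Rightarrow> real) \<Rightarrow> nat \<Rightarrow> (bool \<times> bool) list measure" where
  "path_law p t = point_measure (histories t) (\<lambda>xs. ennreal (path_prob p xs))"

lemma space_path_law [simp]: "space (path_law p t) = histories t"
  and sets_path_law [simp]: "sets (path_law p t) = Pow (histories t)"
  by (simp_all add: path_law_def space_point_measure sets_point_measure)

lemma integral_path_law:
  fixes f :: "_ \<Rightarrow> 'b::{banach, second_countable_topology}"
  assumes "\<And>s. 0 \<le> p s \<and> p s \<le> 1"
  shows "integral\<^sup>L (path_law p t) f = expect p t f"
  unfolding path_law_def expect_def
  using assms by (intro lebesgue_integral_point_measure_finite) (auto intro: path_prob_nonneg)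

lemma measure_path_law:
  assumes "\<And>s. 0 \<le> p s \<and> p s \<le> 1" and "A \<subseteq> histories t"
  shows "measure (path_law p t) A = expect p t (indicator A)"
proof -
  have "measure (path_law p t) A = (\<Sum>xs\<in>A. path_prob p xs)"
    unfolding path_law_def
    using assms by (subst measure_point_measure_finite_if) (auto intro: path_prob_nonneg)
  also have "\<dots> = expect p t (indicator A)"
    unfolding expect_def using assms(2) by (simp add: indicator_def sum.If_cases Int_absorb1)
  finally show ?thesis .
qed

lemma prob_space_path_law:
  assumes p: "\<And>s. 0 \<le> p s \<and> p s \<le> 1"
  shows "prob_space (path_law p t)"
proof (rule prob_spaceI)
  have "emeasure (path_law p t) (histories t) = (\<Sum>xs\<in>histories t. ennreal (path_prob p xs))"
    unfolding path_law_def by (rule emeasure_point_measure_finite) auto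
  also have "\<dots> = ennreal (expect p t (\<lambda>_. 1))"
    using p by (simp add: expect_def path_prob_nonneg)
  finally show "emeasure (path_law p t) (space (path_law p t)) = 1"
    by (simp add: expect_const)
qed

lemma measure_path_law_Markov:
  assumes p: "\<And>s. 0 \<le> p s \<and> p s \<le> 1" and "\<epsilon> > 0"
  shows "measure (path_law p t) {xs \<in> histories t. \<bar>f xs\<bar> > \<epsilon>} \<le> expect p t (\<lambda>xs. \<bar>f xs\<bar>) / \<epsilon>"
proof -
  have "measure (path_law p t) {xs \<in> histories t. \<bar>f xs\<bar> > \<epsilon>}
      \<le> expect p t (\<lambda>xs. (1 / \<epsilon>) * \<bar>f xs\<bar>)"
    unfolding measure_path_law[OF p Collect_restrict]
    using \<open>\<epsilon> > 0\<close> by (intro expect_mono[OF p]) (auto simp: indicator_def)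
  then show ?thesis
    by (simp only: expect_mult_left) simp
qed

text \<open>The gating factors have cancelled. An observed event behind a closed gate gives
  \<open>0 / 0 = 0\<close>, which is harmless because such a history has weight 0 under both
  laws.\<close>

definition likelihood_ratio :: "(nat \<Rightarrow> real) \<Rightarrow> (nat \<Rightarrow> real) \<Rightarrow> nat \<Rightarrow> (bool \<times> bool) list \<Rightarrow> real" where
  "likelihood_ratio p' p t xs =
     (\<Prod>s<t. obs_weight (p' s) (fst (xs ! s)) (snd (xs ! s)) / obs_weight (p s) (fst (xs ! s)) (snd (xs ! s)))"

lemma path_prob_eq_likelihood_ratio:
  assumes "\<And>s. 0 < p s \<and> p s < 1" and xs: "xs \<in> histories t"
  shows "path_prob p' xs = path_prob p xs * likelihood_ratio p' p t xs"
proof -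
  have "obs_weight (p' s) g y = obs_weight (p s) g y * (obs_weight (p' s) g y / obs_weight (p s) g y)" for s g y
    using assms(1)[of s] by (auto simp: obs_weight_def)
  then have "path_prob p' xs = (\<Prod>s<length xs. (q (take s xs) (fst (xs ! s)) * obs_weight (p s) (fst (xs ! s)) (snd (xs ! s))) *
       (obs_weight (p' s) (fst (xs ! s)) (snd (xs ! s)) / obs_weight (p s) (fst (xs ! s)) (snd (xs ! s))))"
    unfolding path_prob_def by (intro prod.cong refl) (metis mult.assoc)
  then show ?thesis
    using xs by (simp only: path_prob_def likelihood_ratio_def histories_def prod.distrib mem_Collect_eq)
qed

lemma likelihood_ratio_nonneg:
  assumes "\<And>s. 0 \<le> p s \<and> p s \<le> 1" "\<And>s. 0 \<le> p' s \<and> p' s \<le> 1"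
  shows "0 \<le> likelihood_ratio p' p t xs"
  unfolding likelihood_ratio_def using assms by (intro prod_nonneg divide_nonneg_nonneg) (auto intro: obs_weight_nonneg)

lemma obs_weight_pos_if_path_prob_pos:
  assumes "path_prob p xs \<noteq> 0" and "xs \<in> histories t" "s < t"
  shows "obs_weight (p s) (fst (xs ! s)) (snd (xs ! s)) \<noteq> 0"
  using assms by (auto simp: path_prob_def histories_def)

text \<open>The product ratio is a density, hence almost surely the Radon-Nikodym derivative. A
  closed gate contributes the factor 1 and so nothing to the sum of logarithms.\<close>

lemma log_lr_path_law:
  assumes p: "\<And>s. 0 < p s \<and> p s < 1" and p': "\<And>s. 0 < p' s \<and> p' s < 1"
  shows "AE xs in path_law p t. log_lr (path_law p' t) (path_law p t) xs
    = (\<Sum>s<t. of_bool (fst (xs ! s)) * (of_bool (snd (xs ! s)) * ln (p' s / p s)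
          + (1 - of_bool (snd (xs ! s))) * ln ((1 - p' s) / (1 - p s))))"
proof -
  have p01: "0 \<le> p s \<and> p s \<le> 1" and p'01: "0 \<le> p' s \<and> p' s \<le> 1" for s
    using p[of s] p'[of s] by auto
  interpret prob_space "path_law p t"
    by (rule prob_space_path_law[OF p01])
  have "density (path_law p t) (\<lambda>xs. ennreal (likelihood_ratio p' p t xs)) = path_law p' t"
    unfolding path_law_def point_measure_def
  proof (subst density_density_eq)
    show "density (count_space (histories t)) (\<lambda>xs. ennreal (path_prob p xs) * ennreal (likelihood_ratio p' p t xs))
        = density (count_space (histories t)) (\<lambda>xs. ennreal (path_prob p' xs))"
      using path_prob_eq_likelihood_ratio[where p = p and p' = p', OF p] p01 p'01
      by (intro density_cong) (auto simp: AE_count_space ennreal_mult' path_prob_nonneg)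
  qed auto
  then have "AE xs in path_law p t. ennreal (likelihood_ratio p' p t xs) = RN_deriv (path_law p t) (path_law p' t) xs"
    by (rule RN_deriv_unique[rotated]) (simp add: path_law_def)
  \<comment> \<open>The logarithm of the product splits only if no factor is \<open>0 / 0\<close>;
    positive path weight ensures this.\<close>
  moreover have "AE xs in path_law p t. path_prob p xs \<noteq> 0 \<and> xs \<in> histories t"
    unfolding path_law_def point_measure_def by (subst AE_density) (auto simp: AE_count_space)
  ultimately show ?thesis
  proof eventually_elim
    case (elim xs)
    have w: "obs_weight (p s) (fst (xs ! s)) (snd (xs ! s)) \<noteq> 0" if "s < t" for s
      using obs_weight_pos_if_path_prob_pos[of p xs t s] elim that by blast
    have factor: "obs_weight (p' s) g y / obs_weight (p s) g y > 0 \<and>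
        ln (obs_weight (p' s) g y / obs_weight (p s) g y)
          = of_bool g * (of_bool y * ln (p' s / p s) + (1 - of_bool y) * ln ((1 - p' s) / (1 - p s)))"
      if "obs_weight (p s) g y \<noteq> 0" for s g y
      using that p[of s] p'[of s] by (auto simp: obs_weight_def split: if_splits)
    have "log_lr (path_law p' t) (path_law p t) xs = ln (likelihood_ratio p' p t xs)"
      unfolding log_lr_def elim(1)[symmetric] by (simp add: likelihood_ratio_nonneg p01 p'01)
    also have "\<dots> = (\<Sum>s<t. ln (obs_weight (p' s) (fst (xs ! s)) (snd (xs ! s)) / obs_weight (p s) (fst (xs ! s)) (snd (xs ! s))))"
      unfolding likelihood_ratio_def
    proof (rule ln_prod)
      fix s
      assume "s \<in> {..<t}"
      then have "s < t" by simp
      from factor[OF w[OF this]] show "obs_weight (p' s) (fst (xs ! s)) (snd (xs ! s)) / obs_weight (p s) (fst (xs ! s)) (snd (xs ! s)) \<noteq> 0"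
        by (metis less_irrefl)
    qed simp
    also have "\<dots> = (\<Sum>s<t. of_bool (fst (xs ! s)) * (of_bool (snd (xs ! s)) * ln (p' s / p s)
          + (1 - of_bool (snd (xs ! s))) * ln ((1 - p' s) / (1 - p s))))"
      using factor w by (intro sum.cong) auto
    finally show ?case .
  qed
qed

text \<open>The conditional second moment of one factor is 1 plus the chi-square distance of two
  Bernoulli laws if the gate is open, and 1 if it is closed. The margin gives
  \<open>a\<^sup>2 \<le> p s * (1 - p s)\<close>.\<close>

lemma expect_likelihood_ratio_square_le:
  assumes p: "\<And>s. a \<le> p s \<and> p s \<le> 1 - a" and p': "\<And>s. a \<le> p' s \<and> p' s \<le> 1 - a" and a: "a > 0"
    and d: "\<And>s. \<bar>p' s - p s\<bar> \<le> d"
  shows "expect p t (\<lambda>xs. (likelihood_ratio p' p t xs)\<^sup>2) \<le> (1 + d\<^sup>2 / a\<^sup>2) ^ t"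
proof -
  let ?f = "\<lambda>s g y. (obs_weight (p' s) g y / obs_weight (p s) g y)\<^sup>2"
  have p01: "0 < p s \<and> p s < 1" for s
    using p[of s] a by linarith
  have chi2: "(\<Sum>y\<in>UNIV. obs_weight (p s) g y * ?f s g y)
      = (if g then 1 + (p' s - p s)\<^sup>2 / (p s * (1 - p s)) else 1)" for s g
    using p01[of s] by (auto simp: UNIV_bool obs_weight_def field_simps power2_eq_square)
  have le: "(p' s - p s)\<^sup>2 / (p s * (1 - p s)) \<le> d\<^sup>2 / a\<^sup>2" for s
  proof (rule frac_le)
    show "(p' s - p s)\<^sup>2 \<le> d\<^sup>2"
      using power_mono[OF d[of s], of 2] by simp
    show "a\<^sup>2 \<le> p s * (1 - p s)"
      unfolding power2_eq_square using p[of s] a by (intro mult_mono) linarith+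
  qed (use a in auto)
  have nonneg: "(p' s - p s)\<^sup>2 / (p s * (1 - p s)) \<ge> 0" for s
    using p01[of s] by simp
  have "expect p t (\<lambda>xs. \<Prod>s<t. ?f s (fst (xs ! s)) (snd (xs ! s))) \<le> (1 + d\<^sup>2 / a\<^sup>2) ^ t"
  proof (rule expect_prod_le)
    fix s g
    show "0 < (\<Sum>y\<in>UNIV. obs_weight (p s) g y * ?f s g y)"
      unfolding chi2 using nonneg[of s] by auto
    show "(\<Sum>y\<in>UNIV. obs_weight (p s) g y * ?f s g y) \<le> 1 + d\<^sup>2 / a\<^sup>2"
      unfolding chi2 using le[of s] nonneg[of s] by (auto intro: order_trans)
  qed (use p01 in \<open>auto intro: less_imp_le\<close>)
  then show ?thesis
    by (simp add: likelihood_ratio_def prod_power_distrib)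
qed

text \<open>Cauchy-Schwarz for the mean of the likelihood ratio times the indicator of
  \<open>A\<close>, with a square root of the path weight given to each factor.\<close>

lemma measure_path_law_le_sqrt:
  assumes p: "\<And>s. a \<le> p s \<and> p s \<le> 1 - a" and p': "\<And>s. a \<le> p' s \<and> p' s \<le> 1 - a" and a: "a > 0"
    and d: "\<And>s. \<bar>p' s - p s\<bar> \<le> d" and A: "A \<subseteq> histories t"
  shows "measure (path_law p' t) A \<le> sqrt ((1 + d\<^sup>2 / a\<^sup>2) ^ t * measure (path_law p t) A)"
proof -
  have p01: "0 < p s \<and> p s < 1" and p'01: "0 \<le> p' s \<and> p' s \<le> 1" for s
    using p[of s] p'[of s] a by linarith+
  have p01': "0 \<le> p s \<and> p s \<le> 1" for s
    using p01[of s] by simp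
  have nn: "path_prob p xs \<ge> 0" for xs
    using p01' by (simp add: path_prob_nonneg)
  define L where "L = likelihood_ratio p' p t"
  have "measure (path_law p' t) A = (\<Sum>xs\<in>histories t. path_prob p' xs * indicator A xs)"
    unfolding measure_path_law[OF p'01 A] expect_def by simp
  also have "\<dots> = (\<Sum>xs\<in>histories t. (sqrt (path_prob p xs) * L xs) * (sqrt (path_prob p xs) * indicator A xs))"
  proof (intro sum.cong refl)
    fix xs
    assume "xs \<in> histories t"
    then have "path_prob p' xs = (sqrt (path_prob p xs))\<^sup>2 * L xs"
      using path_prob_eq_likelihood_ratio[where p = p and p' = p', OF p01] nn[of xs] by (simp add: L_def)
    then show "path_prob p' xs * indicator A xs
        = (sqrt (path_prob p xs) * L xs) * (sqrt (path_prob p xs) * indicator A xs)"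
      by (simp only: power2_eq_square mult_ac)
  qed
  also have "\<dots> \<le> sqrt ((\<Sum>xs\<in>histories t. (sqrt (path_prob p xs) * L xs)\<^sup>2) *
                        (\<Sum>xs\<in>histories t. (sqrt (path_prob p xs) * indicator A xs)\<^sup>2))"
    by (rule real_le_rsqrt[OF Cauchy_Schwarz_ineq_sum])
  also have "(\<Sum>xs\<in>histories t. (sqrt (path_prob p xs) * L xs)\<^sup>2) = expect p t (\<lambda>xs. (L xs)\<^sup>2)"
    by (simp add: expect_def power_mult_distrib nn)
  also have "(\<Sum>xs\<in>histories t. (sqrt (path_prob p xs) * indicator A xs)\<^sup>2) = measure (path_law p t) A"
    unfolding measure_path_law[OF p01' A] expect_def
    by (intro sum.cong refl) (simp add: power_mult_distrib nn indicator_def)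
  also have "sqrt (expect p t (\<lambda>xs. (L xs)\<^sup>2) * measure (path_law p t) A)
      \<le> sqrt ((1 + d\<^sup>2 / a\<^sup>2) ^ t * measure (path_law p t) A)"
    unfolding L_def using expect_likelihood_ratio_square_le[where p = p and p' = p' and a = a, OF p p' a d]
    by (intro real_sqrt_le_mono mult_right_mono) auto
  finally show ?thesis .
qed

text \<open>For differences of order \<open>1 / sqrt t\<close> the factor is bounded independently
  of \<open>t\<close>, since \<open>1 + x \<le> exp x\<close>.\<close>

lemma measure_path_law_le_sqrt_exp:
  assumes "\<And>s. a \<le> p s \<and> p s \<le> 1 - a" "\<And>s. a \<le> p' s \<and> p' s \<le> 1 - a" "a > 0"
    and "\<And>s. \<bar>p' s - p s\<bar> \<le> b / sqrt (real t)" and A: "A \<subseteq> histories t" and t: "t > 0"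
  shows "measure (path_law p' t) A \<le> sqrt (exp (b\<^sup>2 / a\<^sup>2) * measure (path_law p t) A)"
proof -
  have "(1 + (b / sqrt (real t))\<^sup>2 / a\<^sup>2) ^ t \<le> exp ((b / sqrt (real t))\<^sup>2 / a\<^sup>2) ^ t"
    by (intro power_mono exp_ge_add_one_self) auto
  also have "\<dots> = exp (b\<^sup>2 / a\<^sup>2)"
    using t by (simp add: exp_of_nat_mult[symmetric] power_divide)
  finally have "sqrt ((1 + (b / sqrt (real t))\<^sup>2 / a\<^sup>2) ^ t * measure (path_law p t) A)
      \<le> sqrt (exp (b\<^sup>2 / a\<^sup>2) * measure (path_law p t) A)"
    by (intro real_sqrt_le_mono mult_right_mono) auto
  then show ?thesis
    by (rule order_trans[OF measure_path_law_le_sqrt[where p = p and p' = p' and a = a, OF assms(1-4) A]])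
qed

end

text \<open>The bound is asked only for large indices, since a shifted parameter may lie outside the
  parameter set for small ones.\<close>

lemma contiguous_toI_sqrt:
  assumes "\<forall>\<^sub>F n in sequentially. \<forall>A\<in>sets (P n). measure (Q n) A \<le> sqrt (c * measure (P n) A)"
  shows "contiguous_to Q P"
  unfolding contiguous_to_def
proof (intro allI impI)
  fix A
  assume A: "\<forall>n. A n \<in> sets (P n)" and "(\<lambda>n. measure (P n) (A n)) \<longlonglongrightarrow> 0"
  then have "(\<lambda>n. sqrt (c * measure (P n) (A n))) \<longlonglongrightarrow> sqrt (c * 0)"
    by (intro tendsto_intros)
  then have "(\<lambda>n. sqrt (c * measure (P n) (A n))) \<longlonglongrightarrow> 0"
    by simp
  then show "(\<lambda>n. measure (Q n) (A n)) \<longlonglongrightarrow> 0"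
    by (rule tendsto_sandwich[rotated 2, OF tendsto_const])
       (use assms A in \<open>auto elim: eventually_mono\<close>)
qed

section \<open>The quadratic expansion of the log-likelihood ratio\<close>

text \<open>Periodicity makes every coefficient of the log-likelihood ratio and of the score a
  function of \<open>s mod K\<close>. These counts and the residual sums below, one of each per
  residue, therefore carry all the randomness.\<close>

definition gate_count :: "nat \<Rightarrow> nat \<Rightarrow> nat \<Rightarrow> (bool \<times> bool) list \<Rightarrow> real" where
  "gate_count K r t xs = (\<Sum>s<t. of_bool (s mod K = r) * of_bool (fst (xs ! s)))"

definition residual_sum :: "(nat \<Rightarrow> real) \<Rightarrow> nat \<Rightarrow> nat \<Rightarrow> nat \<Rightarrow> (bool \<times> bool) list \<Rightarrow> real" where
  "residual_sum p K r t xs =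
     (\<Sum>s<t. of_bool (s mod K = r) * (of_bool (fst (xs ! s)) * (of_bool (snd (xs ! s)) - p s)))"

lemma sum_by_residue:
  fixes f :: "nat \<Rightarrow> nat \<Rightarrow> 'a::comm_semiring_1"
  assumes "K \<ge> 1"
  shows "(\<Sum>s<t. f (s mod K) s) = (\<Sum>r<K. \<Sum>s<t. of_bool (s mod K = r) * f r s)"
proof -
  have "(\<Sum>r<K. of_bool (s mod K = r) * f r s) = f (s mod K) s" for s
    using assms by (simp add: of_bool_def if_distrib[of "\<lambda>x. x * _"] cong: if_cong)
  then have "(\<Sum>s<t. f (s mod K) s) = (\<Sum>s<t. \<Sum>r<K. of_bool (s mod K = r) * f r s)"
    by simp
  also have "\<dots> = (\<Sum>r<K. \<Sum>s<t. of_bool (s mod K = r) * f r s)"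
    by (rule sum.swap)
  finally show ?thesis .
qed

lemma sum_residual_by_residue:
  fixes c :: "nat \<Rightarrow> 'a::{real_algebra_1, comm_ring_1}"
  assumes "K \<ge> 1"
  shows "(\<Sum>s<t. of_real (of_bool (fst (xs ! s)) * (of_bool (snd (xs ! s)) - p s)) * c (s mod K))
       = (\<Sum>r<K. of_real (residual_sum p K r t xs) * c r)"
  unfolding sum_by_residue[OF assms, where f = "\<lambda>r s. of_real (of_bool (fst (xs ! s)) * (of_bool (snd (xs ! s)) - p s)) * c r"]
    residual_sum_def of_real_sum sum_distrib_right
  by (intro sum.cong refl) (simp add: of_bool_def)

lemma gate_count_bounds: "0 \<le> gate_count K r t xs" "gate_count K r t xs \<le> real t"
proof -
  show "0 \<le> gate_count K r t xs"
    unfolding gate_count_def by (intro sum_nonneg) auto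
  have "gate_count K r t xs \<le> (\<Sum>s<t. 1)"
    unfolding gate_count_def by (intro sum_mono) auto
  then show "gate_count K r t xs \<le> real t" by simp
qed

lemma sum_gate_by_residue:
  fixes c :: "nat \<Rightarrow> 'a::{real_algebra_1, comm_ring_1}"
  assumes "K \<ge> 1"
  shows "(\<Sum>s<t. of_bool (fst (xs ! s)) * c (s mod K)) = (\<Sum>r<K. of_real (gate_count K r t xs) * c r)"
  unfolding sum_by_residue[OF assms, where f = "\<lambda>r s. of_bool (fst (xs ! s)) * c r"]
    gate_count_def of_real_sum sum_distrib_right
  by (intro sum.cong refl) (simp add: of_bool_def)

context gating_kernel
begin

text \<open>Completing the square gives
  \<open>\<bar>x\<bar> \<le> x\<^sup>2 / (2 * sqrt t) + sqrt t / 2\<close>; both terms have mean at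
  most \<open>sqrt t / 2\<close> because the second moment is at most \<open>t\<close>.\<close>

lemma expect_abs_residual_sum_le:
  assumes p: "\<And>s. 0 \<le> p s \<and> p s \<le> 1"
  shows "expect p t (\<lambda>xs. \<bar>residual_sum p K r t xs\<bar>) \<le> sqrt (real t)"
proof (cases "t = 0")
  case True
  then show ?thesis by (simp add: residual_sum_def expect_def)
next
  case False
  then have st: "sqrt (real t) > 0" by simp
  let ?f = "\<lambda>s g y. of_bool (s mod K = r) * (of_bool g * (of_bool y - p s)) :: real"
  have sq: "expect p t (\<lambda>xs. (residual_sum p K r t xs)\<^sup>2) \<le> real t"
    unfolding residual_sum_def
  proof (rule expect_square_martingale_le[where f = ?f, OF p])
    show "(\<Sum>y\<in>UNIV. obs_weight (p s) g y * ?f s g y) = 0" for s g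
      by (auto simp: UNIV_bool obs_weight_def algebra_simps)
    show "\<bar>?f s g y\<bar> \<le> 1" for s g y
      using p[of s] by (auto simp: abs_mult)
  qed
  have "expect p t (\<lambda>xs. \<bar>residual_sum p K r t xs\<bar>)
      \<le> expect p t (\<lambda>xs. (1 / (2 * sqrt (real t))) * (residual_sum p K r t xs)\<^sup>2 + sqrt (real t) / 2)"
  proof (rule expect_mono[OF p])
    fix xs
    have "0 \<le> (\<bar>residual_sum p K r t xs\<bar> - sqrt (real t))\<^sup>2"
      by simp
    then have "2 * sqrt (real t) * \<bar>residual_sum p K r t xs\<bar> \<le> (residual_sum p K r t xs)\<^sup>2 + sqrt (real t) * sqrt (real t)"
      unfolding power2_diff by (simp add: power2_eq_square algebra_simps)
    then show "\<bar>residual_sum p K r t xs\<bar> \<le> (1 / (2 * sqrt (real t))) * (residual_sum p K r t xs)\<^sup>2 + sqrt (real t) / 2"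
      using st by (simp add: field_simps del: real_sqrt_mult_self)
  qed
  also have "\<dots> = (1 / (2 * sqrt (real t))) * expect p t (\<lambda>xs. (residual_sum p K r t xs)\<^sup>2) + sqrt (real t) / 2"
    by (simp only: expect_add expect_mult_left expect_const)
  also have "\<dots> \<le> (1 / (2 * sqrt (real t))) * real t + sqrt (real t) / 2"
    using sq st by (intro add_right_mono mult_left_mono) auto
  also have "\<dots> = sqrt (real t)"
    by (simp add: real_div_sqrt field_simps)
  finally show ?thesis .
qed

lemma expect_abs_linear_combination_le:
  assumes p: "\<And>s. 0 \<le> p s \<and> p s \<le> 1"
  shows "expect p t (\<lambda>xs. \<bar>\<Sum>i\<in>I. f i xs * (c i :: real)\<bar>) \<le> (\<Sum>i\<in>I. expect p t (\<lambda>xs. \<bar>f i xs\<bar>) * \<bar>c i\<bar>)"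
proof -
  have "expect p t (\<lambda>xs. \<bar>\<Sum>i\<in>I. f i xs * c i\<bar>) \<le> expect p t (\<lambda>xs. \<Sum>i\<in>I. \<bar>c i\<bar> * \<bar>f i xs\<bar>)"
    by (rule expect_mono[OF p]) (auto intro!: order_trans[OF sum_abs] sum_mono simp: abs_mult)
  also have "\<dots> = (\<Sum>i\<in>I. expect p t (\<lambda>xs. \<bar>f i xs\<bar>) * \<bar>c i\<bar>)"
    by (simp only: expect_sum expect_mult_left mult.commute)
  finally show ?thesis .
qed

text \<open>\<open>A t r\<close> and \<open>B t r\<close> are the increments of the log-likelihood ratio at a gated time of
  residue \<open>r\<close>, with and without an event.\<close>

lemma local_quadratic_expansion:
  fixes A B v :: "nat \<Rightarrow> nat \<Rightarrow> real" and p \<kappa> :: "nat \<Rightarrow> real"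
  assumes K: "K \<ge> 1" and p: "\<And>s. 0 < p s \<and> p s < 1" and per: "\<And>s. p (s mod K) = p s"
    and freq: "\<And>r. r < K \<Longrightarrow> (\<lambda>t. expect p t (\<lambda>xs. \<bar>gate_count K r t xs / real t - \<kappa> r\<bar>)) \<longlonglongrightarrow> 0"
    and lin: "\<And>r. r < K \<Longrightarrow> (\<lambda>t. sqrt (real t) * (A t r - B t r) - v t r / p r) \<longlonglongrightarrow> 0"
    and quad: "\<And>r. r < K \<Longrightarrow> (\<lambda>t. real t * (p r * A t r + (1 - p r) * B t r) + (1 - p r) / (2 * p r) * (v t r)\<^sup>2) \<longlonglongrightarrow> 0"
    and bdd: "\<And>r. r < K \<Longrightarrow> Bseq (\<lambda>t. v t r)"
  shows "(\<lambda>t. expect p t (\<lambda>xs. \<bar>(\<Sum>s<t. of_bool (fst (xs ! s)) * (of_bool (snd (xs ! s)) * A t (s mod K)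
            + (1 - of_bool (snd (xs ! s))) * B t (s mod K)))
         - (1 / sqrt (real t) * (\<Sum>s<t. of_bool (fst (xs ! s)) * ((of_bool (snd (xs ! s)) - p s) / p s) * v t (s mod K))
            - (\<Sum>r<K. \<kappa> r * ((1 - p r) / p r) * (v t r)\<^sup>2) / 2)\<bar>)) \<longlonglongrightarrow> 0"
proof -
  have p01: "0 \<le> p s \<and> p s \<le> 1" for s
    using p[of s] by auto
  \<comment> \<open>\<open>\<alpha>\<close> and \<open>\<beta>\<close> are the null sequences of
    \<open>lin\<close> and \<open>quad\<close>; \<open>\<eta>\<close> is the limiting value of
    \<open>t\<close> times the conditional mean of a gated increment, so that its sum carries the
    error in the gating frequencies.\<close>
  define \<alpha> where "\<alpha> = (\<lambda>t r. sqrt (real t) * (A t r - B t r) - v t r / p r)"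
  define \<beta> where "\<beta> = (\<lambda>t r. real t * (p r * A t r + (1 - p r) * B t r) + (1 - p r) / (2 * p r) * (v t r)\<^sup>2)"
  define \<eta> where "\<eta> = (\<lambda>t r. - ((1 - p r) / (2 * p r) * (v t r)\<^sup>2))"
  define F where "F = (\<lambda>t r. expect p t (\<lambda>xs. \<bar>gate_count K r t xs / real t - \<kappa> r\<bar>))"
  let ?D = "\<lambda>t xs. (\<Sum>s<t. of_bool (fst (xs ! s)) * (of_bool (snd (xs ! s)) * A t (s mod K)
            + (1 - of_bool (snd (xs ! s))) * B t (s mod K)))
         - (1 / sqrt (real t) * (\<Sum>s<t. of_bool (fst (xs ! s)) * ((of_bool (snd (xs ! s)) - p s) / p s) * v t (s mod K))
            - (\<Sum>r<K. \<kappa> r * ((1 - p r) / p r) * (v t r)\<^sup>2) / 2)"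
  have decomp: "?D t xs = (\<Sum>r<K. residual_sum p K r t xs * (\<alpha> t r / sqrt (real t)))
      + (\<Sum>r<K. (gate_count K r t xs / real t) * \<beta> t r)
      + (\<Sum>r<K. (gate_count K r t xs / real t - \<kappa> r) * \<eta> t r)" if "t > 0" for t xs
  proof -
    \<comment> \<open>Writing an observation as residual plus conditional mean splits each increment
      into the residual times \<open>A - B\<close> and the gate times the mean increment.\<close>
    have 1: "(\<Sum>s<t. of_bool (fst (xs ! s)) * (of_bool (snd (xs ! s)) * A t (s mod K)
            + (1 - of_bool (snd (xs ! s))) * B t (s mod K)))
        = (\<Sum>s<t. of_real (of_bool (fst (xs ! s)) * (of_bool (snd (xs ! s)) - p s)) * (A t (s mod K) - B t (s mod K)))
        + (\<Sum>s<t. of_bool (fst (xs ! s)) * (p (s mod K) * A t (s mod K) + (1 - p (s mod K)) * B t (s mod K)))"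
      unfolding sum.distrib[symmetric] per by (intro sum.cong refl) (simp add: algebra_simps)
    have 2: "(\<Sum>s<t. of_bool (fst (xs ! s)) * ((of_bool (snd (xs ! s)) - p s) / p s) * v t (s mod K))
        = (\<Sum>s<t. of_real (of_bool (fst (xs ! s)) * (of_bool (snd (xs ! s)) - p s)) * (v t (s mod K) / p (s mod K)))"
      unfolding per by (intro sum.cong refl) simp
    have "?D t xs = (\<Sum>r<K. residual_sum p K r t xs * (A t r - B t r) + gate_count K r t xs * (p r * A t r + (1 - p r) * B t r)
        - residual_sum p K r t xs * (v t r / p r) / sqrt (real t) + \<kappa> r * ((1 - p r) / p r) * (v t r)\<^sup>2 / 2)"
      unfolding 1 2
      by (subst sum_residual_by_residue[OF K, where c = "\<lambda>r. A t r - B t r"],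
          subst sum_residual_by_residue[OF K, where c = "\<lambda>r. v t r / p r"],
          subst sum_gate_by_residue[OF K, where c = "\<lambda>r. p r * A t r + (1 - p r) * B t r"])
         (simp add: sum.distrib sum_subtractf sum_divide_distrib sum_distrib_left, simp add: mult.commute)
    also have "\<dots> = (\<Sum>r<K. residual_sum p K r t xs * (\<alpha> t r / sqrt (real t)) + (gate_count K r t xs / real t) * \<beta> t r
        + (gate_count K r t xs / real t - \<kappa> r) * \<eta> t r)"
    proof (intro sum.cong refl)
      fix r
      show "residual_sum p K r t xs * (A t r - B t r) + gate_count K r t xs * (p r * A t r + (1 - p r) * B t r)
        - residual_sum p K r t xs * (v t r / p r) / sqrt (real t) + \<kappa> r * ((1 - p r) / p r) * (v t r)\<^sup>2 / 2
        = residual_sum p K r t xs * (\<alpha> t r / sqrt (real t)) + (gate_count K r t xs / real t) * \<beta> t r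
        + (gate_count K r t xs / real t - \<kappa> r) * \<eta> t r"
        using that p[of r] by (simp add: \<alpha>_def \<beta>_def \<eta>_def field_simps)
    qed
    finally show ?thesis
      by (simp add: sum.distrib)
  qed
  have bound: "expect p t (\<lambda>xs. \<bar>?D t xs\<bar>)
      \<le> (\<Sum>r<K. \<bar>\<alpha> t r\<bar>) + (\<Sum>r<K. \<bar>\<beta> t r\<bar>) + (\<Sum>r<K. F t r * \<bar>\<eta> t r\<bar>)" if t: "t > 0" for t
  proof -
    have "expect p t (\<lambda>xs. \<bar>?D t xs\<bar>)
      \<le> expect p t (\<lambda>xs. \<bar>\<Sum>r<K. residual_sum p K r t xs * (\<alpha> t r / sqrt (real t))\<bar>
          + \<bar>\<Sum>r<K. (gate_count K r t xs / real t) * \<beta> t r\<bar>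
          + \<bar>\<Sum>r<K. (gate_count K r t xs / real t - \<kappa> r) * \<eta> t r\<bar>)"
      unfolding decomp[OF t] by (rule expect_mono[OF p01]) linarith
    also have "\<dots> = expect p t (\<lambda>xs. \<bar>\<Sum>r<K. residual_sum p K r t xs * (\<alpha> t r / sqrt (real t))\<bar>)
          + expect p t (\<lambda>xs. \<bar>\<Sum>r<K. (gate_count K r t xs / real t) * \<beta> t r\<bar>)
          + expect p t (\<lambda>xs. \<bar>\<Sum>r<K. (gate_count K r t xs / real t - \<kappa> r) * \<eta> t r\<bar>)"
      by (simp only: expect_add)
    also have "\<dots> \<le> (\<Sum>r<K. \<bar>\<alpha> t r\<bar>) + (\<Sum>r<K. \<bar>\<beta> t r\<bar>) + (\<Sum>r<K. F t r * \<bar>\<eta> t r\<bar>)"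
    proof (intro add_mono)
      have "expect p t (\<lambda>xs. \<bar>\<Sum>r<K. residual_sum p K r t xs * (\<alpha> t r / sqrt (real t))\<bar>)
          \<le> (\<Sum>r<K. expect p t (\<lambda>xs. \<bar>residual_sum p K r t xs\<bar>) * \<bar>\<alpha> t r / sqrt (real t)\<bar>)"
        by (rule expect_abs_linear_combination_le[OF p01])
      also have "\<dots> \<le> (\<Sum>r<K. sqrt (real t) * \<bar>\<alpha> t r / sqrt (real t)\<bar>)"
        by (intro sum_mono mult_right_mono expect_abs_residual_sum_le p01) simp
      also have "\<dots> = (\<Sum>r<K. \<bar>\<alpha> t r\<bar>)"
        using t by simp
      finally show "expect p t (\<lambda>xs. \<bar>\<Sum>r<K. residual_sum p K r t xs * (\<alpha> t r / sqrt (real t))\<bar>) \<le> (\<Sum>r<K. \<bar>\<alpha> t r\<bar>)" .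
      have "expect p t (\<lambda>xs. \<bar>\<Sum>r<K. (gate_count K r t xs / real t) * \<beta> t r\<bar>)
          \<le> (\<Sum>r<K. expect p t (\<lambda>xs. \<bar>gate_count K r t xs / real t\<bar>) * \<bar>\<beta> t r\<bar>)"
        by (rule expect_abs_linear_combination_le[OF p01])
      also have "\<dots> \<le> (\<Sum>r<K. expect p t (\<lambda>xs. 1) * \<bar>\<beta> t r\<bar>)"
        using t gate_count_bounds by (intro sum_mono mult_right_mono expect_mono p01) auto
      finally show "expect p t (\<lambda>xs. \<bar>\<Sum>r<K. (gate_count K r t xs / real t) * \<beta> t r\<bar>) \<le> (\<Sum>r<K. \<bar>\<beta> t r\<bar>)"
        by (simp add: expect_const)
      show "expect p t (\<lambda>xs. \<bar>\<Sum>r<K. (gate_count K r t xs / real t - \<kappa> r) * \<eta> t r\<bar>) \<le> (\<Sum>r<K. F t r * \<bar>\<eta> t r\<bar>)"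
        unfolding F_def by (rule expect_abs_linear_combination_le[OF p01])
    qed
    finally show ?thesis .
  qed
  have "(\<lambda>t. F t r * \<bar>\<eta> t r\<bar>) \<longlonglongrightarrow> 0" if r: "r < K" for r
  proof -
    obtain C where C: "\<And>t. \<bar>v t r\<bar> \<le> C"
      using bdd[OF r] unfolding Bseq_def by auto
    have "\<bar>\<eta> t r\<bar> \<le> (1 - p r) / (2 * p r) * C\<^sup>2" for t
      using p[of r] power_mono[OF C[of t], of 2] by (simp add: \<eta>_def abs_mult mult_left_mono divide_right_mono)
    moreover have F0: "0 \<le> F t r" for t
      unfolding F_def by (rule expect_nonneg[OF p01]) simp
    ultimately have le: "norm (F t r * \<bar>\<eta> t r\<bar>) \<le> F t r * ((1 - p r) / (2 * p r) * C\<^sup>2)" for t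
      unfolding real_norm_def abs_mult abs_abs abs_of_nonneg[OF F0] by (intro mult_left_mono)
    have lim: "(\<lambda>t. F t r * ((1 - p r) / (2 * p r) * C\<^sup>2)) \<longlonglongrightarrow> 0"
      unfolding F_def by (rule tendsto_mult_left_zero[OF freq[OF r]])
    show ?thesis
      by (rule Lim_null_comparison[OF always_eventually[OF allI[OF le]] lim])
  qed
  then have "(\<lambda>t. (\<Sum>r<K. \<bar>\<alpha> t r\<bar>) + (\<Sum>r<K. \<bar>\<beta> t r\<bar>) + (\<Sum>r<K. F t r * \<bar>\<eta> t r\<bar>)) \<longlonglongrightarrow> 0"
    unfolding \<alpha>_def \<beta>_def
    by (intro tendsto_add_zero tendsto_null_sum tendsto_rabs_zero lin quad) (simp_all only: lessThan_iff)
  moreover have "\<forall>\<^sub>F t in sequentially. norm (expect p t (\<lambda>xs. \<bar>?D t xs\<bar>))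
      \<le> (\<Sum>r<K. \<bar>\<alpha> t r\<bar>) + (\<Sum>r<K. \<bar>\<beta> t r\<bar>) + (\<Sum>r<K. F t r * \<bar>\<eta> t r\<bar>)"
    using eventually_gt_at_top[of 0]
  proof eventually_elim
    case (elim t)
    have "0 \<le> expect p t (\<lambda>xs. \<bar>?D t xs\<bar>)"
      by (rule expect_nonneg[OF p01]) simp
    then show ?case
      using bound[OF elim] by simp
  qed
  ultimately show ?thesis
    by (rule Lim_null_comparison[rotated])
qed

end

section \<open>The characteristic function of the score\<close>

text \<open>Caratheodory's form of the derivative writes \<open>Ln w\<close> as
  \<open>g w * (w - 1)\<close> with \<open>g\<close> continuous at 1 and \<open>g 1 = 1\<close>, so
  no remainder has to be estimated.\<close>

lemma tendsto_mult_Ln: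
  fixes a :: "nat \<Rightarrow> real" and z :: "nat \<Rightarrow> complex"
  assumes az: "(\<lambda>n. of_real (a n) * z n) \<longlonglongrightarrow> l" and z: "z \<longlonglongrightarrow> 0"
  shows "(\<lambda>n. of_real (a n) * Ln (1 + z n)) \<longlonglongrightarrow> l"
proof -
  have "(Ln has_field_derivative inverse 1) (at 1)"
    by (rule has_field_derivative_Ln) simp
  then obtain g where g: "\<And>w. Ln w - Ln 1 = g w * (w - 1)" "isCont g 1" "g 1 = inverse 1"
    using CARAT_DERIV[of Ln "inverse 1" 1] by blast
  have "(\<lambda>n. 1 + z n) \<longlonglongrightarrow> 1 + 0"
    by (intro tendsto_intros z)
  then have "(\<lambda>n. g (1 + z n)) \<longlonglongrightarrow> 1"
    using isCont_tendsto_compose[OF g(2)] g(3) by simp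
  moreover have "Ln (1 + z n) = z n * g (1 + z n)" for n
    using g(1)[of "1 + z n"] by (simp add: mult.commute)
  ultimately show ?thesis
    using tendsto_mult[OF az, of "\<lambda>n. g (1 + z n)" 1] by (simp add: mult.assoc)
qed

text \<open>\<open>m t\<close> is the mean of \<open>exp (\<i> * c * (Z - p) / sqrt t)\<close> for a
  Bernoulli variable \<open>Z\<close>. Centering removes the linear term, the variance is
  \<open>p * (1 - p)\<close>, and the remainder has order t to the power -3/2.\<close>

lemma bernoulli_char_limit:
  fixes p c :: real
  assumes "0 < p" "p < 1"
  defines "m \<equiv> (\<lambda>t. of_real p * exp (\<i> * of_real (c * (1 - p) / sqrt (real t)))
        + of_real (1 - p) * exp (\<i> * of_real (- c * p / sqrt (real t))))"
  shows "(\<lambda>t. of_real (real t) * (m t - 1)) \<longlonglongrightarrow> of_real (- (p * (1 - p) * c\<^sup>2 / 2))"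
proof -
  define R where "R = (\<lambda>x. exp (\<i> * complex_of_real x) - (1 + \<i> * of_real x - (of_real x)\<^sup>2 / 2))"
  have R: "norm (R x) \<le> \<bar>x\<bar> ^ 3" for x
  proof -
    have "norm (iexp x - (\<Sum>k\<le>2. (\<i> * complex_of_real x) ^ k / fact k)) \<le> \<bar>x\<bar> ^ Suc 2 / fact (Suc 2)"
      by (rule iexp_approx1)
    also have "\<dots> = \<bar>x\<bar> ^ 3 / 6"
      by (simp add: fact_numeral)
    also have "\<dots> \<le> \<bar>x\<bar> ^ 3"
      using zero_le_power[OF abs_ge_zero[of x], of 3] by linarith
    also have "iexp x - (\<Sum>k\<le>2. (\<i> * complex_of_real x) ^ k / fact k) = R x"
      by (simp add: R_def eval_nat_numeral algebra_simps)
    finally show ?thesis .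
  qed
  define x where "x = (\<lambda>t. c * (1 - p) / sqrt (real t))"
  define y where "y = (\<lambda>t. - c * p / sqrt (real t))"
  have eq: "of_real (real t) * (m t - 1) - of_real (- (p * (1 - p) * c\<^sup>2 / 2))
      = of_real (real t) * (of_real p * R (x t) + of_real (1 - p) * R (y t))" if "t > 0" for t
  proof -
    have exp: "exp (\<i> * complex_of_real w) = 1 + \<i> * of_real w - (of_real w)\<^sup>2 / 2 + R w" for w
      by (simp add: R_def)
    have distrib: "a * (- b / 2 + d) = - (a * b) / 2 + a * d" for a b d :: complex
      by (simp add: algebra_simps)
    have mt: "m t = of_real p * exp (\<i> * of_real (x t)) + of_real (1 - p) * exp (\<i> * of_real (y t))"
      by (simp only: m_def x_def y_def)
    have first: "p * x t + (1 - p) * y t = 0"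
      by (simp add: x_def y_def field_simps)
    have second: "real t * (p * (x t)\<^sup>2 + (1 - p) * (y t)\<^sup>2) = p * (1 - p) * c\<^sup>2"
      using that by (simp add: x_def y_def power_divide power_mult_distrib field_simps power2_eq_square)
    have "m t - 1 = \<i> * of_real (p * x t + (1 - p) * y t) - of_real (p * (x t)\<^sup>2 + (1 - p) * (y t)\<^sup>2) / 2
        + (of_real p * R (x t) + of_real (1 - p) * R (y t))"
      unfolding mt exp by (simp add: algebra_simps add_divide_distrib diff_divide_distrib)
    then have "m t - 1 = - of_real (p * (x t)\<^sup>2 + (1 - p) * (y t)\<^sup>2) / 2
        + (of_real p * R (x t) + of_real (1 - p) * R (y t))"
      unfolding first by (simp only: of_real_0 mult_zero_right diff_0 minus_divide_left)
    then have "of_real (real t) * (m t - 1) = - of_real (real t * (p * (x t)\<^sup>2 + (1 - p) * (y t)\<^sup>2)) / 2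
        + of_real (real t) * (of_real p * R (x t) + of_real (1 - p) * R (y t))"
      by (simp only: distrib of_real_mult[of "real t"])
    then show ?thesis
      unfolding second by simp
  qed
  have bound: "norm (of_real (real t) * (m t - 1) - of_real (- (p * (1 - p) * c\<^sup>2 / 2))) \<le> 2 * \<bar>c\<bar> ^ 3 / sqrt (real t)" if t: "t > 0" for t
  proof -
    have cube: "real t * (\<bar>c\<bar> / sqrt (real t)) ^ 3 = \<bar>c\<bar> ^ 3 / sqrt (real t)"
      using t by (simp add: power_divide power3_eq_cube field_simps)
    have xy: "\<bar>x t\<bar> \<le> \<bar>c\<bar> / sqrt (real t)" "\<bar>y t\<bar> \<le> \<bar>c\<bar> / sqrt (real t)"
      using assms(1,2) t by (auto simp: x_def y_def abs_mult divide_right_mono mult_left_le)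
    have "norm (of_real p * R (x t) + of_real (1 - p) * R (y t)) \<le> p * norm (R (x t)) + (1 - p) * norm (R (y t))"
      using assms(1,2) by (intro order_trans[OF norm_triangle_ineq]) (simp only: norm_mult norm_of_real)
    also have "\<dots> \<le> 1 * (\<bar>c\<bar> / sqrt (real t)) ^ 3 + 1 * (\<bar>c\<bar> / sqrt (real t)) ^ 3"
      using assms(1,2) xy R[of "x t"] R[of "y t"]
      by (intro add_mono mult_mono) (auto intro: order_trans power_mono)
    finally have "norm (of_real p * R (x t) + of_real (1 - p) * R (y t)) \<le> 2 * (\<bar>c\<bar> / sqrt (real t)) ^ 3"
      by simp
    then have "real t * norm (of_real p * R (x t) + of_real (1 - p) * R (y t)) \<le> 2 * (real t * (\<bar>c\<bar> / sqrt (real t)) ^ 3)"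
      using t by (simp add: mult.left_commute)
    then show ?thesis
      unfolding eq[OF t] cube by (simp add: norm_mult)
  qed
  have "\<forall>\<^sub>F t in sequentially. norm (of_real (real t) * (m t - 1) - of_real (- (p * (1 - p) * c\<^sup>2 / 2))) \<le> 2 * \<bar>c\<bar> ^ 3 / sqrt (real t)"
    by (rule eventually_mono[OF eventually_gt_at_top[of 0] bound])
  moreover have "(\<lambda>t. 2 * \<bar>c\<bar> ^ 3 / sqrt (real t)) \<longlonglongrightarrow> 0"
    by (intro tendsto_divide_0[OF tendsto_const] filterlim_at_top_imp_at_infinity
         filterlim_compose[OF sqrt_at_top filterlim_real_sequentially])
  ultimately have "(\<lambda>t. of_real (real t) * (m t - 1) - of_real (- (p * (1 - p) * c\<^sup>2 / 2))) \<longlonglongrightarrow> 0"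
    by (rule Lim_null_comparison)
  then show ?thesis
    by (rule Lim_null[THEN iffD2])
qed

lemma norm_one_minus_exp_le:
  fixes z :: complex
  shows "norm (1 - exp z) \<le> norm z * exp (norm z)"
proof -
  have "norm (exp z - (\<Sum>i\<le>0. z ^ i / fact i)) \<le> exp \<bar>Re z\<bar> * norm z ^ Suc 0 / fact 0"
    by (rule Taylor_exp)
  then have "norm (1 - exp z) \<le> exp \<bar>Re z\<bar> * norm z"
    by (simp add: norm_minus_commute)
  also have "\<dots> \<le> exp (norm z) * norm z"
    by (intro mult_right_mono) (auto simp: abs_Re_le_cmod)
  finally show ?thesis by (simp add: mult.commute)
qed

context gating_kernel
begin

text \<open>An open gate contributes a factor of conditional mean \<open>m t r\<close> divided by
  exactly this number, a closed gate contributes 1. Writing the divisors through \<open>Ln\<close>,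
  which needs them nonzero, turns their product into a linear function of the gate counts.\<close>

lemma expect_compensated_exp_eq_1:
  fixes c p :: "nat \<Rightarrow> real"
  assumes K: "K \<ge> 1" and per: "\<And>s. p (s mod K) = p s"
  defines "m \<equiv> (\<lambda>t r. of_real (p r) * exp (\<i> * of_real (c r * (1 - p r) / sqrt (real t)))
        + of_real (1 - p r) * exp (\<i> * of_real (- c r * p r / sqrt (real t))))"
  assumes nz: "\<And>r. r < K \<Longrightarrow> m t r \<noteq> 0"
  shows "expect p t (\<lambda>xs. exp (\<i> * of_real (1 / sqrt (real t) * (\<Sum>r<K. residual_sum p K r t xs * c r)))
          * exp (- (\<Sum>r<K. of_real (gate_count K r t xs) * Ln (m t r)))) = 1"
proof -
  let ?f = "\<lambda>s g y. exp (\<i> * of_real (1 / sqrt (real t) * (of_bool g * (of_bool y - p s) * c (s mod K))))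
      * exp (- (of_bool g * Ln (m t (s mod K))))"
  have "expect p t (\<lambda>xs. \<Prod>s<t. ?f s (fst (xs ! s)) (snd (xs ! s))) = 1"
  proof (rule expect_prod_eq_1)
    fix s g
    have "exp (- Ln (m t (s mod K))) = 1 / m t (s mod K)"
      using nz[of "s mod K"] K by (simp add: exp_minus inverse_eq_divide)
    moreover have "of_real (p s) * exp (\<i> * of_real (1 / sqrt (real t) * ((1 - p s) * c (s mod K))))
        + of_real (1 - p s) * exp (\<i> * of_real (1 / sqrt (real t) * (- p s * c (s mod K)))) = m t (s mod K)"
      unfolding m_def per by (simp add: mult.commute)
    ultimately show "(\<Sum>y\<in>UNIV. obs_weight (p s) g y *\<^sub>R ?f s g y) = 1"
      using nz[of "s mod K"] K
      by (cases g) (simp_all add: UNIV_bool obs_weight_def scaleR_conv_of_real add_divide_distrib[symmetric] add.commute)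
  qed
  moreover have "(\<Prod>s<t. ?f s (fst (xs ! s)) (snd (xs ! s)))
      = exp (\<i> * of_real (1 / sqrt (real t) * (\<Sum>r<K. residual_sum p K r t xs * c r)))
          * exp (- (\<Sum>r<K. of_real (gate_count K r t xs) * Ln (m t r)))" for xs
  proof -
    have "(\<Sum>r<K. residual_sum p K r t xs * c r)
        = (\<Sum>s<t. of_bool (fst (xs ! s)) * (of_bool (snd (xs ! s)) - p s) * c (s mod K))"
      using sum_residual_by_residue[OF K, where c = c and xs = xs and t = t and p = p] by simp
    moreover have "(\<Sum>r<K. of_real (gate_count K r t xs) * Ln (m t r))
        = (\<Sum>s<t. of_bool (fst (xs ! s)) * Ln (m t (s mod K)))"
      by (rule sum_gate_by_residue[OF K, symmetric])
    ultimately show ?thesis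
      by (simp only: prod.distrib exp_sum[symmetric] finite_lessThan sum_distrib_left of_real_sum sum_negf)
  qed
  ultimately show ?thesis
    by simp
qed

text \<open>With \<open>X\<close> of modulus 1 and \<open>X * exp L\<close> of mean 1, the
  difference between the mean of \<open>X\<close> and \<open>exp (- S)\<close> is the mean of
  \<open>X * (1 - exp (L - S))\<close>. It vanishes because \<open>L - S\<close> is bounded and
  tends to 0 in mean.\<close>

lemma char_score_tendsto:
  fixes c p \<kappa> :: "nat \<Rightarrow> real"
  assumes K: "K \<ge> 1" and p: "\<And>s. 0 < p s \<and> p s < 1" and per: "\<And>s. p (s mod K) = p s"
    and freq: "\<And>r. r < K \<Longrightarrow> (\<lambda>t. expect p t (\<lambda>xs. \<bar>gate_count K r t xs / real t - \<kappa> r\<bar>)) \<longlonglongrightarrow> 0"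
  shows "(\<lambda>t. expect p t (\<lambda>xs. exp (\<i> * of_real (1 / sqrt (real t) * (\<Sum>r<K. residual_sum p K r t xs * c r)))))
      \<longlonglongrightarrow> exp (- of_real ((\<Sum>r<K. \<kappa> r * (p r * (1 - p r) * (c r)\<^sup>2)) / 2))"
proof -
  have p01: "0 \<le> p s \<and> p s \<le> 1" for s
    using p[of s] by auto
  define m where "m = (\<lambda>t r. of_real (p r) * exp (\<i> * of_real (c r * (1 - p r) / sqrt (real t)))
        + of_real (1 - p r) * exp (\<i> * of_real (- c r * p r / sqrt (real t))))"
  define v where "v = (\<lambda>r. p r * (1 - p r) * (c r)\<^sup>2 / 2)"
  define S where "S = (\<Sum>r<K. \<kappa> r * v r)"
  define X where "X = (\<lambda>t xs. exp (\<i> * complex_of_real (1 / sqrt (real t) * (\<Sum>r<K. residual_sum p K r t xs * c r))))"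
  define L where "L = (\<lambda>t xs. - (\<Sum>r<K. of_real (gate_count K r t xs) * Ln (m t r)))"
  have tm: "(\<lambda>t. of_real (real t) * (m t r - 1)) \<longlonglongrightarrow> of_real (- v r)" for r
    using bernoulli_char_limit[of "p r" "c r"] p[of r] by (simp add: m_def v_def)
  have m0: "(\<lambda>t. m t r - 1) \<longlonglongrightarrow> 0" for r
  proof (rule Lim_transform_eventually)
    show "(\<lambda>t. of_real (1 / real t) * (of_real (real t) * (m t r - 1))) \<longlonglongrightarrow> 0"
      using tendsto_mult[OF tendsto_of_real[OF lim_1_over_n] tm[of r]] by simp
    show "\<forall>\<^sub>F t in sequentially. of_real (1 / real t) * (of_real (real t) * (m t r - 1)) = m t r - 1"
      using eventually_gt_at_top[of 0] by eventually_elim simp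
  qed
  have tLn: "(\<lambda>t. of_real (real t) * Ln (m t r)) \<longlonglongrightarrow> of_real (- v r)" for r
    using tendsto_mult_Ln[OF tm m0, of r] by simp
  define \<delta> where "\<delta> = (\<lambda>t r. norm (of_real (real t) * Ln (m t r) + of_real (v r)))"
  have \<delta>0: "(\<lambda>t. \<delta> t r) \<longlonglongrightarrow> 0" for r
    using tendsto_norm_zero[OF LIM_zero[OF tLn[of r]]] by (simp add: \<delta>_def)
  \<comment> \<open>A bound on the exponent error uniform over histories: gate frequencies lie
    between 0 and 1 and \<open>\<delta>\<close> is eventually below 1. It turns a mean error of the
    exponent into one of the exponential, at the price of the factor \<open>exp B\<close>.\<close>
  define B where "B = (\<Sum>r<K. (1 + \<bar>\<kappa> r\<bar>) * \<bar>v r\<bar> + 1)"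
  define F where "F = (\<lambda>t. \<Sum>r<K. expect p t (\<lambda>xs. \<bar>gate_count K r t xs / real t - \<kappa> r\<bar>) * \<bar>v r\<bar> + \<delta> t r)"
  have "(\<lambda>t. exp B * F t) \<longlonglongrightarrow> exp B * (\<Sum>r<K. 0 * \<bar>v r\<bar> + 0)"
    unfolding F_def by (intro tendsto_intros freq \<delta>0) auto
  then have lim: "(\<lambda>t. exp B * F t) \<longlonglongrightarrow> 0"
    by simp
  have ev1: "\<forall>\<^sub>F t in sequentially. \<forall>r\<in>{..<K}. \<delta> t r < 1"
    by (intro eventually_ball_finite ballI order_tendstoD(2)[OF \<delta>0]) auto
  have ev2: "\<forall>\<^sub>F t in sequentially. \<forall>r\<in>{..<K}. m t r \<noteq> 0"
  proof (intro eventually_ball_finite ballI)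
    fix r
    have "\<forall>\<^sub>F t in sequentially. norm (m t r - 1) < 1"
      using tendsto_norm_zero[OF m0[of r]] by (rule order_tendstoD(2)) simp
    then show "\<forall>\<^sub>F t in sequentially. m t r \<noteq> 0"
      by (rule eventually_mono) auto
  qed simp
  have main: "norm (expect p t (X t) - of_real (exp (- S))) \<le> exp B * F t"
    if t: "t > 0" and \<delta>1: "\<And>r. r < K \<Longrightarrow> \<delta> t r < 1" and nz: "\<And>r. r < K \<Longrightarrow> m t r \<noteq> 0" for t
  proof -
    have LS: "norm (L t xs - of_real S) \<le> (\<Sum>r<K. \<bar>gate_count K r t xs / real t - \<kappa> r\<bar> * \<bar>v r\<bar> + \<delta> t r)" for xs
    proof -
      \<comment> \<open>A count times \<open>Ln\<close> is the frequency times
        \<open>t * Ln\<close>, and the latter tends to \<open>- v r\<close>; the two terms separate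
        the frequency error from the error of this limit.\<close>
      have "L t xs - of_real S = (\<Sum>r<K. of_real (gate_count K r t xs / real t - \<kappa> r) * of_real (v r)
          - of_real (gate_count K r t xs / real t) * (of_real (real t) * Ln (m t r) + of_real (v r)))"
        unfolding L_def S_def of_real_sum sum_negf[symmetric] sum_subtractf[symmetric]
        using t by (intro sum.cong refl) (simp add: field_simps)
      also have "norm \<dots> \<le> (\<Sum>r<K. \<bar>gate_count K r t xs / real t - \<kappa> r\<bar> * \<bar>v r\<bar> + \<delta> t r)"
      proof (intro order_trans[OF norm_sum] sum_mono order_trans[OF norm_triangle_ineq4] add_mono)
        fix r
        show "norm (of_real (gate_count K r t xs / real t - \<kappa> r) * of_real (v r) :: complex) \<le> \<bar>gate_count K r t xs / real t - \<kappa> r\<bar> * \<bar>v r\<bar>"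
          unfolding norm_mult norm_of_real ..
        have "norm (complex_of_real (gate_count K r t xs / real t)) \<le> 1"
          unfolding norm_of_real using t gate_count_bounds[of K r t xs] by simp
        then show "norm (of_real (gate_count K r t xs / real t) * (of_real (real t) * Ln (m t r) + of_real (v r))) \<le> \<delta> t r"
          unfolding norm_mult \<delta>_def by (intro mult_left_le_one_le) auto
      qed
      finally show ?thesis .
    qed
    have "(\<Sum>r<K. \<bar>gate_count K r t xs / real t - \<kappa> r\<bar> * \<bar>v r\<bar> + \<delta> t r) \<le> B" for xs
      unfolding B_def
    proof (intro sum_mono add_mono mult_right_mono)
      fix r
      assume "r \<in> {..<K}"
      then show "\<delta> t r \<le> 1" using \<delta>1[of r] by simp
      have "0 \<le> gate_count K r t xs / real t" "gate_count K r t xs / real t \<le> 1"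
        using t gate_count_bounds[of K r t xs] by simp_all
      then show "\<bar>gate_count K r t xs / real t - \<kappa> r\<bar> \<le> 1 + \<bar>\<kappa> r\<bar>" by linarith
    qed simp
    with LS have LB: "norm (L t xs - of_real S) \<le> B" for xs
      using order_trans by blast
    have one: "expect p t (\<lambda>xs. X t xs * exp (L t xs)) = 1"
      unfolding X_def L_def m_def
      by (rule expect_compensated_exp_eq_1[where p = p and c = c, OF K per]) (use nz in \<open>auto simp: m_def\<close>)
    have X1: "norm (X t xs) = 1" for xs
      unfolding X_def by (rule norm_exp_i_times)
    have shift: "exp (L t xs - of_real S) = exp (L t xs) * of_real (exp (- S))" for xs
    proof -
      have "exp (L t xs + of_real (- S)) = exp (L t xs) * of_real (exp (- S))"
        by (simp only: exp_add exp_of_real)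
      then show ?thesis
        by (simp only: of_real_minus add_uminus_conv_diff)
    qed
    \<comment> \<open>Multiplying the limit by a quantity of mean 1 brings both terms under one
      expectation.\<close>
    have "expect p t (X t) - of_real (exp (- S)) = expect p t (X t) - of_real (exp (- S)) * expect p t (\<lambda>xs. X t xs * exp (L t xs))"
      by (simp add: one)
    also have "\<dots> = expect p t (\<lambda>xs. X t xs * (1 - exp (L t xs - of_real S)))"
      unfolding expect_mult_left[symmetric] expect_diff[symmetric]
      by (intro expect_cong) (simp add: shift algebra_simps)
    finally have "norm (expect p t (X t) - of_real (exp (- S))) \<le> expect p t (\<lambda>xs. norm (X t xs * (1 - exp (L t xs - of_real S))))"
      using norm_expect_le[of p, OF p01] by simp
    also have "\<dots> \<le> expect p t (\<lambda>xs. exp B * (\<Sum>r<K. \<bar>v r\<bar> * \<bar>gate_count K r t xs / real t - \<kappa> r\<bar> + \<delta> t r))"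
    proof (rule expect_mono[OF p01])
      fix xs
      have "norm (X t xs * (1 - exp (L t xs - of_real S))) \<le> norm (L t xs - of_real S) * exp (norm (L t xs - of_real S))"
        unfolding norm_mult X1 using norm_one_minus_exp_le by simp
      also have "\<dots> \<le> (\<Sum>r<K. \<bar>gate_count K r t xs / real t - \<kappa> r\<bar> * \<bar>v r\<bar> + \<delta> t r) * exp B"
        using LS[of xs] LB[of xs] order_trans[OF norm_ge_zero LS[of xs]] by (intro mult_mono) auto
      finally show "norm (X t xs * (1 - exp (L t xs - of_real S)))
          \<le> exp B * (\<Sum>r<K. \<bar>v r\<bar> * \<bar>gate_count K r t xs / real t - \<kappa> r\<bar> + \<delta> t r)"
        by (simp add: mult.commute)
    qed
    also have "\<dots> = exp B * F t"
      by (simp only: expect_mult_left expect_sum expect_add expect_const F_def mult.commute)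
    finally show ?thesis .
  qed
  have "(\<lambda>t. expect p t (X t)) \<longlonglongrightarrow> of_real (exp (- S))"
  proof (rule Lim_null[THEN iffD2], rule Lim_null_comparison[OF _ lim])
    show "\<forall>\<^sub>F t in sequentially. norm (expect p t (X t) - of_real (exp (- S))) \<le> exp B * F t"
      using ev1 ev2 eventually_gt_at_top[of 0] by eventually_elim (auto intro: main)
  qed
  moreover have S: "S = (\<Sum>r<K. \<kappa> r * (p r * (1 - p r) * (c r)\<^sup>2)) / 2"
    by (simp add: S_def v_def sum_divide_distrib)
  moreover have "of_real (exp (- S)) = exp (- complex_of_real S)"
    by (metis exp_of_real of_real_minus)
  ultimately show ?thesis
    unfolding X_def S by simp
qed

end

section \<open>Local expansions and gating frequencies\<close>

lemma tendsto_zero_mult_Bseq: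
  fixes f g :: "nat \<Rightarrow> real"
  assumes "f \<longlonglongrightarrow> 0" "Bseq g"
  shows "(\<lambda>n. f n * g n) \<longlonglongrightarrow> 0"
  using bounded_bilinear.Zfun_prod_Bfun[OF bounded_bilinear_mult, of f sequentially g] assms
  by (simp add: tendsto_Zfun_iff)

lemma Bseq_add_Bseq:
  fixes f g :: "nat \<Rightarrow> real"
  assumes "Bseq f" "Bseq g"
  shows "Bseq (\<lambda>n. f n + g n)"
  using assms bounded_plus_comp[of f UNIV g] by (simp add: Bseq_eq_bounded)

text \<open>To second order \<open>u = s * (1 - exp (- x))\<close> is
  \<open>s * x - s * x\<^sup>2 / 2\<close> and \<open>ln (1 + u)\<close> is
  \<open>u - u\<^sup>2 / 2\<close>; these give the contributions \<open>- s / 2\<close> and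
  \<open>- (s * s / 2)\<close>.\<close>

lemma log_increment_second_order:
  fixes s :: real
  assumes "s > 0"
  shows "((\<lambda>x. (ln (1 + s * (1 - exp (- x))) - s * x) / x\<^sup>2) \<longlongrightarrow> - (s * s / 2) - s / 2) (at 0)"
  using assms by (intro filterlim_split_at) real_asymp+

text \<open>With \<open>p = 1 - exp (- \<lambda>)\<close> and \<open>p' = 1 - exp (- (\<lambda> + x))\<close> one has
  \<open>p' / p = 1 + (1 - p) / p * (1 - exp (- x))\<close> and \<open>(1 - p') / (1 - p) = exp (- x)\<close>.\<close>

lemma likelihood_increment_expansion:
  fixes x v :: "nat \<Rightarrow> real" and p :: real
  assumes p: "0 < p" "p < 1" and xv: "(\<lambda>t. sqrt (real t) * x t - v t) \<longlonglongrightarrow> 0" and v: "Bseq v"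
  defines "A \<equiv> (\<lambda>t. ln (1 + (1 - p) / p * (1 - exp (- x t))))"
  shows "(\<lambda>t. sqrt (real t) * (A t - (- x t)) - v t / p) \<longlonglongrightarrow> 0"
    and "(\<lambda>t. real t * (p * A t + (1 - p) * (- x t)) + (1 - p) / (2 * p) * (v t)\<^sup>2) \<longlonglongrightarrow> 0"
    and "x \<longlonglongrightarrow> 0" and "Bseq (\<lambda>t. sqrt (real t) * x t)"
proof -
  define s where "s = (1 - p) / p"
  have s: "s > 0" using p by (simp add: s_def)
  \<comment> \<open>The second-order coefficient of the log increment. Times \<open>p\<close> it is
    minus half the Fisher weight \<open>(1 - p) / p\<close>, which produces the drift of the
    expansion.\<close>
  define c where "c = - (s * s / 2) - s / 2"
  have pc: "p * c = - ((1 - p) / (2 * p))"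
    using p by (simp add: c_def s_def field_simps)
  \<comment> \<open>Filling in the limit at 0 makes \<open>\<rho>\<close> continuous there and the
    expansion of \<open>A\<close> an exact identity, also when \<open>x t = 0\<close>.\<close>
  define \<rho> where "\<rho> = (\<lambda>y. if y = 0 then c else (ln (1 + s * (1 - exp (- y))) - s * y) / y\<^sup>2)"
  have "((\<lambda>y. (ln (1 + s * (1 - exp (- y))) - s * y) / y\<^sup>2) \<longlongrightarrow> c) (at 0)"
    unfolding c_def by (rule log_increment_second_order[OF s])
  then have "(\<rho> \<longlongrightarrow> c) (at 0)"
    by (rule Lim_transform_eventually) (auto simp: \<rho>_def eventually_at_filter)
  then have \<rho>_cont: "isCont \<rho> 0"
    by (simp add: isCont_def \<rho>_def)
  have A: "A t = s * x t + \<rho> (x t) * (x t)\<^sup>2" for t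
    by (auto simp: A_def s_def[symmetric] \<rho>_def)
  define w where "w = (\<lambda>t. sqrt (real t) * x t)"
  have wv: "(\<lambda>t. w t - v t) \<longlonglongrightarrow> 0"
    using xv by (simp add: w_def)
  have "Bseq (\<lambda>t. w t - v t)"
    using wv by (intro convergent_imp_Bseq convergentI)
  then have "Bseq (\<lambda>t. (w t - v t) + v t)"
    using v by (rule Bseq_add_Bseq)
  then show w: "Bseq (\<lambda>t. sqrt (real t) * x t)"
    by (simp add: w_def)
  then have w: "Bseq w" by (simp add: w_def)
  have inv: "(\<lambda>t. 1 / sqrt (real t)) \<longlonglongrightarrow> 0"
    by (intro tendsto_divide_0[OF tendsto_const] filterlim_at_top_imp_at_infinity
         filterlim_compose[OF sqrt_at_top filterlim_real_sequentially])
  show x0: "x \<longlonglongrightarrow> 0"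
  proof (rule Lim_transform_eventually)
    show "(\<lambda>t. 1 / sqrt (real t) * w t) \<longlonglongrightarrow> 0"
      by (rule tendsto_zero_mult_Bseq[OF inv w])
    show "\<forall>\<^sub>F t in sequentially. 1 / sqrt (real t) * w t = x t"
      using eventually_gt_at_top[of 0] by eventually_elim (simp add: w_def)
  qed
  have \<rho>c: "(\<lambda>t. \<rho> (x t)) \<longlonglongrightarrow> c"
    using isCont_tendsto_compose[OF \<rho>_cont x0] by (simp add: \<rho>_def)
  have "(\<lambda>t. \<rho> (x t) * x t) \<longlonglongrightarrow> 0"
    using tendsto_mult[OF \<rho>c x0] by simp
  from tendsto_zero_mult_Bseq[OF this w]
  have "(\<lambda>t. (w t - v t) / p + (\<rho> (x t) * x t) * w t) \<longlonglongrightarrow> 0 / p + 0"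
    using p by (intro tendsto_add tendsto_divide wv tendsto_const) auto
  \<comment> \<open>Since \<open>s + 1 = 1 / p\<close>, the linear part of the difference is
    \<open>x t / p\<close>.\<close>
  moreover have "(w t - v t) / p + (\<rho> (x t) * x t) * w t = sqrt (real t) * (A t - (- x t)) - v t / p" for t
    using p by (simp add: A w_def s_def field_simps power2_eq_square)
  ultimately show "(\<lambda>t. sqrt (real t) * (A t - (- x t)) - v t / p) \<longlonglongrightarrow> 0"
    by simp
  have "(\<lambda>t. p * (\<rho> (x t) - c)) \<longlonglongrightarrow> 0" and "(\<lambda>t. (p * c) * (w t - v t)) \<longlonglongrightarrow> 0"
    using tendsto_mult_right_zero[OF LIM_zero[OF \<rho>c]] tendsto_mult_right_zero[OF wv] by simp_all
  from tendsto_add[OF tendsto_zero_mult_Bseq[OF tendsto_zero_mult_Bseq[OF this(1) w] w]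
      tendsto_zero_mult_Bseq[OF this(2) Bseq_add_Bseq[OF w v]]]
  have "(\<lambda>t. ((p * (\<rho> (x t) - c)) * w t) * w t + ((p * c) * (w t - v t)) * (w t + v t)) \<longlonglongrightarrow> 0 + 0" .
  moreover have "((p * (\<rho> (x t) - c)) * w t) * w t + ((p * c) * (w t - v t)) * (w t + v t)
      = real t * (p * A t + (1 - p) * (- x t)) + (1 - p) / (2 * p) * (v t)\<^sup>2" for t
  proof -
    have ww: "w t * w t = real t * (x t)\<^sup>2"
    proof -
      have "w t * w t = (sqrt (real t) * sqrt (real t)) * (x t)\<^sup>2"
        by (simp only: w_def power2_eq_square mult_ac)
      then show ?thesis by simp
    qed
    \<comment> \<open>This cancels the linear terms in the conditional mean. What is left is
      quadratic, so the error of \<open>w\<close> against \<open>v\<close> enters only multiplied by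
      the bounded \<open>w + v\<close>.\<close>
    have ps: "p * s = 1 - p" using p by (simp add: s_def)
    have "((p * (\<rho> (x t) - c)) * w t) * w t + ((p * c) * (w t - v t)) * (w t + v t)
        = p * \<rho> (x t) * (w t * w t) - p * c * (v t)\<^sup>2"
      by (simp add: algebra_simps power2_eq_square)
    also have "\<dots> = real t * (p * s * x t + p * \<rho> (x t) * (x t)\<^sup>2 + (1 - p) * (- x t)) + (1 - p) / (2 * p) * (v t)\<^sup>2"
      unfolding ww pc ps by (simp add: algebra_simps)
    also have "\<dots> = real t * (p * A t + (1 - p) * (- x t)) + (1 - p) / (2 * p) * (v t)\<^sup>2"
      unfolding A by (simp only: distrib_left mult.assoc)
    finally show ?thesis .
  qed
  ultimately show "(\<lambda>t. real t * (p * A t + (1 - p) * (- x t)) + (1 - p) / (2 * p) * (v t)\<^sup>2) \<longlonglongrightarrow> 0"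
    by simp
qed

section \<open>Gradients and first-order expansion along bounded directions\<close>

lemma grad_eqI:
  assumes "GDERIV f x :> D"
  shows "grad f x = D"
  unfolding grad_def
proof (rule the_equality[where P = "\<lambda>D. GDERIV f x :> D", OF assms])
  fix D'
  assume "GDERIV f x :> D'"
  then have "(\<lambda>h. h \<bullet> D') = (\<lambda>h. h \<bullet> D)"
    using assms unfolding gderiv_def by (rule has_derivative_unique)
  from fun_cong[OF this, of "D' - D"] have "(D' - D) \<bullet> (D' - D) = 0"
    by (simp only: inner_diff_right)
  then show "D' = D"
    by simp
qed

text \<open>The gradient is the adjoint of the derivative applied to 1.\<close>

lemma differentiable_imp_GDERIV_grad:
  fixes f :: "'a::euclidean_space \<Rightarrow> real"
  assumes "f differentiable (at x)"
  shows "GDERIV f x :> grad f x"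
proof -
  obtain f' where f': "(f has_derivative f') (at x)"
    using assms unfolding differentiable_def by blast
  have "h \<bullet> adjoint f' 1 = f' h" for h
    using adjoint_works[OF has_derivative_linear[OF f'], of h 1] by simp
  then have "GDERIV f x :> adjoint f' 1"
    using f' by (simp add: gderiv_def)
  then show ?thesis
    using grad_eqI by metis
qed

text \<open>Frechet differentiability is uniform over directions of bounded length, so
  \<open>h t\<close> may vary without converging.\<close>

lemma GDERIV_sequence:
  fixes f :: "'a::real_inner \<Rightarrow> real" and h :: "nat \<Rightarrow> 'a"
  assumes f: "GDERIV f x :> D" and h: "bounded (range h)"
  shows "(\<lambda>t. sqrt (real t) * (f (x + (1 / sqrt (real t)) *\<^sub>R h t) - f x) - h t \<bullet> D) \<longlonglongrightarrow> 0"
proof (rule tendsto_le_approx)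
  fix \<epsilon> :: real
  assume "\<epsilon> > 0"
  obtain b where b: "b > 0" "\<And>t. norm (h t) \<le> b"
    using h by (auto simp: bounded_pos)
  \<comment> \<open>The tolerance is divided by the bound on the directions so that the rescaled
    error is at most \<open>\<epsilon>\<close>.\<close>
  obtain d where d: "d > 0" "\<And>y. norm (y - x) < d \<Longrightarrow> norm (f y - f x - (y - x) \<bullet> D) \<le> \<epsilon> / b * norm (y - x)"
    using f \<open>\<epsilon> > 0\<close> b(1) unfolding gderiv_def has_derivative_at_alt by (meson divide_pos_pos)
  have "(\<lambda>t. b * (1 / sqrt (real t))) \<longlonglongrightarrow> b * 0"
    by (intro tendsto_mult tendsto_const tendsto_divide_0[OF tendsto_const] filterlim_at_top_imp_at_infinity
         filterlim_compose[OF sqrt_at_top filterlim_real_sequentially])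
  then have "\<forall>\<^sub>F t in sequentially. b * (1 / sqrt (real t)) < d"
    using d(1) by (auto intro: order_tendstoD(2))
  then show "\<forall>\<^sub>F t in sequentially. \<bar>sqrt (real t) * (f (x + (1 / sqrt (real t)) *\<^sub>R h t) - f x) - h t \<bullet> D - 0\<bar> \<le> \<epsilon>"
    using eventually_gt_at_top[of 0]
  proof eventually_elim
    case (elim t)
    have st: "sqrt (real t) > 0" using elim by simp
    define y where "y = x + (1 / sqrt (real t)) *\<^sub>R h t"
    have yx: "norm (y - x) = norm (h t) / sqrt (real t)"
      using st by (simp add: y_def)
    also have "\<dots> \<le> b * (1 / sqrt (real t))"
      using b st by (simp add: divide_right_mono)
    finally have "norm (y - x) < d"
      using elim by linarith
    from d(2)[OF this] have "sqrt (real t) * \<bar>f y - f x - (y - x) \<bullet> D\<bar> \<le> sqrt (real t) * (\<epsilon> / b * (norm (h t) / sqrt (real t)))"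
      unfolding yx real_norm_def using st by (intro mult_left_mono) auto
    also have "\<dots> = \<epsilon> * (norm (h t) / b)"
      using st by simp
    also have "\<dots> \<le> \<epsilon>"
      using b \<open>\<epsilon> > 0\<close> by (intro mult_left_le) (auto simp: divide_le_eq)
    also have "sqrt (real t) * \<bar>f y - f x - (y - x) \<bullet> D\<bar> = \<bar>sqrt (real t) * (f y - f x - (y - x) \<bullet> D)\<bar>"
      using st by (simp add: abs_mult)
    also have "sqrt (real t) * (f y - f x - (y - x) \<bullet> D) = sqrt (real t) * (f y - f x) - h t \<bullet> D"
      using st by (simp add: y_def algebra_simps)
    finally show ?case
      by (simp add: y_def)
  qed
qed

section \<open>Gating frequencies along a residue class\<close>

lemma sum_residue_class:
  fixes f :: "nat \<Rightarrow> real"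
  assumes "r < K"
  shows "(\<Sum>s<n * K. of_bool (s mod K = r) * f s) = (\<Sum>l<n. f (r + l * K))"
proof -
  have "(\<Sum>s\<in>{l * K..<l * K + K}. of_bool (s mod K = r) * f s) = f (r + l * K)" for l
  proof -
    have "of_bool (s mod K = r) * f s = (if s = r + l * K then f s else 0)" if "s \<in> {l * K..<l * K + K}" for s
    proof -
      define u where "u = s - l * K"
      have s: "s = u + l * K" and u: "u < K" using that by (auto simp: u_def)
      have "s mod K = u" unfolding s using u by simp
      then show ?thesis by (simp add: s)
    qed
    then have "(\<Sum>s\<in>{l * K..<l * K + K}. of_bool (s mod K = r) * f s)
        = (\<Sum>s\<in>{l * K..<l * K + K}. if s = r + l * K then f s else 0)"
      by (intro sum.cong refl)
    also have "\<dots> = f (r + l * K)"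
      using assms by simp
    finally show ?thesis .
  qed
  then show ?thesis
    by (subst sum.nat_group[symmetric]) simp
qed

text \<open>The first \<open>t\<close> times consist of \<open>t div K\<close> full periods and an
  incomplete one, which meets the residue \<open>r\<close> at most once.\<close>

lemma gate_count_history_close:
  assumes K: "K \<ge> 1" and r: "r < K"
  shows "\<bar>gate_count K r t (history G Y t \<omega>) - (\<Sum>l<t div K. of_bool (G (r + l * K) \<omega>))\<bar> \<le> 1"
proof -
  define n where "n = t div K"
  let ?f = "\<lambda>s. of_bool (s mod K = r) * of_bool (G s \<omega>) :: real"
  have t: "n * K \<le> t" "t \<le> n * K + K"
    unfolding n_def using K div_mult_mod_eq[of t K] mod_less_divisor[of K t] by linarith+
  have count: "gate_count K r t (history G Y t \<omega>) = sum ?f {..<t}"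
    unfolding gate_count_def by (intro sum.cong refl) (simp add: history_def)
  have nK: "sum ?f {..<n * K} = (\<Sum>l<n. of_bool (G (r + l * K) \<omega>))"
    by (rule sum_residue_class[OF r])
  have lower: "sum ?f {..<n * K} \<le> sum ?f {..<t}"
    by (rule sum_mono2) (use t in auto)
  have "sum ?f {..<t} \<le> sum ?f {..<Suc n * K}"
    by (rule sum_mono2) (use t in \<open>auto simp: add.commute\<close>)
  also have "\<dots> = (\<Sum>l<Suc n. of_bool (G (r + l * K) \<omega>))"
    by (rule sum_residue_class[OF r])
  also have "\<dots> \<le> (\<Sum>l<n. of_bool (G (r + l * K) \<omega>)) + 1"
    by simp
  finally show ?thesis
    using lower unfolding count nK n_def[symmetric] by linarith
qed

text \<open>The frequency error is bounded by 1, so convergence in probability gives convergence in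
  mean. The index passes from periods to times through \<open>t div K\<close>.\<close>

lemma (in prob_space) gate_frequency_L1:
  fixes g :: real
  assumes GY: "\<And>t. G t \<in> measurable M (count_space UNIV)" "\<And>t. Y t \<in> measurable M (count_space UNIV)"
    and K: "K \<ge> 1" and r: "r < K" and g: "0 \<le> g" "g \<le> 1"
    and conv: "tendsto0_in_prob (\<lambda>_. M) (\<lambda>L \<omega>. (\<Sum>l<L. of_bool (G (r + l * K) \<omega>)) / real L - g)"
  shows "(\<lambda>t. expectation (\<lambda>\<omega>. \<bar>gate_count K r t (history G Y t \<omega>) / real t - g / real K\<bar>)) \<longlonglongrightarrow> 0"
proof -
  define X where "X = (\<lambda>L \<omega>. (\<Sum>l<L. of_bool (G (r + l * K) \<omega>)) / real L - g)"
  note [measurable] = GY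
  have X_meas[measurable]: "X L \<in> borel_measurable M" for L
    unfolding X_def by measurable
  have X1: "\<bar>X L \<omega>\<bar> \<le> 1" for L \<omega>
  proof -
    have "(\<Sum>l<L. of_bool (G (r + l * K) \<omega>)) \<le> (\<Sum>l<L. 1 :: real)"
      by (intro sum_mono) auto
    then have "0 \<le> (\<Sum>l<L. of_bool (G (r + l * K) \<omega>) :: real) / real L"
      "(\<Sum>l<L. of_bool (G (r + l * K) \<omega>) :: real) / real L \<le> 1"
      by (auto simp: divide_le_eq intro!: divide_nonneg_nonneg sum_nonneg)
    then show ?thesis
      using g unfolding X_def by linarith
  qed
  have X_int: "integrable M (\<lambda>\<omega>. \<bar>X L \<omega>\<bar>)" for L
    by (rule integrable_const_bound[where B = 1]) (use X1 in auto)
  have X_lim: "(\<lambda>L. expectation (\<lambda>\<omega>. \<bar>X L \<omega>\<bar>)) \<longlonglongrightarrow> 0"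
  proof (rule tendsto_le_approx)
    fix \<epsilon> :: real
    assume "\<epsilon> > 0"
    have "(\<lambda>L. prob {\<omega> \<in> space M. \<bar>X L \<omega>\<bar> > \<delta>}) \<longlonglongrightarrow> 0" if "\<delta> > 0" for \<delta>
      using conv that unfolding tendsto0_in_prob_def X_def by blast
    from this[OF half_gt_zero[OF \<open>\<epsilon> > 0\<close>]]
    have "(\<lambda>L. prob {\<omega> \<in> space M. \<bar>X L \<omega>\<bar> > \<epsilon> / 2}) \<longlonglongrightarrow> 0" .
    then have "\<forall>\<^sub>F L in sequentially. prob {\<omega> \<in> space M. \<bar>X L \<omega>\<bar> > \<epsilon> / 2} < \<epsilon> / 2"
      using \<open>\<epsilon> > 0\<close> by (intro order_tendstoD(2)) auto
    then show "\<forall>\<^sub>F L in sequentially. \<bar>expectation (\<lambda>\<omega>. \<bar>X L \<omega>\<bar>) - 0\<bar> \<le> \<epsilon>"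
    proof eventually_elim
      case (elim L)
      let ?B = "{\<omega> \<in> space M. \<bar>X L \<omega>\<bar> > \<epsilon> / 2}"
      have B: "?B \<in> events" by measurable
      have "expectation (\<lambda>\<omega>. \<bar>X L \<omega>\<bar>) \<le> expectation (\<lambda>\<omega>. \<epsilon> / 2 + indicator ?B \<omega>)"
      proof (rule integral_mono[OF X_int])
        show "integrable M (\<lambda>\<omega>. \<epsilon> / 2 + indicator ?B \<omega> :: real)"
          using B by (intro Bochner_Integration.integrable_add integrable_const integrable_real_indicator) (auto simp: emeasure_eq_measure)
        show "\<bar>X L \<omega>\<bar> \<le> \<epsilon> / 2 + indicator ?B \<omega>" if "\<omega> \<in> space M" for \<omega>
          using X1[of L \<omega>] that \<open>\<epsilon> > 0\<close> by (auto simp: indicator_def)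
      qed
      also have "\<dots> = \<epsilon> / 2 + prob ?B"
        using B by (subst Bochner_Integration.integral_add) (auto simp: emeasure_eq_measure prob_space)
      finally have "expectation (\<lambda>\<omega>. \<bar>X L \<omega>\<bar>) \<le> \<epsilon>"
        using elim by linarith
      moreover have "0 \<le> expectation (\<lambda>\<omega>. \<bar>X L \<omega>\<bar>)"
        by (rule Bochner_Integration.integral_nonneg) simp
      ultimately show ?case by simp
    qed
  qed
  have div_lim: "filterlim (\<lambda>t. t div K) sequentially sequentially"
  proof (rule filterlim_at_top[THEN iffD2, rule_format])
    fix Z
    show "\<forall>\<^sub>F t in sequentially. Z \<le> t div K"
      using eventually_ge_at_top[of "Z * K"]
      by eventually_elim (use K in \<open>simp add: less_eq_div_iff_mult_less_eq\<close>)
  qed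
  have "(\<lambda>t. expectation (\<lambda>\<omega>. \<bar>X (t div K) \<omega>\<bar>) + 2 * (1 / real t)) \<longlonglongrightarrow> 0 + 2 * 0"
    by (intro tendsto_add tendsto_mult tendsto_const lim_1_over_n filterlim_compose[OF X_lim div_lim])
  then have lim: "(\<lambda>t. expectation (\<lambda>\<omega>. \<bar>X (t div K) \<omega>\<bar>) + 2 * (1 / real t)) \<longlonglongrightarrow> 0"
    by simp
  show ?thesis
  proof (rule Lim_null_comparison[OF _ lim])
    show "\<forall>\<^sub>F t in sequentially. norm (expectation (\<lambda>\<omega>. \<bar>gate_count K r t (history G Y t \<omega>) / real t - g / real K\<bar>))
        \<le> expectation (\<lambda>\<omega>. \<bar>X (t div K) \<omega>\<bar>) + 2 * (1 / real t)"
      using eventually_gt_at_top[of 0]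
    proof eventually_elim
      case (elim t)
      define n where "n = t div K"
      have "K * n \<le> t" "t \<le> K * n + K"
        using times_div_less_eq_dividend[of K t] dividend_less_times_div[of K t] K unfolding n_def by linarith+
      then have nK: "real K * real n \<le> real t" "real t \<le> real K * real n + real K"
        by (simp_all only: of_nat_mult[symmetric] of_nat_add[symmetric] of_nat_le_iff)
      have t: "real t > 0" and K': "real K \<ge> 1" using elim K by auto
      have nt: "real n \<le> real t"
        using div_le_dividend[of t K] by (simp add: n_def)
      \<comment> \<open>The 2 consists of one unit for the incomplete last period and one for
        replacing \<open>g * (t div K)\<close> by \<open>g * t / K\<close>.\<close>
      have le: "\<bar>gate_count K r t (history G Y t \<omega>) / real t - g / real K\<bar> \<le> \<bar>X n \<omega>\<bar> + 2 * (1 / real t)" for \<omega>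
      proof -
        define N where "N = gate_count K r t (history G Y t \<omega>)"
        define S where "S = (\<Sum>l<n. of_bool (G (r + l * K) \<omega>) :: real)"
        have SX: "S = real n * (X n \<omega> + g)"
          unfolding S_def X_def by (cases "n = 0") simp_all
        have NS: "\<bar>N - S\<bar> \<le> 1"
          unfolding N_def S_def n_def by (rule gate_count_history_close[OF K r])
        have "g * (real t - real K * real n) \<le> 1 * real K"
          using nK g by (intro mult_mono) auto
        moreover have "0 \<le> g * (real t - real K * real n)"
          using nK g by (intro mult_nonneg_nonneg) auto
        moreover have "real n * g - real t * (g / real K) = - (g * (real t - real K * real n) / real K)"
          using K' by (simp add: field_simps)
        ultimately have gap: "\<bar>real n * g - real t * (g / real K)\<bar> \<le> 1"
          using K' by (simp add: divide_le_eq)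
        have Xn: "\<bar>real n * X n \<omega>\<bar> \<le> real t * \<bar>X n \<omega>\<bar>"
          using nt by (simp add: abs_mult mult_right_mono)
        have "N - real t * (g / real K) = (N - S) + real n * X n \<omega> + (real n * g - real t * (g / real K))"
          by (simp add: SX algebra_simps)
        then have "\<bar>N - real t * (g / real K)\<bar> \<le> 2 + real t * \<bar>X n \<omega>\<bar>"
          using NS gap Xn by linarith
        then have "\<bar>N - real t * (g / real K)\<bar> / real t \<le> (2 + real t * \<bar>X n \<omega>\<bar>) / real t"
          using t by (intro divide_right_mono) auto
        moreover have "\<bar>N - real t * (g / real K)\<bar> / real t = \<bar>N / real t - g / real K\<bar>"
        proof -
          have "\<bar>N - real t * (g / real K)\<bar> / real t = \<bar>(N - real t * (g / real K)) / real t\<bar>"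
            using t by (simp add: abs_divide)
          also have "(N - real t * (g / real K)) / real t = N / real t - g / real K"
            using t by (simp add: diff_divide_distrib)
          finally show ?thesis .
        qed
        moreover have "(2 + real t * \<bar>X n \<omega>\<bar>) / real t = \<bar>X n \<omega>\<bar> + 2 * (1 / real t)"
          using t by (simp add: field_simps)
        ultimately show ?thesis
          by (simp only: N_def)
      qed
      have hist[measurable]: "history G Y t \<in> M \<rightarrow>\<^sub>M count_space (histories t)"
        by (rule history_measurable[OF GY])
      have meas: "(\<lambda>\<omega>. \<bar>gate_count K r t (history G Y t \<omega>) / real t - g / real K\<bar>) \<in> borel_measurable M"
        by (rule measurable_compose[OF hist]) simp
      have dom_int: "integrable M (\<lambda>\<omega>. \<bar>X n \<omega>\<bar> + 2 * (1 / real t))"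
        by (intro Bochner_Integration.integrable_add X_int integrable_const)
      have "integrable M (\<lambda>\<omega>. \<bar>gate_count K r t (history G Y t \<omega>) / real t - g / real K\<bar>)"
        by (rule Bochner_Integration.integrable_bound[OF dom_int meas]) (use le in \<open>auto intro: order_trans[OF _ abs_ge_self]\<close>)
      then have "expectation (\<lambda>\<omega>. \<bar>gate_count K r t (history G Y t \<omega>) / real t - g / real K\<bar>)
          \<le> expectation (\<lambda>\<omega>. \<bar>X n \<omega>\<bar> + 2 * (1 / real t))"
        by (rule integral_mono[OF _ dom_int le])
      also have "\<dots> = expectation (\<lambda>\<omega>. \<bar>X n \<omega>\<bar>) + 2 * (1 / real t)"
        by (subst Bochner_Integration.integral_add[OF X_int integrable_const]) (simp add: prob_space)
      finally show ?case
        by (simp add: n_def)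
    qed
  qed
qed

section \<open>The main theorem\<close>

lemma sum_scaleR_by_residue:
  fixes c :: "nat \<Rightarrow> 'a::real_vector"
  assumes "K \<ge> 1"
  shows "(\<Sum>s<t. a s *\<^sub>R c (s mod K)) = (\<Sum>r<K. (\<Sum>s<t. of_bool (s mod K = r) * a s) *\<^sub>R c r)"
proof -
  have "(\<Sum>r<K. (of_bool (s mod K = r) * a s) *\<^sub>R c r) = a s *\<^sub>R c (s mod K)" for s
  proof -
    have "(\<Sum>r<K. (of_bool (s mod K = r) * a s) *\<^sub>R c r) = (\<Sum>r<K. if r = s mod K then a s *\<^sub>R c r else 0)"
      by (intro sum.cong) auto
    then show ?thesis
      using assms by simp
  qed
  then have "(\<Sum>s<t. a s *\<^sub>R c (s mod K)) = (\<Sum>s<t. \<Sum>r<K. (of_bool (s mod K = r) * a s) *\<^sub>R c r)"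
    by simp
  also have "\<dots> = (\<Sum>r<K. (\<Sum>s<t. of_bool (s mod K = r) * a s) *\<^sub>R c r)"
    by (subst sum.swap) (simp only: scaleR_sum_left)
  finally show ?thesis .
qed

lemma outer_prod_self_mult: "outer_prod v v *v u = (v \<bullet> u) *\<^sub>R v"
  by (simp add: vec_eq_iff outer_prod_def matrix_vector_mult_def inner_vec_def sum_distrib_left mult_ac)

lemma sum_matrix_vector_mult:
  fixes A :: "'i \<Rightarrow> real ^ 'n ^ 'm"
  shows "(\<Sum>i\<in>I. A i) *v u = (\<Sum>i\<in>I. A i *v u)"
  by (induction I rule: infinite_finite_induct) (simp_all add: matrix_vector_mult_add_rdistrib)

lemma fisher_information_quadratic_form:
  "u \<bullet> (fisher_information K p lam \<theta> \<alpha> *v u)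
     = (\<Sum>r<K. \<alpha> r / real K * ((1 - p r \<theta>) / p r \<theta>) * (u \<bullet> grad (lam r) \<theta>)\<^sup>2)"
proof -
  have "u \<bullet> (fisher_information K p lam \<theta> \<alpha> *v u)
      = (1 / real K) * (\<Sum>r<K. \<alpha> r * ((1 - p r \<theta>) / p r \<theta> * ((grad (lam r) \<theta> \<bullet> u) * (u \<bullet> grad (lam r) \<theta>))))"
    unfolding fisher_information_def fisher_component_def
    by (simp only: scaleR_matrix_vector_assoc[symmetric] sum_matrix_vector_mult outer_prod_self_mult
        inner_sum_right inner_scaleR_right)
  also have "\<dots> = (\<Sum>r<K. \<alpha> r / real K * ((1 - p r \<theta>) / p r \<theta>) * (u \<bullet> grad (lam r) \<theta>)\<^sup>2)"
    unfolding sum_distrib_left by (intro sum.cong refl) (simp add: inner_commute power2_eq_square)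
  finally show ?thesis .
qed

lemma exp_minus_Lipschitz:
  fixes x y :: real
  assumes "x \<ge> 0" "y \<ge> 0"
  shows "\<bar>exp (- x) - exp (- y)\<bar> \<le> \<bar>x - y\<bar>"
proof -
  have *: "\<bar>exp (- x) - exp (- y)\<bar> \<le> \<bar>x - y\<bar>" if "0 \<le> y" "y \<le> x" for x y :: real
  proof -
    have "exp (- y) - exp (- x) = exp (- y) * (1 - exp (- (x - y)))"
      by (simp add: right_diff_distrib flip: exp_add)
    also have "\<dots> \<le> 1 * (x - y)"
    proof (intro mult_mono)
      show "1 - exp (- (x - y)) \<le> x - y"
        using exp_ge_add_one_self[of "- (x - y)"] by linarith
    qed (use that in auto)
    finally show ?thesis
      using that by simp
  qed
  show ?thesis
    using assms *[of x y] *[of y x] by (cases "y \<le> x") (auto simp: abs_minus_commute)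
qed

section \<open>The process under the regularity assumptions\<close>

locale regular_ded =
  fixes K D :: nat
    and \<Theta> :: "(real ^ 'd) set"
    and p lam :: "nat \<Rightarrow> real ^ 'd \<Rightarrow> real"
    and \<gamma> :: "real ^ 'd \<Rightarrow> nat \<Rightarrow> real"
    and M :: "real ^ 'd \<Rightarrow> 'w measure"
    and G Y :: "nat \<Rightarrow> 'w \<Rightarrow> bool"
    and \<theta>0 :: "real ^ 'd"
    and lam_min lam_max :: real
  assumes ded: "ded_process K D \<Theta> p \<gamma> M G Y"
    and p_eq: "\<And>t \<theta>. \<theta> \<in> \<Theta> \<Longrightarrow> p t \<theta> = 1 - exp (- lam t \<theta>)"
    and lam_mod: "\<And>t \<theta>. \<theta> \<in> \<Theta> \<Longrightarrow> lam t \<theta> = lam (t mod K) \<theta>"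
    and \<theta>0_interior: "\<theta>0 \<in> interior \<Theta>"
    and lam_min_pos: "0 < lam_min"
    and lam_bounds: "\<And>r \<theta>. r < K \<Longrightarrow> \<theta> \<in> \<Theta> \<Longrightarrow> lam_min \<le> lam r \<theta> \<and> lam r \<theta> \<le> lam_max"
    and lam_differentiable: "\<And>r. r < K \<Longrightarrow> lam r differentiable (at \<theta>0)"
begin

lemma K_pos: "K \<ge> 1"
  using ded by (simp add: ded_process_def)

lemma \<theta>0_in: "\<theta>0 \<in> \<Theta>"
  using \<theta>0_interior interior_subset by blast

lemma lam_bounds_all: "\<theta> \<in> \<Theta> \<Longrightarrow> lam_min \<le> lam s \<theta> \<and> lam s \<theta> \<le> lam_max"
  using lam_bounds[of "s mod K" \<theta>] lam_mod[of \<theta> s] K_pos by simp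

lemma p_mod: "\<theta> \<in> \<Theta> \<Longrightarrow> p (s mod K) \<theta> = p s \<theta>"
  using p_eq[of \<theta> s] p_eq[of \<theta> "s mod K"] lam_mod[of \<theta> s] by simp

text \<open>A distance from 0 and 1 kept by all event probabilities, uniformly in time and
  parameter; it is the constant \<open>a\<close> of the second moment bound.\<close>

definition margin :: real where
  "margin = min (1 - exp (- lam_min)) (exp (- lam_max))"

lemma margin_pos: "margin > 0"
  using lam_min_pos by (simp add: margin_def)

lemma p_margin: "\<theta> \<in> \<Theta> \<Longrightarrow> margin \<le> p s \<theta> \<and> p s \<theta> \<le> 1 - margin"
  using lam_bounds_all[of \<theta> s] p_eq[of \<theta> s] by (simp add: margin_def min_le_iff_disj)

lemma p_strict: "\<theta> \<in> \<Theta> \<Longrightarrow> 0 < p s \<theta> \<and> p s \<theta> < 1"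
  using p_margin[of \<theta> s] margin_pos by linarith

lemma p_weak: "\<theta> \<in> \<Theta> \<Longrightarrow> 0 \<le> p s \<theta> \<and> p s \<theta> \<le> 1"
  using p_strict[of \<theta> s] by linarith

text \<open>One kernel for all parameters and times; naming it allows \<open>gating_kernel\<close>
  to be instantiated once for the whole locale.\<close>

definition kernel :: "(bool \<times> bool) list \<Rightarrow> bool \<Rightarrow> real" where
  "kernel = (SOME q. gating_kernel q \<and> (\<forall>\<theta>\<in>\<Theta>. \<forall>t. history_law M G Y \<theta> t
            = point_measure (histories t) (\<lambda>xs. ennreal (gating_kernel.path_prob q (\<lambda>s. p s \<theta>) xs))))"

lemma kernel: "gating_kernel kernel \<and> (\<forall>\<theta>\<in>\<Theta>. \<forall>t. history_law M G Y \<theta> t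
            = point_measure (histories t) (\<lambda>xs. ennreal (gating_kernel.path_prob kernel (\<lambda>s. p s \<theta>) xs)))"
proof -
  have "\<exists>q. gating_kernel q \<and> (\<forall>\<theta>\<in>\<Theta>. \<forall>t. history_law M G Y \<theta> t
            = point_measure (histories t) (\<lambda>xs. ennreal (gating_kernel.path_prob q (\<lambda>s. p s \<theta>) xs)))"
    (is ?ex)
  proof (rule history_law_eq_point_measure[OF ded])
    fix q
    assume "gating_kernel q" and "\<And>\<theta> t. \<theta> \<in> \<Theta> \<Longrightarrow> history_law M G Y \<theta> t
            = point_measure (histories t) (\<lambda>xs. ennreal (gating_kernel.path_prob q (\<lambda>s. p s \<theta>) xs))"
    then show ?ex
      by blast
  qed
  from someI_ex[OF this] show ?thesis
    unfolding kernel_def .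
qed

sublocale gating_kernel kernel
  using kernel by blast

lemma history_law_eq_path_law: "\<theta> \<in> \<Theta> \<Longrightarrow> history_law M G Y \<theta> t = path_law (\<lambda>s. p s \<theta>) t"
  using kernel by (simp add: path_law_def)

text \<open>Carries the limit from the sample space to finite sums over histories. The division by
  \<open>K\<close> reflects that a residue class takes up one K-th of all times.\<close>

lemma gate_frequency:
  assumes r: "r < K"
  shows "(\<lambda>t. expect (\<lambda>s. p s \<theta>0) t (\<lambda>xs. \<bar>gate_count K r t xs / real t - \<gamma> \<theta>0 r / real K\<bar>)) \<longlonglongrightarrow> 0"
proof -
  have "\<forall>\<theta>\<in>\<Theta>. prob_space (M \<theta>) \<and> (\<forall>t. G t \<in> measurable (M \<theta>) (count_space UNIV) \<and>
             Y t \<in> measurable (M \<theta>) (count_space UNIV))"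
    using ded unfolding ded_process_def by (elim conjE)
  then have M: "prob_space (M \<theta>0)" and GY: "G t \<in> measurable (M \<theta>0) (count_space UNIV)"
      "Y t \<in> measurable (M \<theta>0) (count_space UNIV)" for t
    using \<theta>0_in by simp_all
  have "\<forall>\<theta>\<in>\<Theta>. \<forall>r<K. 0 \<le> \<gamma> \<theta> r \<and> \<gamma> \<theta> r \<le> 1 \<and> tendsto0_in_prob (\<lambda>_. M \<theta>)
          (\<lambda>L \<omega>. (\<Sum>l<L. of_bool (G (r + l * K) \<omega>)) / real L - \<gamma> \<theta> r)"
    using ded unfolding ded_process_def by (elim conjE)
  then have \<gamma>: "0 \<le> \<gamma> \<theta>0 r" "\<gamma> \<theta>0 r \<le> 1" and conv: "tendsto0_in_prob (\<lambda>_. M \<theta>0)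
          (\<lambda>L \<omega>. (\<Sum>l<L. of_bool (G (r + l * K) \<omega>)) / real L - \<gamma> \<theta>0 r)"
    using \<theta>0_in r by simp_all
  have "expect (\<lambda>s. p s \<theta>0) t f = integral\<^sup>L (M \<theta>0) (\<lambda>\<omega>. f (history G Y t \<omega>))" for t and f :: "_ \<Rightarrow> real"
  proof -
    have "expect (\<lambda>s. p s \<theta>0) t f = integral\<^sup>L (history_law M G Y \<theta>0 t) f"
      unfolding history_law_eq_path_law[OF \<theta>0_in] by (rule integral_path_law[symmetric]) (rule p_weak[OF \<theta>0_in])
    also have "\<dots> = integral\<^sup>L (M \<theta>0) (\<lambda>\<omega>. f (history G Y t \<omega>))"
      unfolding history_law_def by (intro integral_distr history_measurable GY) simp
    finally show ?thesis .
  qed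
  then show ?thesis
    using prob_space.gate_frequency_L1[OF M GY K_pos r \<gamma> conv] by simp
qed

text \<open>\<open>lam s\<close> and \<open>lam (s mod K)\<close> agree only on
  \<open>\<Theta>\<close>; since \<open>\<theta>0\<close> is interior they agree near it, and the
  derivative carries over.\<close>

lemma GDERIV_lam: "GDERIV (lam s) \<theta>0 :> grad (lam s) \<theta>0"
  and grad_lam_mod: "grad (lam s) \<theta>0 = grad (lam (s mod K)) \<theta>0"
proof -
  have "s mod K < K"
    using K_pos by simp
  then have "GDERIV (lam (s mod K)) \<theta>0 :> grad (lam (s mod K)) \<theta>0"
    by (intro differentiable_imp_GDERIV_grad lam_differentiable)
  then have D: "GDERIV (lam s) \<theta>0 :> grad (lam (s mod K)) \<theta>0"
    unfolding gderiv_def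
    by (rule has_derivative_transform_within_open[OF _ open_interior \<theta>0_interior])
       (rule lam_mod[symmetric], use interior_subset in blast)
  then show eq: "grad (lam s) \<theta>0 = grad (lam (s mod K)) \<theta>0"
    by (rule grad_eqI)
  show "GDERIV (lam s) \<theta>0 :> grad (lam s) \<theta>0"
    using D eq by simp
qed

lemma score_by_residue:
  "normalized_score p lam \<theta>0 t xs = (1 / sqrt (real t)) *\<^sub>R
     (\<Sum>r<K. residual_sum (\<lambda>s. p s \<theta>0) K r t xs *\<^sub>R ((1 / p r \<theta>0) *\<^sub>R grad (lam r) \<theta>0))"
proof -
  have "(\<Sum>s<t. (of_bool (fst (xs ! s)) * ((of_bool (snd (xs ! s)) - p s \<theta>0) / p s \<theta>0)) *\<^sub>R grad (lam s) \<theta>0)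
      = (\<Sum>s<t. (of_bool (fst (xs ! s)) * (of_bool (snd (xs ! s)) - p s \<theta>0)) *\<^sub>R
            ((1 / p (s mod K) \<theta>0) *\<^sub>R grad (lam (s mod K)) \<theta>0))"
    by (intro sum.cong refl) (simp add: p_mod[OF \<theta>0_in] grad_lam_mod[symmetric])
  then show ?thesis
    unfolding normalized_score_def residual_sum_def by (subst sum_scaleR_by_residue[OF K_pos, symmetric]) simp
qed

section \<open>Local parameter sequences: contiguity and the quadratic expansion\<close>

context
  fixes h :: "nat \<Rightarrow> real ^ 'd"
  assumes h: "bounded (range h)"
begin

definition \<theta>t :: "nat \<Rightarrow> real ^ 'd" where
  "\<theta>t t = \<theta>0 + (1 / sqrt (real t)) *\<^sub>R h t"

definition lam_increment :: "nat \<Rightarrow> nat \<Rightarrow> real" where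
  "lam_increment t r = lam r (\<theta>t t) - lam r \<theta>0"

definition direction :: "nat \<Rightarrow> nat \<Rightarrow> real" where
  "direction t r = h t \<bullet> grad (lam r) \<theta>0"

lemma eventually_in: "\<forall>\<^sub>F t in sequentially. \<theta>t t \<in> \<Theta>"
proof -
  obtain b where b: "\<And>t. norm (h t) \<le> b"
    using h by (auto simp: bounded_iff)
  have "(\<lambda>t. 1 / sqrt (real t)) \<longlonglongrightarrow> 0"
    by (intro tendsto_divide_0[OF tendsto_const] filterlim_at_top_imp_at_infinity
         filterlim_compose[OF sqrt_at_top filterlim_real_sequentially])
  then have "(\<lambda>t. (1 / sqrt (real t)) * b) \<longlonglongrightarrow> 0"
    by (rule tendsto_mult_left_zero)
  then have "(\<lambda>t. (1 / sqrt (real t)) *\<^sub>R h t) \<longlonglongrightarrow> 0"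
    by (rule Lim_null_comparison[rotated]) (use b in \<open>auto simp: divide_right_mono\<close>)
  then have "\<theta>t \<longlonglongrightarrow> \<theta>0 + 0"
    unfolding \<theta>t_def[abs_def] by (intro tendsto_add tendsto_const)
  then have "\<forall>\<^sub>F t in sequentially. \<theta>t t \<in> interior \<Theta>"
    using topological_tendstoD[OF _ open_interior, of \<theta>t \<theta>0] \<theta>0_interior by simp
  then show ?thesis
    by (rule eventually_mono) (use interior_subset in blast)
qed

lemma increment_limit: "(\<lambda>t. sqrt (real t) * lam_increment t r - direction t r) \<longlonglongrightarrow> 0"
  unfolding lam_increment_def direction_def \<theta>t_def by (rule GDERIV_sequence[OF GDERIV_lam h])

lemma Bseq_direction: "Bseq (\<lambda>t. direction t r)"
proof -
  obtain b where b: "\<And>t. norm (h t) \<le> b"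
    using h by (auto simp: bounded_iff)
  have "norm (direction t r) \<le> b * norm (grad (lam r) \<theta>0)" for t
    unfolding direction_def
    using Cauchy_Schwarz_ineq2[of "h t" "grad (lam r) \<theta>0"] mult_right_mono[OF b[of t], of "norm (grad (lam r) \<theta>0)"]
    by simp
  then show ?thesis
    by (rule BseqI')
qed

lemmas expansion = likelihood_increment_expansion[where v = "\<lambda>t. direction t r" and x = "\<lambda>t. lam_increment t r"
    and p = "p r \<theta>0" for r, OF conjunct1[OF p_strict[OF \<theta>0_in]] conjunct2[OF p_strict[OF \<theta>0_in]] increment_limit Bseq_direction]

text \<open>Event probabilities are Lipschitz in \<open>lam\<close>, whose increments have order
  \<open>1 / sqrt t\<close> in each residue class. The sum of the finitely many constants bounds all
  times at once.\<close>

lemma p_increment_bound: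
  obtains b where "\<forall>\<^sub>F t in sequentially. \<forall>s. \<bar>p s (\<theta>t t) - p s \<theta>0\<bar> \<le> b / sqrt (real t)"
proof -
  have "\<forall>r. \<exists>c. \<forall>t. \<bar>sqrt (real t) * lam_increment t r\<bar> \<le> c"
    using expansion(4) unfolding Bseq_def by auto
  then obtain c where c: "\<And>r t. \<bar>sqrt (real t) * lam_increment t r\<bar> \<le> c r"
    by metis
  have c0: "0 \<le> c r" for r
    using c[of 0 r] by simp
  show thesis
  proof (rule that)
    show "\<forall>\<^sub>F t in sequentially. \<forall>s. \<bar>p s (\<theta>t t) - p s \<theta>0\<bar> \<le> (\<Sum>r<K. c r) / sqrt (real t)"
      using eventually_in eventually_gt_at_top[of 0]
    proof eventually_elim
      case (elim t)
      show ?case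
      proof
        fix s
        have st: "sqrt (real t) > 0" using elim by simp
        have sK: "s mod K < K" using K_pos by simp
        have "\<bar>p s (\<theta>t t) - p s \<theta>0\<bar> = \<bar>exp (- lam (s mod K) (\<theta>t t)) - exp (- lam (s mod K) \<theta>0)\<bar>"
          using p_eq[OF elim(1)] p_eq[OF \<theta>0_in] lam_mod[OF elim(1), of s] lam_mod[OF \<theta>0_in, of s] by (simp add: abs_minus_commute)
        also have "\<dots> \<le> \<bar>lam_increment t (s mod K)\<bar>"
          unfolding lam_increment_def using lam_bounds_all[OF elim(1), of "s mod K"] lam_bounds_all[OF \<theta>0_in, of "s mod K"] lam_min_pos
          by (intro exp_minus_Lipschitz) linarith+
        also have "\<dots> \<le> c (s mod K) / sqrt (real t)"
          using c[of t "s mod K"] st by (simp add: abs_mult pos_le_divide_eq mult.commute)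
        also have "\<dots> \<le> (\<Sum>r<K. c r) / sqrt (real t)"
          using st sK c0 by (intro divide_right_mono member_le_sum) auto
        finally show "\<bar>p s (\<theta>t t) - p s \<theta>0\<bar> \<le> (\<Sum>r<K. c r) / sqrt (real t)" .
      qed
    qed
  qed
qed

text \<open>For large \<open>t\<close> both parameters lie in \<open>\<Theta>\<close>, so
  \<open>margin\<close> applies to both laws, and the bound on the difference of probabilities is
  symmetric; the same comparison therefore works in each direction.\<close>

lemma local_contiguity:
  "mutually_contiguous (\<lambda>t. history_law M G Y (\<theta>0 + (1 / sqrt (real t)) *\<^sub>R h t) t)
     (\<lambda>t. history_law M G Y \<theta>0 t)"
proof -
  obtain b where "\<forall>\<^sub>F t in sequentially. \<forall>s. \<bar>p s (\<theta>t t) - p s \<theta>0\<bar> \<le> b / sqrt (real t)"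
    by (rule p_increment_bound)
  then have ev: "\<forall>\<^sub>F t in sequentially. \<theta>t t \<in> \<Theta> \<and> t > 0 \<and> (\<forall>s. \<bar>p s (\<theta>t t) - p s \<theta>0\<bar> \<le> b / sqrt (real t))"
    using eventually_in eventually_gt_at_top[of 0] by eventually_elim blast
  have "\<forall>A\<in>sets (history_law M G Y \<theta>0 t). measure (history_law M G Y (\<theta>t t) t) A
        \<le> sqrt (exp (b\<^sup>2 / margin\<^sup>2) * measure (history_law M G Y \<theta>0 t) A)"
    "\<forall>A\<in>sets (history_law M G Y (\<theta>t t) t). measure (history_law M G Y \<theta>0 t) A
        \<le> sqrt (exp (b\<^sup>2 / margin\<^sup>2) * measure (history_law M G Y (\<theta>t t) t) A)"
    if t: "\<theta>t t \<in> \<Theta> \<and> t > 0 \<and> (\<forall>s. \<bar>p s (\<theta>t t) - p s \<theta>0\<bar> \<le> b / sqrt (real t))" for t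
  proof -
    have t': "\<theta>t t \<in> \<Theta>" "t > 0" and d: "\<bar>p s (\<theta>t t) - p s \<theta>0\<bar> \<le> b / sqrt (real t)" for s
      using t by auto
    have d': "\<bar>p s \<theta>0 - p s (\<theta>t t)\<bar> \<le> b / sqrt (real t)" for s
      using d[of s] by (simp add: abs_minus_commute)
    show "\<forall>A\<in>sets (history_law M G Y \<theta>0 t). measure (history_law M G Y (\<theta>t t) t) A
        \<le> sqrt (exp (b\<^sup>2 / margin\<^sup>2) * measure (history_law M G Y \<theta>0 t) A)"
      unfolding history_law_eq_path_law[OF \<theta>0_in] history_law_eq_path_law[OF t'(1)]
      using measure_path_law_le_sqrt_exp[where p = "\<lambda>s. p s \<theta>0" and p' = "\<lambda>s. p s (\<theta>t t)" and a = margin,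
          OF p_margin[OF \<theta>0_in] p_margin[OF t'(1)] margin_pos d _ t'(2)] by simp
    show "\<forall>A\<in>sets (history_law M G Y (\<theta>t t) t). measure (history_law M G Y \<theta>0 t) A
        \<le> sqrt (exp (b\<^sup>2 / margin\<^sup>2) * measure (history_law M G Y (\<theta>t t) t) A)"
      unfolding history_law_eq_path_law[OF \<theta>0_in] history_law_eq_path_law[OF t'(1)]
      using measure_path_law_le_sqrt_exp[where p' = "\<lambda>s. p s \<theta>0" and p = "\<lambda>s. p s (\<theta>t t)" and a = margin,
          OF p_margin[OF t'(1)] p_margin[OF \<theta>0_in] margin_pos d' _ t'(2)] by simp
  qed
  note bound = this
  show ?thesis
    unfolding mutually_contiguous_def \<theta>t_def[symmetric]
    by (intro conjI contiguous_toI_sqrt[where c = "exp (b\<^sup>2 / margin\<^sup>2)"] eventually_mono[OF ev]) (erule bound)+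
qed

text \<open>For large \<open>t\<close> the remainder is almost surely the error \<open>E\<close> of
  the expansion with explicit increments, whose mean absolute value tends to 0. Markov's inequality
  turns this into convergence in probability.\<close>

lemma local_asymptotic_normality:
  "tendsto0_in_prob (\<lambda>t. history_law M G Y \<theta>0 t)
     (\<lambda>t xs. log_lr (history_law M G Y (\<theta>0 + (1 / sqrt (real t)) *\<^sub>R h t) t) (history_law M G Y \<theta>0 t) xs
        - (h t \<bullet> normalized_score p lam \<theta>0 t xs
           - (h t \<bullet> (fisher_information K p lam \<theta>0 (\<gamma> \<theta>0) *v h t)) / 2))"
  unfolding tendsto0_in_prob_def \<theta>t_def[symmetric]
proof (intro allI impI)
  let ?p = "\<lambda>s. p s \<theta>0"
  define A where "A = (\<lambda>t r. ln (1 + (1 - p r \<theta>0) / p r \<theta>0 * (1 - exp (- lam_increment t r))))"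
  define B where "B = (\<lambda>t r. - lam_increment t r)"
  define E where "E = (\<lambda>t xs. (\<Sum>s<t. of_bool (fst (xs ! s)) * (of_bool (snd (xs ! s)) * A t (s mod K)
            + (1 - of_bool (snd (xs ! s))) * B t (s mod K)))
         - (1 / sqrt (real t) * (\<Sum>s<t. of_bool (fst (xs ! s)) * ((of_bool (snd (xs ! s)) - p s \<theta>0) / p s \<theta>0) * direction t (s mod K))
            - (\<Sum>r<K. \<gamma> \<theta>0 r / real K * ((1 - p r \<theta>0) / p r \<theta>0) * (direction t r)\<^sup>2) / 2))"
  have E_lim: "(\<lambda>t. expect ?p t (\<lambda>xs. \<bar>E t xs\<bar>)) \<longlonglongrightarrow> 0"
    unfolding E_def
  proof (rule local_quadratic_expansion[OF K_pos p_strict[OF \<theta>0_in] p_mod[OF \<theta>0_in] gate_frequency])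
    show "(\<lambda>t. sqrt (real t) * (A t r - B t r) - direction t r / p r \<theta>0) \<longlonglongrightarrow> 0" for r
      unfolding A_def B_def by (rule expansion(1))
    show "(\<lambda>t. real t * (p r \<theta>0 * A t r + (1 - p r \<theta>0) * B t r) + (1 - p r \<theta>0) / (2 * p r \<theta>0) * (direction t r)\<^sup>2) \<longlonglongrightarrow> 0" for r
      unfolding A_def B_def by (rule expansion(2))
  qed (assumption | rule Bseq_direction)+
  let ?R = "\<lambda>t xs. log_lr (history_law M G Y (\<theta>t t) t) (history_law M G Y \<theta>0 t) xs
        - (h t \<bullet> normalized_score p lam \<theta>0 t xs
           - (h t \<bullet> (fisher_information K p lam \<theta>0 (\<gamma> \<theta>0) *v h t)) / 2)"
  \<comment> \<open>The identity is only almost sure because \<open>log_lr\<close> comes from a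
    Radon-Nikodym derivative; the premise holds for all large \<open>t\<close>.\<close>
  have RE: "AE xs in path_law ?p t. ?R t xs = E t xs" if t: "\<theta>t t \<in> \<Theta>" for t
  proof -
    have ratio: "ln (p s (\<theta>t t) / p s \<theta>0) = A t (s mod K)" "ln ((1 - p s (\<theta>t t)) / (1 - p s \<theta>0)) = B t (s mod K)" for s
    proof -
      have ps: "p s (\<theta>t t) = 1 - exp (- (lam (s mod K) \<theta>0 + lam_increment t (s mod K)))"
        using p_eq[OF t, of s] lam_mod[OF t, of s] by (simp add: lam_increment_def)
      have p0: "p (s mod K) \<theta>0 = p s \<theta>0" "1 - p s \<theta>0 = exp (- lam (s mod K) \<theta>0)"
        using p_eq[OF \<theta>0_in, of s] lam_mod[OF \<theta>0_in, of s] p_mod[OF \<theta>0_in] by simp_all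
      have q: "1 - p s (\<theta>t t) = (1 - p s \<theta>0) * exp (- lam_increment t (s mod K))"
        unfolding ps p0(2) by (simp add: exp_add[symmetric])
      have pos: "p s \<theta>0 > 0" "1 - p s \<theta>0 > 0"
        using p_strict[OF \<theta>0_in, of s] by simp_all
      have "p s (\<theta>t t) = p s \<theta>0 + (1 - p s \<theta>0) * (1 - exp (- lam_increment t (s mod K)))"
        using q by (simp add: algebra_simps)
      then have "p s (\<theta>t t) / p s \<theta>0 = 1 + (1 - p s \<theta>0) / p s \<theta>0 * (1 - exp (- lam_increment t (s mod K)))"
        using pos by (simp add: add_divide_distrib)
      then show "ln (p s (\<theta>t t) / p s \<theta>0) = A t (s mod K)"
        by (simp only: A_def p0(1))
      show "ln ((1 - p s (\<theta>t t)) / (1 - p s \<theta>0)) = B t (s mod K)"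
        unfolding q using pos by (simp add: B_def)
    qed
    have score: "h t \<bullet> normalized_score p lam \<theta>0 t xs
        = 1 / sqrt (real t) * (\<Sum>s<t. of_bool (fst (xs ! s)) * ((of_bool (snd (xs ! s)) - p s \<theta>0) / p s \<theta>0) * direction t (s mod K))" for xs
      unfolding normalized_score_def direction_def grad_lam_mod[symmetric]
      by (simp only: inner_scaleR_right inner_sum_right)
    have form: "h t \<bullet> (fisher_information K p lam \<theta>0 (\<gamma> \<theta>0) *v h t)
        = (\<Sum>r<K. \<gamma> \<theta>0 r / real K * ((1 - p r \<theta>0) / p r \<theta>0) * (direction t r)\<^sup>2)"
      unfolding direction_def by (rule fisher_information_quadratic_form)
    show ?thesis
      using log_lr_path_law[where p = ?p and p' = "\<lambda>s. p s (\<theta>t t)" and t = t, OF p_strict[OF \<theta>0_in] p_strict[OF t]]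
      unfolding ratio history_law_eq_path_law[OF \<theta>0_in] history_law_eq_path_law[OF t] score form E_def
      by eventually_elim simp
  qed
  fix \<epsilon> :: real
  assume "\<epsilon> > 0"
  have "\<forall>\<^sub>F t in sequentially. norm (measure (history_law M G Y \<theta>0 t) {xs \<in> space (history_law M G Y \<theta>0 t). \<bar>?R t xs\<bar> > \<epsilon>})
      \<le> expect ?p t (\<lambda>xs. \<bar>E t xs\<bar>) / \<epsilon>"
    using eventually_in
  proof eventually_elim
    case (elim t)
    have "measure (path_law ?p t) {xs \<in> histories t. \<bar>?R t xs\<bar> > \<epsilon>} = measure (path_law ?p t) {xs \<in> histories t. \<bar>E t xs\<bar> > \<epsilon>}"
      by (rule measure_eq_AE) (use RE[OF elim] in \<open>auto elim: eventually_mono\<close>)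
    then show ?case
      using measure_path_law_Markov[where p = ?p, OF p_weak[OF \<theta>0_in] \<open>\<epsilon> > 0\<close>, of t "E t"]
      by (simp add: history_law_eq_path_law[OF \<theta>0_in])
  qed
  moreover have "(\<lambda>t. expect ?p t (\<lambda>xs. \<bar>E t xs\<bar>) / \<epsilon>) \<longlonglongrightarrow> 0"
    using tendsto_divide[OF E_lim tendsto_const, of \<epsilon>] \<open>\<epsilon> > 0\<close> by simp
  ultimately show "(\<lambda>t. measure (history_law M G Y \<theta>0 t) {xs \<in> space (history_law M G Y \<theta>0 t). \<bar>?R t xs\<bar> > \<epsilon>}) \<longlonglongrightarrow> 0"
    by (rule Lim_null_comparison)
qed

end

text \<open>In each direction \<open>u\<close> the score is a linear combination of residual sums,
  to which the limit of characteristic functions applies. Tightness follows from Markov's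
  inequality, as residual sums have mean absolute value at most \<open>sqrt t\<close>.\<close>

lemma score_weakly_converges:
  assumes "pos_def_matrix (fisher_information K p lam \<theta>0 (\<gamma> \<theta>0))"
  shows "weakly_converges (\<lambda>t. distr (history_law M G Y \<theta>0 t) borel (normalized_score p lam \<theta>0 t))
           (multivariate_normal 0 (fisher_information K p lam \<theta>0 (\<gamma> \<theta>0)))"
proof -
  let ?p = "\<lambda>s. p s \<theta>0"
  let ?I = "fisher_information K p lam \<theta>0 (\<gamma> \<theta>0)"
  let ?S = "normalized_score p lam \<theta>0"
  let ?\<mu> = "\<lambda>t. distr (history_law M G Y \<theta>0 t) borel (?S t)"
  \<comment> \<open>The gradient with the weight \<open>1 / p r\<close> of the score absorbed: with
    \<open>c r = u \<bullet> g r\<close>, the variance term \<open>p * (1 - p) * c\<^sup>2\<close>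
    becomes the Fisher weight \<open>(1 - p) / p\<close> times the squared directional
    derivative.\<close>
  define g where "g = (\<lambda>r. (1 / p r \<theta>0) *\<^sub>R grad (lam r) \<theta>0)"
  have law: "history_law M G Y \<theta>0 t = path_law ?p t" for t
    by (rule history_law_eq_path_law[OF \<theta>0_in])
  have meas: "?S t \<in> path_law ?p t \<rightarrow>\<^sub>M borel" for t
    by (simp add: path_law_def)
  have p01: "0 \<le> p s \<theta>0 \<and> p s \<theta>0 \<le> 1" for s
    by (rule p_weak[OF \<theta>0_in])
  have prob: "prob_space (?\<mu> t)" for t
    unfolding law by (rule prob_space.prob_space_distr[OF prob_space_path_law[OF p01] meas])
  show ?thesis
  proof (rule weakly_converges_char)
    show "prob_space (?\<mu> t)" for t by (rule prob)
    show "sets (?\<mu> t) = sets borel" for t by simp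
    show "prob_space (multivariate_normal 0 ?I)" by (rule multivariate_normal_char(1)[OF assms])
    show "sets (multivariate_normal 0 ?I) = sets borel" by (simp add: multivariate_normal_def)
    fix u :: "real ^ 'd"
    have "integral\<^sup>L (?\<mu> t) (\<lambda>x. exp (\<i> * of_real (u \<bullet> x)))
        = expect ?p t (\<lambda>xs. exp (\<i> * of_real (1 / sqrt (real t) * (\<Sum>r<K. residual_sum ?p K r t xs * (u \<bullet> g r)))))" for t
    proof -
      have score: "u \<bullet> ?S t xs = 1 / sqrt (real t) * (\<Sum>r<K. residual_sum ?p K r t xs * (u \<bullet> g r))" for xs
        unfolding score_by_residue g_def by (simp only: inner_scaleR_right inner_sum_right)
      have "integral\<^sup>L (?\<mu> t) (\<lambda>x. exp (\<i> * of_real (u \<bullet> x))) = expect ?p t (\<lambda>xs. exp (\<i> * of_real (u \<bullet> ?S t xs)))"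
        unfolding law by (subst integral_distr[OF meas]) (simp_all add: integral_path_law[where p = ?p, OF p01])
      then show ?thesis
        unfolding score .
    qed
    moreover have "u \<bullet> (?I *v u) = (\<Sum>r<K. \<gamma> \<theta>0 r / real K * (p r \<theta>0 * (1 - p r \<theta>0) * (u \<bullet> g r)\<^sup>2))"
      unfolding fisher_information_quadratic_form
    proof (intro sum.cong refl)
      fix r
      have "k * ((1 - a) / a) * w\<^sup>2 = k * (a * (1 - a) * (1 / a * w)\<^sup>2)" if "a \<noteq> 0" for a k w :: real
        using that by (simp add: field_simps power2_eq_square)
      from this[of "p r \<theta>0"] p_strict[OF \<theta>0_in, of r]
      show "\<gamma> \<theta>0 r / real K * ((1 - p r \<theta>0) / p r \<theta>0) * (u \<bullet> grad (lam r) \<theta>0)\<^sup>2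
          = \<gamma> \<theta>0 r / real K * (p r \<theta>0 * (1 - p r \<theta>0) * (u \<bullet> g r)\<^sup>2)"
        unfolding g_def inner_scaleR_right by fastforce
    qed
    ultimately show "(\<lambda>t. integral\<^sup>L (?\<mu> t) (\<lambda>x. exp (\<i> * of_real (u \<bullet> x))))
        \<longlonglongrightarrow> integral\<^sup>L (multivariate_normal 0 ?I) (\<lambda>x. exp (\<i> * of_real (u \<bullet> x)))"
      using char_score_tendsto[where p = ?p and c = "\<lambda>r. u \<bullet> g r" and \<kappa> = "\<lambda>r. \<gamma> \<theta>0 r / real K",
          OF K_pos p_strict[OF \<theta>0_in] p_mod[OF \<theta>0_in] gate_frequency]
      by (simp add: multivariate_normal_char(2)[OF assms])
  next
    fix \<epsilon> :: real
    assume "\<epsilon> > 0"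
    define C where "C = (\<Sum>r<K. norm (g r))"
    \<comment> \<open>\<open>C\<close> bounds the mean norm of the score for all positive
      \<open>t\<close>; adding 1 keeps \<open>R\<close> positive even if all gradients
      vanish.\<close>
    define R where "R = (C + 1) / \<epsilon>"
    have C0: "C \<ge> 0" by (simp add: C_def sum_nonneg)
    then have R: "R > 0" using \<open>\<epsilon> > 0\<close> by (simp add: R_def)
    have "measure (?\<mu> t) {x. norm x > R} \<le> \<epsilon>" if t: "t > 0" for t
    proof -
      have st: "sqrt (real t) > 0" using t by simp
      have norm_S: "norm (?S t xs) \<le> (\<Sum>r<K. \<bar>residual_sum ?p K r t xs\<bar> * (norm (g r) / sqrt (real t)))" for xs
      proof -
        have "norm (?S t xs) = 1 / sqrt (real t) * norm (\<Sum>r<K. residual_sum ?p K r t xs *\<^sub>R g r)"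
          unfolding score_by_residue g_def using st by simp
        also have "\<dots> \<le> 1 / sqrt (real t) * (\<Sum>r<K. \<bar>residual_sum ?p K r t xs\<bar> * norm (g r))"
          using st by (intro mult_left_mono order_trans[OF norm_sum] sum_mono) auto
        finally show ?thesis
          by (simp add: sum_divide_distrib)
      qed
      have "measure (?\<mu> t) {x. norm x > R} = measure (path_law ?p t) {xs \<in> histories t. \<bar>norm (?S t xs)\<bar> > R}"
        unfolding law by (subst measure_distr[OF meas]) (auto intro!: arg_cong[where f = "measure (path_law ?p t)"])
      also have "\<dots> \<le> expect ?p t (\<lambda>xs. \<bar>norm (?S t xs)\<bar>) / R"
        by (rule measure_path_law_Markov[where p = ?p, OF p01 R])
      also have "\<dots> \<le> C / R"
      proof (rule divide_right_mono)
        have "expect ?p t (\<lambda>xs. \<bar>norm (?S t xs)\<bar>)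
            \<le> expect ?p t (\<lambda>xs. \<Sum>r<K. (norm (g r) / sqrt (real t)) * \<bar>residual_sum ?p K r t xs\<bar>)"
          by (rule expect_mono[where p = ?p, OF p01]) (use norm_S in \<open>simp add: mult.commute\<close>)
        also have "\<dots> = (\<Sum>r<K. (norm (g r) / sqrt (real t)) * expect ?p t (\<lambda>xs. \<bar>residual_sum ?p K r t xs\<bar>))"
          by (simp only: expect_sum expect_mult_left)
        also have "\<dots> \<le> (\<Sum>r<K. (norm (g r) / sqrt (real t)) * sqrt (real t))"
          using st by (intro sum_mono mult_left_mono expect_abs_residual_sum_le p01) auto
        also have "\<dots> = C"
          using st by (simp add: C_def)
        finally show "expect ?p t (\<lambda>xs. \<bar>norm (?S t xs)\<bar>) \<le> C" .
      qed (use R in simp)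
      also have "\<dots> \<le> \<epsilon>"
        using C0 \<open>\<epsilon> > 0\<close> by (simp add: R_def field_simps)
      finally show ?thesis .
    qed
    then show "\<exists>R. \<forall>\<^sub>F t in sequentially. measure (?\<mu> t) {x. norm x > R} \<le> \<epsilon>"
      by (intro exI[of _ R] eventually_mono[OF eventually_gt_at_top[of 0]])
  qed
qed

end

theorem proposition2:
  fixes K D :: nat
    and \<Theta> :: "(real ^ 'd) set"
    and p lam :: "nat \<Rightarrow> real ^ 'd \<Rightarrow> real"
    and \<gamma> :: "real ^ 'd \<Rightarrow> nat \<Rightarrow> real"
    and M :: "real ^ 'd \<Rightarrow> 'w measure"
    and G Y :: "nat \<Rightarrow> 'w \<Rightarrow> bool"
    and \<theta>0 :: "real ^ 'd"
    and lam_min lam_max :: real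
  defines "I0 \<equiv> fisher_information K p lam \<theta>0 (\<gamma> \<theta>0)"
    and "P \<equiv> history_law M G Y"
    and "\<Delta> \<equiv> normalized_score p lam \<theta>0"
  assumes "ded_process K D \<Theta> p \<gamma> M G Y"
    and "\<And>t \<theta>. \<theta> \<in> \<Theta> \<Longrightarrow> p t \<theta> = 1 - exp (- lam t \<theta>)"
    and "\<And>t \<theta>. \<theta> \<in> \<Theta> \<Longrightarrow> lam t \<theta> = lam (t mod K) \<theta>"
    and "\<theta>0 \<in> interior \<Theta>"
    and "0 < lam_min" and "lam_min \<le> lam_max"
    and "\<And>r \<theta>. r < K \<Longrightarrow> \<theta> \<in> \<Theta> \<Longrightarrow> lam_min \<le> lam r \<theta> \<and> lam r \<theta> \<le> lam_max"
    and "\<And>r. r < K \<Longrightarrow> \<exists>S g. open S \<and> \<Theta> \<subseteq> S \<and> Ck_on 3 S g \<and> (\<forall>\<theta>\<in>\<Theta>. g \<theta> = lam r \<theta>)"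
    and "\<And>\<theta>. \<theta> \<in> \<Theta> \<Longrightarrow> (\<And>r. r < K \<Longrightarrow> \<gamma> \<theta>0 r > 0 \<Longrightarrow> lam r \<theta> = lam r \<theta>0) \<Longrightarrow> \<theta> = \<theta>0"
    and "compact \<Theta>"
    and "pos_def_matrix I0"
  shows "(\<forall>h :: nat \<Rightarrow> real ^ 'd. bounded (range h) \<longrightarrow>
            mutually_contiguous (\<lambda>t. P (\<theta>0 + (1 / sqrt (real t)) *\<^sub>R h t) t) (\<lambda>t. P \<theta>0 t))
       \<and> (\<forall>h :: nat \<Rightarrow> real ^ 'd. bounded (range h) \<longrightarrow>
            tendsto0_in_prob (\<lambda>t. P \<theta>0 t)
              (\<lambda>t x. log_lr (P (\<theta>0 + (1 / sqrt (real t)) *\<^sub>R h t) t) (P \<theta>0 t) x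
                     - (h t \<bullet> \<Delta> t x - (h t \<bullet> (I0 *v h t)) / 2)))
       \<and> weakly_converges (\<lambda>t. distr (P \<theta>0 t) borel (\<Delta> t)) (multivariate_normal 0 I0)"
proof -
  have differentiable: "lam r differentiable (at \<theta>0)" if r: "r < K" for r
  proof -
    obtain S g where g: "\<Theta> \<subseteq> S" "Ck_on 3 S g" "\<And>\<theta>. \<theta> \<in> \<Theta> \<Longrightarrow> g \<theta> = lam r \<theta>"
      using assms(11)[OF r] by blast
    have sub: "interior \<Theta> \<subseteq> \<Theta>" by (rule interior_subset)
    then have "\<theta>0 \<in> S"
      using assms(7) g(1) by blast
    then have "g differentiable (at \<theta>0)"
      using g(2) by (simp add: eval_nat_numeral)
    then obtain g' where "(g has_derivative g') (at \<theta>0)"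
      unfolding differentiable_def by blast
    \<comment> \<open>\<open>lam r\<close> and its smooth extension are known to agree only on
      \<open>\<Theta>\<close>, which contains a neighbourhood of \<open>\<theta>0\<close>.\<close>
    then have "(lam r has_derivative g') (at \<theta>0)"
      by (rule has_derivative_transform_within_open[OF _ open_interior assms(7)]) (use g(3) sub in blast)
    then show ?thesis
      unfolding differentiable_def by blast
  qed
  interpret regular_ded K D \<Theta> p lam \<gamma> M G Y \<theta>0 lam_min lam_max
    by (rule regular_ded.intro[OF assms(4-8,10) differentiable])
  show ?thesis
    unfolding P_def \<Delta>_def I0_def
    by (intro conjI allI impI local_contiguity local_asymptotic_normality
        score_weakly_converges assms(14)[unfolded I0_def])
qed

end
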